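(* Let $n\ge2$, $m=(m_1,\dots,m_n)\in\mathbb{N}^n$, $|M|=m_1+\cdots+m_n$, and let $\vec v={}^t[s,c_0,c_1,c_2,d_0,d_1,d_2,\delta]$ and $x=(x_1,\dots,x_n)$ be generic complex parameters satisfying the balancing condition $$(c_0+c_1+c_2)+(d_0+d_1+d_2)=(2+|M|)\delta+3s .$$ Define $$\widetilde E^{n,3}(\vec v,x):=\frac{\prod_{0\le k\le2}\Bigl([[\delta+s-c_k]]_{|M|}\prod_{1\le i\le n}[[\delta+s-d_k+x_i]]_{m_i}\Bigr)}{\prod_{1\le i\le n}[[\delta+s+x_i]]_{m_i}}\;E(\vec v,x),$$ where $E(\vec v,x)$ is the $A_n$ elliptic hypergeometric series of rectangular type defined in the context. Then $\widetilde E^{n,3}(\vec v,x)$ is invariant under the action on $(\vec v,x)$ of the transformations $b_1,b_2,s_0,s_1,t_0,t_1$ defined in the context.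
   Context: $[[x]]=\sigma(x;\omega_1,\omega_2)$ is the Weierstrass sigma function with periods $(\omega_1,\omega_2)$ (an odd holomorphic function), $\delta\in\mathbb{C}$ is a fixed constant with $\delta\notin\mathbb{Q}\omega_1+\mathbb{Q}\omega_2$, and $[[z]]_k=[[z]]\,[[z+\delta]]\cdots[[z+(k-1)\delta]]$ for $k=0,1,2,\dots$. For $\gamma\in\mathbb{N}^n$, $|\gamma|=\gamma_1+\cdots+\gamma_n$, $\Delta[x]=\prod_{i<j}[[x_i-x_j]]$, $\Delta[x+\gamma\delta]=\prod_{i<j}[[x_i+\gamma_i\delta-x_j-\gamma_j\delta]]$. With $a_j=-m_j\delta$, the series is $$E(\vec v,x)=\sum_{\gamma\in\mathbb{N}^n}\frac{\Delta[x+\gamma\delta]}{\Delta[x]}\prod_{1\le i\le n}\frac{[[(|\gamma|+\gamma_i)\delta+s+x_i]]}{[[s+x_i]]}\prod_{1\le j\le n}\left(\frac{[[s+x_j]]_{|\gamma|}}{[[\delta+s-a_j+x_j]]_{|\gamma|}}\prod_{1\le i\le n}\frac{[[a_j+x_i-x_j]]_{\gamma_i}}{[[\delta+x_i-x_j]]_{\gamma_i}}\right)\prod_{0\le k\le2}\left(\frac{[[d_k]]_{|\gamma|}}{[[\delta+s-c_k]]_{|\gamma|}}\prod_{1\le i\le n}\frac{[[c_k+x_i]]_{\gamma_i}}{[[\delta+s-d_k+x_i]]_{\gamma_i}}\right),$$ which terminates. The multi-index $m$ is fixed. The transformations (all fixing $\delta$) are: $s_i$ ($i=0,1$) exchanges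 $c_i$ and $c_{i+1}$; $t_i$ ($i=0,1$) exchanges $d_i$ and $d_{i+1}$; these fix everything else; $b_1$ sends $(s,c_0,c_1,c_2,d_0,d_1,d_2)$ to $(2s+\delta-c_0-d_1-d_2,\ s+\delta-d_1-d_2,\ c_1,\ c_2,\ d_0,\ s+\delta-c_0-d_2,\ s+\delta-c_0-d_1)$ and fixes $x$; $b_2$ sends $(s,c_0,c_1,c_2,d_0,d_1,d_2)$ to $(2s+\delta-c_0-c_1-c_2,\ s+\delta-c_1-c_2,\ s+\delta-c_0-c_2,\ s+\delta-c_0-c_1,\ d_0,\ d_1,\ d_2)$ and sends $x_i$ to $\tilde x_i=-m_i\delta-x_i+|M|\delta$ for $1\le i\le n$. "Generic" means that all denominators occurring are nonzero. *)

theory Defs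
  imports "HOL-Analysis.Analysis" "HOL-Complex_Analysis.Weierstrass_Factorization"
begin

definition period_lattice :: "complex \<Rightarrow> complex \<Rightarrow> complex set" where
  "period_lattice \<omega>1 \<omega>2 = {of_int a * \<omega>1 + of_int b * \<omega>2 | a b. True}"

(* The canonical product
     z * PROD w. (1 - z/w) * exp (z/w + z^2/(2 * w^2))
   over the nonzero lattice points, as an unordered limit over finite sets of lattice points. *)
definition weierstrass_sigma :: "complex \<Rightarrow> complex \<Rightarrow> complex \<Rightarrow> complex" where
  "weierstrass_sigma \<omega>1 \<omega>2 z =
     Lim (finite_subsets_at_top (period_lattice \<omega>1 \<omega>2 - {0}))
       (\<lambda>F. z * (\<Prod>w\<in>F. weierstrass_factor 2 (z / w)))"

(* Below, br is the bracket z |-> [[z]]; it is instantiated with a sigma function. *)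

definition shifted_fact :: "(complex \<Rightarrow> complex) \<Rightarrow> complex \<Rightarrow> complex \<Rightarrow> nat \<Rightarrow> complex" where
  "shifted_fact br \<delta> z k = (\<Prod>r<k. br (z + of_nat r * \<delta>))"

definition Delta :: "(complex \<Rightarrow> complex) \<Rightarrow> nat \<Rightarrow> (nat \<Rightarrow> complex) \<Rightarrow> complex" where
  "Delta br n y = (\<Prod>(i, j)\<in>{(i, j). 1 \<le> i \<and> i < j \<and> j \<le> n}. br (y i - y j))"

definition mi_size :: "nat \<Rightarrow> (nat \<Rightarrow> nat) \<Rightarrow> nat" where
  "mi_size n \<gamma> = (\<Sum>i=1..n. \<gamma> i)"

(* A point (s, c, d, \<delta>, x) stands for the vector [s, c 0, c 1, c 2, d 0, d 1, d 2, \<delta>] together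
   with x = (x 1, ..., x n); values of c, d and x at other indices are irrelevant. *)
type_synonym params =
  "complex \<times> (nat \<Rightarrow> complex) \<times> (nat \<Rightarrow> complex) \<times> complex \<times> (nat \<Rightarrow> complex)"

fun E_term ::
  "(complex \<Rightarrow> complex) \<Rightarrow> nat \<Rightarrow> (nat \<Rightarrow> nat) \<Rightarrow> params \<Rightarrow> (nat \<Rightarrow> nat) \<Rightarrow> complex" where
  "E_term br n m (s, c, d, \<delta>, x) \<gamma> =
     (let a = (\<lambda>j. - of_nat (m j) * \<delta>);
          N = mi_size n \<gamma>;
          ph = shifted_fact br \<delta>
      in Delta br n (\<lambda>i. x i + of_nat (\<gamma> i) * \<delta>) / Delta br n x
         * (\<Prod>i=1..n. br (of_nat (N + \<gamma> i) * \<delta> + s + x i) / br (s + x i))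
         * (\<Prod>j=1..n. ph (s + x j) N / ph (\<delta> + s - a j + x j) N
              * (\<Prod>i=1..n. ph (a j + x i - x j) (\<gamma> i) / ph (\<delta> + x i - x j) (\<gamma> i)))
         * (\<Prod>k=0..2. ph (d k) N / ph (\<delta> + s - c k) N
              * (\<Prod>i=1..n. ph (c k + x i) (\<gamma> i) / ph (\<delta> + s - d k + x i) (\<gamma> i))))"

(* The sum ranges over all multi-indices in N^n, encoded as extensional functions on {1..n};
   since br 0 = 0, only finitely many terms are nonzero (see E_series_terminates). *)
definition E_series ::
  "(complex \<Rightarrow> complex) \<Rightarrow> nat \<Rightarrow> (nat \<Rightarrow> nat) \<Rightarrow> params \<Rightarrow> complex" where
  "E_series br n m P = (\<Sum>\<^sub>\<infinity>\<gamma>\<in>{1..n} \<rightarrow>\<^sub>E (UNIV :: nat set). E_term br n m P \<gamma>)"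

lemma E_term_eq_0:
  assumes "br 0 = 0" "i \<in> {1..n}" "m i < \<gamma> i"
  shows "E_term br n m P \<gamma> = 0"
proof -
  obtain s c d \<delta> x where P: "P = (s, c, d, \<delta>, x)"
    by (cases P)
  have "\<exists>r\<in>{..<\<gamma> i}. br (- of_nat (m i) * \<delta> + x i - x i + of_nat r * \<delta>) = 0"
    using assms by (intro bexI[of _ "m i"]) auto
  then have "shifted_fact br \<delta> (- of_nat (m i) * \<delta> + x i - x i) (\<gamma> i) = 0"
    unfolding shifted_fact_def by (intro prod_zero) auto
  then have inner: "(\<Prod>l=1..n. shifted_fact br \<delta> (- of_nat (m i) * \<delta> + x l - x i) (\<gamma> l)
      / shifted_fact br \<delta> (\<delta> + x l - x i) (\<gamma> l)) = 0"
    using assms(2) by (intro prod_zero bexI[of _ i]) simp_all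
  have "(\<Prod>j=1..n. shifted_fact br \<delta> (s + x j) (mi_size n \<gamma>)
        / shifted_fact br \<delta> (\<delta> + s - - of_nat (m j) * \<delta> + x j) (mi_size n \<gamma>)
      * (\<Prod>l=1..n. shifted_fact br \<delta> (- of_nat (m j) * \<delta> + x l - x j) (\<gamma> l)
        / shifted_fact br \<delta> (\<delta> + x l - x j) (\<gamma> l))) = 0"
    by (rule prod_zero) (use assms(2) inner in auto)
  then show ?thesis
    unfolding P E_term.simps Let_def by (simp only: mult_zero_left mult_zero_right)
qed

lemma E_series_terminates:
  assumes "br 0 = 0"
  shows "E_series br n m P = (\<Sum>\<gamma>\<in>(\<Pi>\<^sub>E i\<in>{1..n}. {..m i}). E_term br n m P \<gamma>)"
proof -
  have "E_series br n m P = (\<Sum>\<^sub>\<infinity>\<gamma>\<in>(\<Pi>\<^sub>E i\<in>{1..n}. {..m i}). E_term br n m P \<gamma>)"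
    unfolding E_series_def
  proof (rule infsum_cong_neutral)
    fix \<gamma> assume "\<gamma> \<in> ({1..n} \<rightarrow>\<^sub>E (UNIV :: nat set)) - (\<Pi>\<^sub>E i\<in>{1..n}. {..m i})"
    then obtain i where "i \<in> {1..n}" "m i < \<gamma> i"
      by (auto simp: PiE_iff not_le)
    with assms show "E_term br n m P \<gamma> = 0"
      by (rule E_term_eq_0)
  qed (auto simp: PiE_iff)
  also have "\<dots> = (\<Sum>\<gamma>\<in>(\<Pi>\<^sub>E i\<in>{1..n}. {..m i}). E_term br n m P \<gamma>)"
    by (intro infsum_finite finite_PiE) auto
  finally show ?thesis .
qed

fun E_tilde ::
  "(complex \<Rightarrow> complex) \<Rightarrow> nat \<Rightarrow> (nat \<Rightarrow> nat) \<Rightarrow> params \<Rightarrow> complex" where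
  "E_tilde br n m (s, c, d, \<delta>, x) =
     (let ph = shifted_fact br \<delta>
      in (\<Prod>k=0..2. ph (\<delta> + s - c k) (mi_size n m)
              * (\<Prod>i=1..n. ph (\<delta> + s - d k + x i) (m i)))
         / (\<Prod>i=1..n. ph (\<delta> + s + x i) (m i))
         * E_series br n m (s, c, d, \<delta>, x))"

(* All denominators of E_tilde are nonzero; only the terms with \<gamma> i \<le> m i are concerned,
   as the series terminates there. *)
fun generic ::
  "(complex \<Rightarrow> complex) \<Rightarrow> nat \<Rightarrow> (nat \<Rightarrow> nat) \<Rightarrow> params \<Rightarrow> bool" where
  "generic br n m (s, c, d, \<delta>, x) \<longleftrightarrow>
     (let a = (\<lambda>j. - of_nat (m j) * \<delta>);
          ph = shifted_fact br \<delta>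
      in Delta br n x \<noteq> 0
         \<and> (\<forall>i\<in>{1..n}. br (s + x i) \<noteq> 0 \<and> ph (\<delta> + s + x i) (m i) \<noteq> 0)
         \<and> (\<forall>\<gamma>\<in>(\<Pi>\<^sub>E i\<in>{1..n}. {..m i}).
              (\<forall>j\<in>{1..n}. ph (\<delta> + s - a j + x j) (mi_size n \<gamma>) \<noteq> 0
                 \<and> (\<forall>i\<in>{1..n}. ph (\<delta> + x i - x j) (\<gamma> i) \<noteq> 0))
            \<and> (\<forall>k\<in>{0..2}. ph (\<delta> + s - c k) (mi_size n \<gamma>) \<noteq> 0
                 \<and> (\<forall>i\<in>{1..n}. ph (\<delta> + s - d k + x i) (\<gamma> i) \<noteq> 0))))"

fun balanced :: "nat \<Rightarrow> (nat \<Rightarrow> nat) \<Rightarrow> params \<Rightarrow> bool" where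
  "balanced n m (s, c, d, \<delta>, x) \<longleftrightarrow>
     (c 0 + c 1 + c 2) + (d 0 + d 1 + d 2) = (2 + of_nat (mi_size n m)) * \<delta> + 3 * s"

fun s_tr :: "nat \<Rightarrow> params \<Rightarrow> params" where
  "s_tr i (s, c, d, \<delta>, x) = (s, c(i := c (i + 1), i + 1 := c i), d, \<delta>, x)"

fun t_tr :: "nat \<Rightarrow> params \<Rightarrow> params" where
  "t_tr i (s, c, d, \<delta>, x) = (s, c, d(i := d (i + 1), i + 1 := d i), \<delta>, x)"

fun b1_tr :: "params \<Rightarrow> params" where
  "b1_tr (s, c, d, \<delta>, x) =
     (2 * s + \<delta> - c 0 - d 1 - d 2,
      c(0 := s + \<delta> - d 1 - d 2),
      d(1 := s + \<delta> - c 0 - d 2, 2 := s + \<delta> - c 0 - d 1),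
      \<delta>, x)"

fun b2_tr :: "nat \<Rightarrow> (nat \<Rightarrow> nat) \<Rightarrow> params \<Rightarrow> params" where
  "b2_tr n m (s, c, d, \<delta>, x) =
     (2 * s + \<delta> - c 0 - c 1 - c 2,
      c(0 := s + \<delta> - c 1 - c 2, 1 := s + \<delta> - c 0 - c 2, 2 := s + \<delta> - c 0 - c 1),
      d, \<delta>,
      (\<lambda>i. - of_nat (m i) * \<delta> - x i + of_nat (mi_size n m) * \<delta>))"

end

theory Submission
  imports Defs
begin

text \<open>
  Write \<open>[z]\<close> for the sigma function of the lattice, \<open>N\<close> and \<open>M\<close> for the sizes of the multi-indices
  \<open>\<gamma>\<close> and \<open>m\<close>. The proof has an analytic part, which extracts from the infinite product the
  three-term identity (\<open>sigma_three_term\<close>)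

    \<open>[z+a][z-a][b+c][b-c] + [z+b][z-b][c+a][c-a] + [z+c][z-c][a+b][a-b] = 0\<close>,

  and an algebraic part, which knows of the bracket only this identity, oddness, continuity, the
  isolation of its zeros and \<open>[k \<delta>] \<noteq> 0\<close> for \<open>k \<noteq> 0\<close> (locale \<open>elliptic_bracket\<close>).

  The normalising factor of the series is chosen so that it cancels all denominators that contain a
  \<open>c\<close> or a \<open>d\<close>. What remains (\<open>E_tilde_eq_bailey_sum\<close>) is a sum over \<open>\<gamma> \<le> m\<close> in which each \<open>c\<close>
  contributes a product \<open>c_factor\<close> and each \<open>d\<close> a product \<open>d_factor\<close>, so that the
  permutations \<open>s_tr\<close> and \<open>t_tr\<close> do nothing. Everything else rests on the Jackson sum (\<open>jackson\<close>),
  the evaluation of the same kind of series with two \<open>c\<close> and two \<open>d\<close>. For fixed \<open>c0 + c1\<close> both of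
  its sides are even functions of \<open>(c0 - c1)/2\<close> in the span of the products of \<open>M\<close> factors
  \<open>[u+z][u-z]\<close>. By the three-term identity such a function is determined by its values at \<open>M + 1\<close>
  points in general position. At the \<open>M\<close> points \<open>c0 = - x p - r \<delta>\<close> with \<open>r < m p\<close> the identity is the
  one with \<open>m p\<close> replaced by \<open>r\<close>, true by induction, and at \<open>c0 = s + M \<delta>\<close> only the term \<open>\<gamma> = m\<close>
  survives.

  The invariance under \<open>b1_tr\<close> is Bailey's argument (\<open>bailey_transformation\<close>): the factors of the
  summand with \<open>c0\<close>, \<open>d1\<close>, \<open>d2\<close> that change are the value of a Jackson sum over \<open>\<kappa> \<le> \<gamma>\<close>, and
  after exchanging the two summations the sum over \<open>\<gamma> - \<kappa>\<close> is again a Jackson sum. The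
  transformation \<open>b2_tr\<close> is the composite (\<open>bailey_reflection\<close>) of three instances of \<open>b1_tr\<close>, one for each pairing of a \<open>c\<close> with
  two of the \<open>d\<close>, and of the reversal \<open>\<gamma> \<mapsto> m - \<gamma>\<close> of the order of summation
  (\<open>bailey_sum_reverse\<close>). The parameters in between need not be generic, but they become so under a
  small change of \<open>c0\<close> and \<open>c2\<close>, and both sides are continuous in these.
\<close>

section \<open>The sigma function of a lattice\<close>

locale sigma_lattice =
  fixes \<omega>1 \<omega>2 :: complex
  assumes nondegenerate: "\<omega>1 \<noteq> 0" "\<omega>2 / \<omega>1 \<notin> \<real>"
begin

abbreviation "\<Lambda> \<equiv> period_lattice \<omega>1 \<omega>2"
abbreviation "\<sigma> \<equiv> weierstrass_sigma \<omega>1 \<omega>2"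

lemma lattice_zero [simp]: "0 \<in> \<Lambda>"
  unfolding period_lattice_def by (auto intro!: exI[of _ 0])

lemma lattice_add: "u \<in> \<Lambda> \<Longrightarrow> v \<in> \<Lambda> \<Longrightarrow> u + v \<in> \<Lambda>"
  unfolding period_lattice_def
  by (auto, metis (no_types, opaque_lifting) add.commute add.left_commute distrib_right of_int_add)

lemma lattice_minus_iff [simp]: "- u \<in> \<Lambda> \<longleftrightarrow> u \<in> \<Lambda>"
proof -
  have "- v \<in> \<Lambda>" if "v \<in> \<Lambda>" for v
  proof -
    from that obtain a b :: int where "v = of_int a * \<omega>1 + of_int b * \<omega>2"
      by (auto simp: period_lattice_def)
    then have "- v = of_int (- a) * \<omega>1 + of_int (- b) * \<omega>2"
      by simp
    then show ?thesis
      unfolding period_lattice_def by blast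
  qed
  from this[of u] this[of "- u"] show ?thesis
    by auto
qed

lemma lattice_diff: "u \<in> \<Lambda> \<Longrightarrow> v \<in> \<Lambda> \<Longrightarrow> u - v \<in> \<Lambda>"
  using lattice_add[of u "- v"] by simp

lemma lattice_add_iff: "w \<in> \<Lambda> \<Longrightarrow> u + w \<in> \<Lambda> \<longleftrightarrow> u \<in> \<Lambda>"
  using lattice_add[of u w] lattice_diff[of "u + w" w] by auto

lemma lattice_norm_bound:
  obtains C :: real where "C > 0"
    "\<And>a b :: int. \<bar>of_int a\<bar> + \<bar>of_int b\<bar> \<le> C * norm (of_int a * \<omega>1 + of_int b * \<omega>2)"
proof -
  define \<tau> where "\<tau> = \<omega>2 / \<omega>1"
  have im: "Im \<tau> \<noteq> 0"
    using nondegenerate(2) complex_is_Real_iff unfolding \<tau>_def by blast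
  define C where "C = (1 + (norm \<tau> + 1) / \<bar>Im \<tau>\<bar>) / norm \<omega>1"
  have pos: "C > 0"
    unfolding C_def using im nondegenerate(1)
    by (intro divide_pos_pos add_pos_nonneg divide_nonneg_pos) auto
  have "\<bar>of_int a\<bar> + \<bar>of_int b\<bar> \<le> C * norm (of_int a * \<omega>1 + of_int b * \<omega>2)" for a b :: int
  proof -
    define r where "r = norm (of_int a + of_int b * \<tau>)"
    have eq: "norm (of_int a * \<omega>1 + of_int b * \<omega>2) = norm \<omega>1 * r"
    proof -
      have "of_int a * \<omega>1 + of_int b * \<omega>2 = \<omega>1 * (of_int a + of_int b * \<tau>)"
        unfolding \<tau>_def using nondegenerate(1) by (simp add: field_simps)
      then show ?thesis
        by (simp add: norm_mult r_def)
    qed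
    have "\<bar>of_int b\<bar> * \<bar>Im \<tau>\<bar> \<le> r"
      using abs_Im_le_cmod[of "of_int a + of_int b * \<tau>"] by (simp add: r_def abs_mult)
    then have b: "\<bar>of_int b\<bar> \<le> r / \<bar>Im \<tau>\<bar>"
      using im by (simp add: field_simps)
    have "norm (of_int a :: complex) \<le> r + norm (of_int b * \<tau>)"
      using norm_triangle_ineq4[of "of_int a + of_int b * \<tau>" "of_int b * \<tau>"] by (simp add: r_def)
    then have a: "\<bar>of_int a\<bar> \<le> r + \<bar>of_int b\<bar> * norm \<tau>"
      by (simp add: norm_mult)
    have "\<bar>of_int a\<bar> + \<bar>of_int b\<bar> \<le> r + \<bar>of_int b\<bar> * (norm \<tau> + 1)"
      using a by (simp add: algebra_simps)
    also have "\<dots> \<le> r + r / \<bar>Im \<tau>\<bar> * (norm \<tau> + 1)"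
      by (intro add_left_mono mult_right_mono b) auto
    also have "\<dots> = C * (norm \<omega>1 * r)"
      using nondegenerate(1) im by (simp add: C_def field_simps)
    finally show ?thesis
      by (simp add: eq)
  qed
  with pos that show ?thesis
    by blast
qed

lemma summable_int_powr: "(\<lambda>a::int. (1 + \<bar>real_of_int a\<bar>) powr (-3/2)) summable_on UNIV"
proof -
  have "summable (\<lambda>n. real (Suc n) powr (-3/2))"
    by (subst summable_Suc_iff) (simp add: summable_real_powr_iff)
  then have nat: "(\<lambda>n::nat. (1 + real n) powr (-3/2)) summable_on UNIV"
    by (intro norm_summable_imp_summable_on) (simp add: algebra_simps)
  have "(\<lambda>a. (1 + \<bar>real_of_int a\<bar>) powr (-3/2)) summable_on range int"
    by (subst summable_on_reindex) (use nat in \<open>auto simp: o_def\<close>)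
  moreover have "(\<lambda>a. (1 + \<bar>real_of_int a\<bar>) powr (-3/2)) summable_on range (\<lambda>n. - int n)"
    by (subst summable_on_reindex) (use nat in \<open>auto simp: o_def inj_on_def\<close>)
  ultimately have "(\<lambda>a. (1 + \<bar>real_of_int a\<bar>) powr (-3/2)) summable_on
      (range int \<union> range (\<lambda>n. - int n))"
    by (rule summable_on_union)
  moreover have "range int \<union> range (\<lambda>n. - int n) = UNIV"
  proof -
    have "z \<in> range int \<union> range (\<lambda>n. - int n)" for z :: int
      by (cases z rule: int_cases2) auto
    then show ?thesis by blast
  qed
  ultimately show ?thesis
    by simp
qed

text \<open>
  The index \<open>(a, b)\<close> has \<open>2 (\<bar>a\<bar> + \<bar>b\<bar>) \<ge> 1 + \<bar>a\<bar>\<close> and \<open>\<ge> 1 + \<bar>b\<bar>\<close>, so that half of the exponent \<open>3\<close>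
  may be spent on each coordinate; this leaves a product of two convergent simple series.
\<close>
lemma lattice_cube_summable: "(\<lambda>w. 1 / norm w ^ 3) summable_on (\<Lambda> - {0})"
proof -
  obtain C where C: "C > 0"
    "\<And>a b :: int. \<bar>of_int a\<bar> + \<bar>of_int b\<bar> \<le> C * norm (of_int a * \<omega>1 + of_int b * \<omega>2)"
    using lattice_norm_bound by blast
  define u where "u = (\<lambda>(a :: int, b :: int). of_int a * \<omega>1 + of_int b * \<omega>2)"
  define \<phi> where "\<phi> = (\<lambda>a :: int. (1 + \<bar>real_of_int a\<bar>) powr (-3/2))"
  have inj: "inj u"
  proof (rule injI, clarify)
    fix a b a' b' :: int
    assume "u (a, b) = u (a', b')"
    then have "of_int (a - a') * \<omega>1 + of_int (b - b') * \<omega>2 = 0"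
      by (simp add: u_def algebra_simps)
    then have "\<bar>real_of_int (a - a')\<bar> + \<bar>real_of_int (b - b')\<bar> \<le> 0"
      using C(2)[of "a - a'" "b - b'"] by simp
    then show "a = a' \<and> b = b'"
      by linarith
  qed
  have "\<Lambda> = range u"
    by (auto simp: period_lattice_def u_def image_def)
  then have im: "\<Lambda> - {0} = u ` (UNIV - {(0, 0)})"
  proof -
    have "u (0, 0) = 0"
      by (simp add: u_def)
    then have "u p = 0 \<longleftrightarrow> p = (0, 0)" for p
      using injD[OF inj, of p "(0, 0)"] by auto
    then show ?thesis
      using \<open>\<Lambda> = range u\<close> by auto
  qed
  have prod: "(\<lambda>(a, b). \<phi> a * \<phi> b) summable_on (UNIV \<times> UNIV)"
  proof (rule summable_on_SigmaI[where g = "\<lambda>a. \<phi> a * infsum \<phi> UNIV"])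
    show "((\<lambda>b. case (a, b) of (a, b) \<Rightarrow> \<phi> a * \<phi> b) has_sum \<phi> a * infsum \<phi> UNIV) UNIV" for a
      using summable_int_powr by (auto simp: \<phi>_def intro!: has_sum_cmult_right has_sum_infsum)
    show "(\<lambda>a. \<phi> a * infsum \<phi> UNIV) summable_on UNIV"
      using summable_int_powr by (auto simp: \<phi>_def intro!: summable_on_cmult_left)
  qed (auto simp: \<phi>_def)
  have "(\<lambda>p. (2 * C) ^ 3 * (case p of (a, b) \<Rightarrow> \<phi> a * \<phi> b)) summable_on (UNIV \<times> UNIV)"
    by (intro summable_on_cmult_right prod)
  then have maj: "(\<lambda>p. (2 * C) ^ 3 * (case p of (a, b) \<Rightarrow> \<phi> a * \<phi> b)) summable_on (UNIV - {(0, 0)})"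
    by (rule summable_on_subset_banach) auto
  have "(\<lambda>p. 1 / norm (u p) ^ 3) summable_on (UNIV - {(0, 0)})"
  proof (rule summable_on_comparison_test[OF maj])
    fix p :: "int \<times> int"
    assume "p \<in> UNIV - {(0, 0)}"
    then obtain a b where p: "p = (a, b)" "(a, b) \<noteq> (0, 0)"
      by (cases p) auto
    define t where "t = \<bar>real_of_int a\<bar> + \<bar>real_of_int b\<bar>"
    have t: "t \<ge> 1"
      using p(2) unfolding t_def by (cases "a = 0") auto
    have tu: "t \<le> C * norm (u p)"
      using C(2)[of a b] by (simp add: t_def u_def p)
    then have u0: "norm (u p) > 0"
      using t C(1) by (smt (verit) mult_nonneg_nonpos norm_ge_zero)
    have "(1 + \<bar>real_of_int a\<bar>) powr (3/2) * (1 + \<bar>real_of_int b\<bar>) powr (3/2)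
        \<le> (2 * t) powr (3/2) * (2 * t) powr (3/2)"
      using t by (intro mult_mono powr_mono2) (auto simp: t_def)
    also have "\<dots> = (2 * t) ^ 3"
      using t powr_realpow[of "2 * t" 3] by (simp add: powr_add[symmetric])
    also have "\<dots> \<le> (2 * (C * norm (u p))) ^ 3"
      using t tu by (intro power_mono) auto
    finally have "(1 + \<bar>real_of_int a\<bar>) powr (3/2) * (1 + \<bar>real_of_int b\<bar>) powr (3/2)
        \<le> (2 * C) ^ 3 * norm (u p) ^ 3"
      by (simp add: power_mult_distrib mult_ac)
    then show "1 / norm (u p) ^ 3 \<le> (2 * C) ^ 3 * (case p of (a, b) \<Rightarrow> \<phi> a * \<phi> b)"
      using u0 by (simp add: p \<phi>_def powr_minus field_simps)
  qed auto
  then show ?thesis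
    unfolding im by (subst summable_on_reindex) (use inj in \<open>auto simp: o_def intro: inj_on_subset\<close>)
qed

lemma countable_lattice: "countable \<Lambda>"
proof -
  have "\<Lambda> = range (\<lambda>(a :: int, b :: int). of_int a * \<omega>1 + of_int b * \<omega>2)"
    by (auto simp: period_lattice_def image_def)
  then show ?thesis
    by simp
qed

lemma lattice_enumeration:
  obtains a :: "nat \<Rightarrow> complex" where "bij_betw a UNIV (\<Lambda> - {0})"
    "weierstrass_product a (\<lambda>_. 2)"
proof -
  have "countable (\<Lambda> - {0})"
    using countable_lattice by (rule countable_subset[rotated]) auto
  moreover have "infinite (\<Lambda> - {0})"
  proof -
    have "inj (\<lambda>k::nat. of_nat (Suc k) * \<omega>1)"
      using nondegenerate(1) by (auto simp: inj_def simp del: of_nat_Suc)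
    moreover have "range (\<lambda>k::nat. of_nat (Suc k) * \<omega>1) \<subseteq> \<Lambda> - {0}"
    proof safe
      fix k :: nat
      show "of_nat (Suc k) * \<omega>1 \<in> \<Lambda>"
        unfolding period_lattice_def
        by (rule CollectI, intro exI[of _ "int (Suc k)"] exI[of _ 0]) simp
      assume "of_nat (Suc k) * \<omega>1 = 0"
      then show False
        using nondegenerate(1) by (metis mult_eq_0_iff of_nat_eq_0_iff nat.distinct(1))
    qed
    ultimately show ?thesis
      by (meson infinite_super range_inj_infinite)
  qed
  ultimately obtain a :: "nat \<Rightarrow> complex" where a: "bij_betw a UNIV (\<Lambda> - {0})"
    using bij_betw_from_nat_into by blast
  have sum: "summable (\<lambda>n. 1 / norm (a n) ^ 3)"
    using lattice_cube_summable summable_on_reindex_bij_betw[OF a, of "\<lambda>w. 1 / norm w ^ 3"]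
    by (auto dest: summable_on_imp_summable)
  have nz: "a n \<noteq> 0" for n
    using a by (auto simp: bij_betw_def)
  have "weierstrass_product a (\<lambda>_. 2)"
  proof
    have "(\<lambda>n. 1 / norm (a n) ^ 3) \<longlonglongrightarrow> 0"
      using sum by (rule summable_LIMSEQ_zero)
    then have "filterlim (\<lambda>n. norm (a n) ^ 3) at_top sequentially"
      using filterlim_inverse_at_top[of "\<lambda>n. 1 / norm (a n) ^ 3" sequentially] nz
      by (auto simp: eventually_sequentially)
    have "filterlim (\<lambda>n. norm (a n)) at_top sequentially"
      unfolding filterlim_at_top
    proof
      fix Z :: real
      have "\<forall>\<^sub>F n in sequentially. Z ^ 3 \<le> norm (a n) ^ 3"
        using \<open>filterlim (\<lambda>n. norm (a n) ^ 3) at_top sequentially\<close> unfolding filterlim_at_top by blast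
      then show "\<forall>\<^sub>F n in sequentially. Z \<le> norm (a n)"
        by eventually_elim (metis norm_ge_zero not_le power_strict_mono zero_less_numeral)
    qed
    then show "filterlim a at_infinity sequentially"
      by (simp add: filterlim_at_infinity_imp_norm_at_top filterlim_norm_at_top_imp_at_infinity)
    show "summable (\<lambda>n. (r / norm (a n)) ^ Suc 2)" if "r > 0" for r
      using summable_mult[OF sum, of "r ^ 3"] by (simp add: power_divide eval_nat_numeral)
  qed (fact nz)
  with a that show ?thesis
    by blast
qed

text \<open>
  An absolutely convergent product may be multiplied up in any order, so the product over an
  enumeration of the lattice is also the limit over its finite subsets.
\<close>
lemma unordered_product_limit:
  fixes g :: "nat \<Rightarrow> complex"
  assumes sum: "summable (\<lambda>n. norm (g n - 1))" and prod: "g has_prod p"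
  shows "((\<lambda>F. \<Prod>n\<in>F. g n) \<longlongrightarrow> p) (finite_subsets_at_top UNIV)"
proof -
  define P where "P N = (\<Prod>n<N. g n)" for N
  have P: "P \<longlonglongrightarrow> p"
  proof -
    have "(\<lambda>N. \<Prod>n\<le>N. g n) \<longlonglongrightarrow> p"
      using prod by (metis convergent_prod_LIMSEQ has_prod_iff)
    then have "(\<lambda>N. P (Suc N)) \<longlonglongrightarrow> p"
      by (simp add: P_def lessThan_Suc_atMost)
    then show ?thesis
      by (rule LIMSEQ_imp_Suc)
  qed
  define T where "T N = exp (\<Sum>n. norm (g (n + N) - 1)) - 1" for N
  have T: "T \<longlonglongrightarrow> 0"
  proof -
    have "(\<lambda>N. \<Sum>n. norm (g (n + N) - 1)) \<longlonglongrightarrow> 0"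
      using suminf_exist_split2[OF sum] .
    then have "(\<lambda>N. exp (\<Sum>n. norm (g (n + N) - 1)) - 1) \<longlonglongrightarrow> exp 0 - 1"
      by (intro tendsto_intros)
    then show ?thesis
      by (simp add: T_def[abs_def])
  qed
  have "(\<lambda>N. norm (P N) * T N + norm (P N - p)) \<longlonglongrightarrow> norm p * 0 + norm (p - p)"
    by (intro tendsto_intros P T)
  then have lim: "(\<lambda>N. norm (P N) * T N + norm (P N - p)) \<longlonglongrightarrow> 0"
    by simp
  show ?thesis
  proof (rule tendstoI)
    fix e :: real
    assume "e > 0"
    with lim have "\<forall>\<^sub>F N in sequentially. norm (P N) * T N + norm (P N - p) < e"
      by (rule order_tendstoD)
    then obtain N where N: "norm (P N) * T N + norm (P N - p) < e"
      by (auto simp: eventually_sequentially)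
    have "\<forall>\<^sub>F F in finite_subsets_at_top UNIV. finite F \<and> {..<N} \<subseteq> F"
      by (auto simp: eventually_finite_subsets_at_top intro!: exI[of _ "{..<N}"])
    then show "\<forall>\<^sub>F F in finite_subsets_at_top UNIV. dist (\<Prod>n\<in>F. g n) p < e"
    proof eventually_elim
      case (elim F)
      define K where "K = F - {..<N}"
      have fin: "finite K"
        using elim by (simp add: K_def)
      have "norm ((\<Prod>n\<in>K. g n) - 1) \<le> (\<Prod>n\<in>K. 1 + norm (g n - 1)) - 1"
        using norm_prod_minus1_le_prod_minus1[of "\<lambda>n. g n - 1" K] by simp
      also have "(\<Prod>n\<in>K. 1 + norm (g n - 1)) \<le> exp (\<Sum>n\<in>K. norm (g n - 1))"
        unfolding exp_sum[OF fin] by (intro prod_mono) (auto simp: add_nonneg_nonneg)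
      also have "(\<Sum>n\<in>K. norm (g n - 1)) = (\<Sum>n\<in>(\<lambda>n. n - N) ` K. norm (g (n + N) - 1))"
        by (subst sum.reindex) (auto simp: K_def inj_on_def intro!: sum.cong)
      also have "\<dots> \<le> (\<Sum>n. norm (g (n + N) - 1))"
        using fin by (intro sum_le_suminf summable_ignore_initial_segment[OF sum]) auto
      finally have K: "norm ((\<Prod>n\<in>K. g n) - 1) \<le> T N"
        by (simp add: T_def)
      have F: "(\<Prod>n\<in>F. g n) = P N * (\<Prod>n\<in>K. g n)"
        using elim prod.subset_diff[of "{..<N}" F g] by (simp add: P_def K_def mult.commute)
      have "(\<Prod>n\<in>F. g n) - p = P N * ((\<Prod>n\<in>K. g n) - 1) + (P N - p)"
        unfolding F by (simp add: algebra_simps)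
      then have "norm ((\<Prod>n\<in>F. g n) - p) \<le> norm (P N) * norm ((\<Prod>n\<in>K. g n) - 1) + norm (P N - p)"
        by (metis norm_mult norm_triangle_ineq)
      also have "\<dots> \<le> norm (P N) * T N + norm (P N - p)"
        by (intro add_right_mono mult_left_mono K) auto
      also have "\<dots> < e"
        by (fact N)
      finally show ?case
        by (simp add: dist_norm)
    qed
  qed
qed

text \<open>
  The quotient \<open>\<sigma> z / z\<close>. Along an enumeration of the nonzero lattice points it is a Weierstrass
  product, which gives its holomorphy and its zeros.
\<close>
definition sigma_cofactor :: "complex \<Rightarrow> complex" where
  "sigma_cofactor z =
     Lim (finite_subsets_at_top (\<Lambda> - {0})) (\<lambda>F. \<Prod>w\<in>F. weierstrass_factor 2 (z / w))"

lemma
  shows sigma_cofactor_tendsto: "((\<lambda>F. \<Prod>w\<in>F. weierstrass_factor 2 (z / w)) \<longlongrightarrow> sigma_cofactor z)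
      (finite_subsets_at_top (\<Lambda> - {0}))"
    and sigma_cofactor_holomorphic: "sigma_cofactor holomorphic_on UNIV"
    and sigma_cofactor_eq_0_iff: "sigma_cofactor z = 0 \<longleftrightarrow> z \<in> \<Lambda> - {0}"
    and lattice_discrete: "\<not> z islimpt (\<Lambda> - {0})"
proof -
  obtain a :: "nat \<Rightarrow> complex" where a: "bij_betw a UNIV (\<Lambda> - {0})"
    and wp: "weierstrass_product a (\<lambda>_. 2)"
    using lattice_enumeration by blast
  interpret W: weierstrass_product a "\<lambda>_. 2"
    by (fact wp)
  have inj: "inj a" and ran: "range a = \<Lambda> - {0}"
    using a by (auto simp: bij_betw_def)
  have lim: "((\<lambda>F. \<Prod>w\<in>F. weierstrass_factor 2 (z / w)) \<longlongrightarrow> W.f z) (finite_subsets_at_top (\<Lambda> - {0}))" for z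
  proof -
    have "((\<lambda>F. \<Prod>n\<in>F. weierstrass_factor 2 (z / a n)) \<longlongrightarrow> W.f z) (finite_subsets_at_top UNIV)"
      using W.abs_convergent[of z] W.has_prod[of z]
      by (intro unordered_product_limit) (auto simp: abs_convergent_prod_conv_summable)
    moreover have "(\<Prod>w\<in>a ` F. weierstrass_factor 2 (z / w)) = (\<Prod>n\<in>F. weierstrass_factor 2 (z / a n))" for F
      using inj by (subst prod.reindex) (auto simp: o_def intro: inj_on_subset)
    ultimately have "((\<lambda>F. \<Prod>w\<in>a ` F. weierstrass_factor 2 (z / w)) \<longlongrightarrow> W.f z) (finite_subsets_at_top UNIV)"
      by simp
    then show ?thesis
      using filtermap_image_finite_subsets_at_top[OF inj] unfolding ran
      by (metis filterlim_filtermap)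
  qed
  have f: "sigma_cofactor = W.f"
    unfolding sigma_cofactor_def by (intro ext tendsto_Lim lim) auto
  show "((\<lambda>F. \<Prod>w\<in>F. weierstrass_factor 2 (z / w)) \<longlongrightarrow> sigma_cofactor z)
      (finite_subsets_at_top (\<Lambda> - {0}))"
    unfolding f by (fact lim)
  show "sigma_cofactor holomorphic_on UNIV"
    unfolding f by (fact W.holomorphic)
  show "sigma_cofactor z = 0 \<longleftrightarrow> z \<in> \<Lambda> - {0}" "\<not> z islimpt (\<Lambda> - {0})"
    using W.zero[of z] W.not_islimpt_range_a[of z] unfolding f ran by auto
qed

lemma sigma_eq: "\<sigma> z = z * sigma_cofactor z"
  unfolding weierstrass_sigma_def
  by (intro tendsto_Lim tendsto_intros sigma_cofactor_tendsto) auto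

lemma sigma_holomorphic: "\<sigma> holomorphic_on A"
proof -
  have "\<sigma> = (\<lambda>z. z * sigma_cofactor z)"
    using sigma_eq by blast
  moreover have "(\<lambda>z. z * sigma_cofactor z) holomorphic_on UNIV"
    by (intro holomorphic_intros sigma_cofactor_holomorphic)
  ultimately show ?thesis
    using holomorphic_on_subset by auto
qed

lemma sigma_isCont: "isCont \<sigma> z"
  using sigma_holomorphic[of UNIV] by (meson UNIV_I continuous_on_eq_continuous_at holomorphic_on_imp_continuous_on open_UNIV)

lemma sigma_eq_0_iff: "\<sigma> z = 0 \<longleftrightarrow> z \<in> \<Lambda>"
  by (cases "z = 0") (auto simp: sigma_eq sigma_cofactor_eq_0_iff)

lemma sigma_isolated_zeros: "\<forall>\<^sub>F w in at z. \<sigma> w \<noteq> 0"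
proof -
  have "\<not> z islimpt insert 0 (\<Lambda> - {0})"
    unfolding islimpt_insert by (rule lattice_discrete)
  then have "\<not> z islimpt \<Lambda>"
    by (simp add: insert_absorb)
  then show ?thesis
    by (simp add: islimpt_iff_eventually sigma_eq_0_iff)
qed

lemma sigma_deriv_0: "deriv \<sigma> 0 \<noteq> 0"
proof -
  have "(sigma_cofactor has_field_derivative deriv sigma_cofactor 0) (at 0)"
    using sigma_cofactor_holomorphic by (simp add: holomorphic_derivI)
  then have "((\<lambda>z. z * sigma_cofactor z) has_field_derivative sigma_cofactor 0) (at 0)"
    by (auto intro!: derivative_eq_intros)
  moreover have "\<sigma> = (\<lambda>z. z * sigma_cofactor z)"
    using sigma_eq by blast
  ultimately show ?thesis
    by (simp add: DERIV_imp_deriv sigma_cofactor_eq_0_iff)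
qed

text \<open>
  The origin contributes the factor \<open>z\<close>. It is allowed in \<open>F\<close> so that \<open>F\<close> ranges over the finite sets of
  all lattice points, which translations by periods permute.
\<close>
definition partial_sigma :: "complex set \<Rightarrow> complex \<Rightarrow> complex" where
  "partial_sigma F z = z * (\<Prod>w\<in>F - {0}. weierstrass_factor 2 (z / w))"

lemma partial_sigma_tendsto: "((\<lambda>F. partial_sigma F z) \<longlongrightarrow> \<sigma> z) (finite_subsets_at_top \<Lambda>)"
proof -
  have "filterlim (\<lambda>F. F - {0}) (finite_subsets_at_top (\<Lambda> - {0})) (finite_subsets_at_top \<Lambda>)"
    unfolding filterlim_iff
  proof (intro allI impI)
    fix P assume "\<forall>\<^sub>F F in finite_subsets_at_top (\<Lambda> - {0}). P F"
    then obtain X where X: "finite X" "X \<subseteq> \<Lambda> - {0}"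
      "\<And>Y. finite Y \<Longrightarrow> X \<subseteq> Y \<Longrightarrow> Y \<subseteq> \<Lambda> - {0} \<Longrightarrow> P Y"
      unfolding eventually_finite_subsets_at_top by metis
    have "P (Y - {0})" if "finite Y" "X \<subseteq> Y" "Y \<subseteq> \<Lambda>" for Y
      using X(2) that by (intro X(3)) auto
    then show "\<forall>\<^sub>F F in finite_subsets_at_top \<Lambda>. P (F - {0})"
      unfolding eventually_finite_subsets_at_top using X by (intro exI[of _ X]) auto
  qed
  then have "((\<lambda>F. \<Prod>w\<in>F - {0}. weierstrass_factor 2 (z / w)) \<longlongrightarrow> sigma_cofactor z)
      (finite_subsets_at_top \<Lambda>)"
    by (rule filterlim_compose[OF sigma_cofactor_tendsto])
  then show ?thesis
    unfolding partial_sigma_def sigma_eq by (rule tendsto_mult_left)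
qed

lemma sigma_odd: "\<sigma> (- z) = - \<sigma> z"
proof -
  have refl: "partial_sigma (uminus ` F) (- z) = - partial_sigma F z" for F
  proof -
    have "uminus ` F - {0} = uminus ` (F - {0})"
      by auto
    then show ?thesis
      by (simp add: partial_sigma_def prod.reindex)
  qed
  have "uminus ` \<Lambda> = \<Lambda>"
    by (auto simp: image_iff intro!: bexI[of _ "- x" for x])
  then have "filterlim ((`) uminus) (finite_subsets_at_top \<Lambda>) (finite_subsets_at_top \<Lambda>)"
    using filtermap_image_finite_subsets_at_top[of uminus \<Lambda>] by (simp add: filterlim_def)
  then have "((\<lambda>F. partial_sigma (uminus ` F) (- z)) \<longlongrightarrow> \<sigma> (- z)) (finite_subsets_at_top \<Lambda>)"
    by (rule filterlim_compose[OF partial_sigma_tendsto])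
  moreover have "((\<lambda>F. - partial_sigma F z) \<longlongrightarrow> - \<sigma> z) (finite_subsets_at_top \<Lambda>)"
    by (intro tendsto_intros partial_sigma_tendsto)
  ultimately show ?thesis
    unfolding refl by (rule tendsto_unique[OF finite_subsets_at_top_neq_bot])
qed

text \<open>
  The zeros of a partial product are separated from its convergence factors, which make up the
  exponential of a quadratic polynomial.
\<close>
lemma partial_sigma_form:
  assumes "finite F" "0 \<in> F"
  obtains C A B where "C \<noteq> 0"
    "\<And>z. partial_sigma F z = C * (\<Prod>w\<in>F. z - w) * exp (A * z + B * z\<^sup>2)"
proof -
  define C where "C = (\<Prod>w\<in>F - {0}. - 1 / w)"
  define A where "A = (\<Sum>w\<in>F - {0}. 1 / w)"
  define B where "B = (\<Sum>w\<in>F - {0}. 1 / (2 * w\<^sup>2))"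
  have "partial_sigma F z = C * (\<Prod>w\<in>F. z - w) * exp (A * z + B * z\<^sup>2)" for z
  proof -
    have "(\<Prod>w\<in>F - {0}. weierstrass_factor 2 (z / w))
        = (\<Prod>w\<in>F - {0}. - 1 / w * (z - w) * exp (1 / w * z + 1 / (2 * w\<^sup>2) * z\<^sup>2))"
      by (intro prod.cong) (auto simp: weierstrass_factor_def field_simps eval_nat_numeral)
    also have "\<dots> = C * (\<Prod>w\<in>F - {0}. z - w) * exp (A * z + B * z\<^sup>2)"
      using assms(1)
      by (simp only: prod.distrib C_def A_def B_def sum_distrib_right sum.distrib[symmetric]
          exp_sum finite_Diff)
    finally show ?thesis
      using assms by (simp add: partial_sigma_def prod.remove[of F 0])
  qed
  moreover have "C \<noteq> 0"
    using assms(1) by (simp add: C_def)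
  ultimately show ?thesis
    using that by blast
qed

text \<open>
  The functions \<open>S (z + \<omega>)\<close> and \<open>S' z\<close> have the same zeros and therefore differ only by a factor
  \<open>k exp (\<beta> z + \<epsilon> z\<^sup>2)\<close>. In the symmetric second difference the constant and the linear part
  cancel.
\<close>
lemma partial_sigma_shift:
  assumes "finite F" "0 \<in> F" "\<omega> \<in> F"
  shows "\<exists>\<epsilon>. \<forall>z h. let S = partial_sigma F; S' = partial_sigma ((\<lambda>w. w - \<omega>) ` F) in
    S (z + h + \<omega>) * S (z - h + \<omega>) * (S' z)\<^sup>2
      = exp (2 * \<epsilon> * h\<^sup>2) * (S' (z + h) * S' (z - h) * (S (z + \<omega>))\<^sup>2)"
proof -
  let ?F' = "(\<lambda>w. w - \<omega>) ` F"
  obtain C A B where C: "C \<noteq> 0"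
    "\<And>z. partial_sigma F z = C * (\<Prod>w\<in>F. z - w) * exp (A * z + B * z\<^sup>2)"
    using partial_sigma_form assms by metis
  have "finite ?F'" "0 \<in> ?F'"
    using assms by auto
  then obtain C' A' B' where C': "C' \<noteq> 0"
    "\<And>z. partial_sigma ?F' z = C' * (\<Prod>w\<in>?F'. z - w) * exp (A' * z + B' * z\<^sup>2)"
    using partial_sigma_form by metis
  define k where "k = C / C' * exp (A * \<omega> + B * \<omega>\<^sup>2)"
  define \<beta> where "\<beta> = A + 2 * B * \<omega> - A'"
  define \<epsilon> where "\<epsilon> = B - B'"
  have shift: "partial_sigma F (z + \<omega>) = partial_sigma ?F' z * (k * exp (\<beta> * z + \<epsilon> * z\<^sup>2))" for z
  proof -
    have "(\<Prod>w\<in>?F'. z - w) = (\<Prod>w\<in>F. z + \<omega> - w)"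
      by (subst prod.reindex) (auto simp: inj_on_def algebra_simps)
    moreover have "exp (A * (z + \<omega>) + B * (z + \<omega>)\<^sup>2)
        = exp (A' * z + B' * z\<^sup>2) * (exp (A * \<omega> + B * \<omega>\<^sup>2) * exp (\<beta> * z + \<epsilon> * z\<^sup>2))"
      by (simp add: \<beta>_def \<epsilon>_def exp_add[symmetric] algebra_simps power2_eq_square)
    ultimately show ?thesis
      using C'(1) by (simp add: C(2) C'(2) k_def)
  qed
  have e: "exp (\<beta> * (z + h) + \<epsilon> * (z + h)\<^sup>2) * exp (\<beta> * (z - h) + \<epsilon> * (z - h)\<^sup>2)
      = exp (2 * \<epsilon> * h\<^sup>2) * (exp (\<beta> * z + \<epsilon> * z\<^sup>2))\<^sup>2" for z h
    by (simp add: exp_add[symmetric] power2_eq_square algebra_simps)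
  show ?thesis
  proof (intro exI[of _ \<epsilon>] allI, unfold Let_def)
    fix z h
    let ?e = "\<lambda>z. exp (\<beta> * z + \<epsilon> * z\<^sup>2)"
    let ?S' = "partial_sigma ?F'"
    have "partial_sigma F (z + h + \<omega>) * partial_sigma F (z - h + \<omega>) * (?S' z)\<^sup>2
        = (?e (z + h) * ?e (z - h)) * k\<^sup>2 * (?S' (z + h) * ?S' (z - h) * (?S' z)\<^sup>2)"
      unfolding shift by (simp add: power2_eq_square)
    also have "\<dots> = exp (2 * \<epsilon> * h\<^sup>2) * (?S' (z + h) * ?S' (z - h) * (partial_sigma F (z + \<omega>))\<^sup>2)"
      unfolding e shift by (simp add: power2_eq_square)
    finally show "partial_sigma F (z + h + \<omega>) * partial_sigma F (z - h + \<omega>) * (?S' z)\<^sup>2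
        = exp (2 * \<epsilon> * h\<^sup>2) * (?S' (z + h) * ?S' (z - h) * (partial_sigma F (z + \<omega>))\<^sup>2)" .
  qed
qed

text \<open>
  This is all that is needed of quasi-periodicity: the ratio \<open>g z = \<sigma> (z + \<omega>) / \<sigma> z\<close> satisfies
  \<open>g (z + h) g (z - h) = (g z)\<^sup>2\<close>. By the previous lemma the quotient \<open>R h\<close> of the two sides is a limit
  of \<open>exp (2 \<epsilon> h\<^sup>2)\<close>, hence does not depend on \<open>z\<close> and satisfies \<open>R (h sqrt 2) = (R h)\<^sup>2\<close>. Oddness
  gives \<open>R h = 1 / R h\<close>, so that \<open>(R h)\<^sup>2 = 1\<close> for all \<open>h\<close>, and then \<open>R h = (R (h / sqrt 2))\<^sup>2 = 1\<close>.
\<close>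
lemma sigma_shift:
  assumes \<omega>: "\<omega> \<in> \<Lambda>"
  shows "\<sigma> (z + h + \<omega>) * \<sigma> (z - h + \<omega>) * (\<sigma> z)\<^sup>2 = \<sigma> (z + h) * \<sigma> (z - h) * (\<sigma> (z + \<omega>))\<^sup>2"
proof (cases "z \<in> \<Lambda> \<or> z + h \<in> \<Lambda> \<or> z - h \<in> \<Lambda>")
  case True
  then show ?thesis
    using lattice_add[OF _ \<omega>] by (auto simp: sigma_eq_0_iff[THEN iffD2])
next
  case False
  define R where "R z h = \<sigma> (z + h + \<omega>) * \<sigma> (z - h + \<omega>) * (\<sigma> z)\<^sup>2 / (\<sigma> (z + h) * \<sigma> (z - h) * (\<sigma> (z + \<omega>))\<^sup>2)" for z h
  define ok where "ok F \<epsilon> \<longleftrightarrow> (\<forall>z h. let S = partial_sigma F; S' = partial_sigma ((\<lambda>w. w - \<omega>) ` F) in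
    S (z + h + \<omega>) * S (z - h + \<omega>) * (S' z)\<^sup>2
      = exp (2 * \<epsilon> * h\<^sup>2) * (S' (z + h) * S' (z - h) * (S (z + \<omega>))\<^sup>2))" for F \<epsilon>
  define \<epsilon> where "\<epsilon> F = (SOME e. ok F e)" for F
  have ok: "ok F (\<epsilon> F)" if "finite F" "{0, \<omega>} \<subseteq> F" for F
    unfolding \<epsilon>_def unfolding ok_def
    by (rule someI_ex, rule partial_sigma_shift) (use that in auto)
  have ev: "\<forall>\<^sub>F F in finite_subsets_at_top \<Lambda>. ok F (\<epsilon> F)"
    unfolding eventually_finite_subsets_at_top by (intro exI[of _ "{0, \<omega>}"]) (auto simp: \<omega> ok)
  have shifted: "((\<lambda>F. partial_sigma ((\<lambda>w. w - \<omega>) ` F) z) \<longlongrightarrow> \<sigma> z) (finite_subsets_at_top \<Lambda>)" for z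
  proof -
    have "(\<lambda>w. w - \<omega>) ` \<Lambda> = \<Lambda>"
      using \<omega> lattice_add lattice_diff by (force simp: image_iff)
    then have "filterlim ((`) (\<lambda>w. w - \<omega>)) (finite_subsets_at_top \<Lambda>) (finite_subsets_at_top \<Lambda>)"
      using filtermap_image_finite_subsets_at_top[of "\<lambda>w. w - \<omega>" \<Lambda>]
      by (simp add: filterlim_def inj_on_def)
    then show ?thesis
      by (rule filterlim_compose[OF partial_sigma_tendsto])
  qed
  have lim: "((\<lambda>F. exp (2 * \<epsilon> F * h\<^sup>2)) \<longlongrightarrow> R z h) (finite_subsets_at_top \<Lambda>)"
    if "z \<notin> \<Lambda>" "z + h \<notin> \<Lambda>" "z - h \<notin> \<Lambda>" for z h
  proof -
    let ?S = partial_sigma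
    let ?S' = "\<lambda>F. partial_sigma ((\<lambda>w. w - \<omega>) ` F)"
    have den: "((\<lambda>F. ?S' F (z + h) * ?S' F (z - h) * (?S F (z + \<omega>))\<^sup>2)
        \<longlongrightarrow> \<sigma> (z + h) * \<sigma> (z - h) * (\<sigma> (z + \<omega>))\<^sup>2) (finite_subsets_at_top \<Lambda>)"
      by (intro tendsto_intros shifted partial_sigma_tendsto)
    have nz: "\<sigma> (z + h) * \<sigma> (z - h) * (\<sigma> (z + \<omega>))\<^sup>2 \<noteq> 0"
      using that by (simp add: sigma_eq_0_iff lattice_add_iff \<omega>)
    have "((\<lambda>F. ?S F (z + h + \<omega>) * ?S F (z - h + \<omega>) * (?S' F z)\<^sup>2
        / (?S' F (z + h) * ?S' F (z - h) * (?S F (z + \<omega>))\<^sup>2)) \<longlongrightarrow> R z h) (finite_subsets_at_top \<Lambda>)"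
      unfolding R_def by (intro tendsto_intros shifted partial_sigma_tendsto nz)
    moreover have "\<forall>\<^sub>F F in finite_subsets_at_top \<Lambda>.
        ?S F (z + h + \<omega>) * ?S F (z - h + \<omega>) * (?S' F z)\<^sup>2
          / (?S' F (z + h) * ?S' F (z - h) * (?S F (z + \<omega>))\<^sup>2) = exp (2 * \<epsilon> F * h\<^sup>2)"
      using ev tendsto_imp_eventually_ne[OF den nz]
    proof eventually_elim
      case (elim F)
      have "?S F (z + h + \<omega>) * ?S F (z - h + \<omega>) * (?S' F z)\<^sup>2
          = exp (2 * \<epsilon> F * h\<^sup>2) * (?S' F (z + h) * ?S' F (z - h) * (?S F (z + \<omega>))\<^sup>2)"
        using elim(1) unfolding ok_def Let_def by blast
      then show ?case
        by (simp only: nonzero_mult_div_cancel_right[OF elim(2)])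
    qed
    ultimately show ?thesis
      by (rule Lim_transform_eventually)
  qed
  \<comment> \<open>Reflection in \<open>- \<omega> / 2\<close> inverts the ratio, which does not depend on the centre.\<close>
  have square: "(R z h)\<^sup>2 = 1" if "z \<notin> \<Lambda>" "z + h \<notin> \<Lambda>" "z - h \<notin> \<Lambda>" for z h
  proof -
    have flip: "- z - \<omega> + h = - (z - h + \<omega>)" "- z - \<omega> - h = - (z + h + \<omega>)" "- z - \<omega> = - (z + \<omega>)"
      "- z - \<omega> + h + \<omega> = - (z - h)" "- z - \<omega> - h + \<omega> = - (z + h)" "- z - \<omega> + \<omega> = - z"
      by simp_all
    have "- z - \<omega> \<notin> \<Lambda>"
      using that unfolding flip(3) by (simp only: lattice_minus_iff lattice_add_iff[OF \<omega>]) simp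
    moreover have "- z - \<omega> + h \<notin> \<Lambda>"
      using that by (subst flip(1)) (simp only: lattice_minus_iff lattice_add_iff[OF \<omega>], simp)
    moreover have "- z - \<omega> - h \<notin> \<Lambda>"
      using that by (subst flip(2)) (simp only: lattice_minus_iff lattice_add_iff[OF \<omega>], simp)
    ultimately have "R z h = R (- z - \<omega>) h"
      using lim that tendsto_unique[OF finite_subsets_at_top_neq_bot] by blast
    also have "\<dots> = inverse (R z h)"
      unfolding R_def flip[THEN arg_cong[where f = \<sigma>], unfolded sigma_odd] by (simp add: field_simps)
    finally have eq: "R z h = inverse (R z h)" .
    have "R z h \<noteq> 0"
      using that by (simp add: R_def sigma_eq_0_iff lattice_add_iff \<omega>)
    with eq show ?thesis
      by (metis power2_eq_square right_inverse)
  qed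
  define r :: complex where "r = of_real (sqrt 2)"
  have r: "r\<^sup>2 = 2" "r \<noteq> 0"
    by (simp_all add: r_def flip: of_real_power)
  obtain y where y: "y \<notin> \<Lambda>" "y + h / r \<notin> \<Lambda>" "y - h / r \<notin> \<Lambda>"
  proof -
    have "countable (\<Lambda> \<union> (\<lambda>w. w - h / r) ` \<Lambda> \<union> (\<lambda>w. w + h / r) ` \<Lambda>)"
      using countable_lattice by simp
    then obtain y where "y \<notin> \<Lambda> \<union> (\<lambda>w. w - h / r) ` \<Lambda> \<union> (\<lambda>w. w + h / r) ` \<Lambda>"
      using uncountable_UNIV_complex by (metis UNIV_eq_I)
    then show ?thesis
      using that[of y] by (auto simp: image_iff) (metis add_diff_cancel diff_add_cancel)+
  qed
  have "((\<lambda>F. (exp (2 * \<epsilon> F * (h / r)\<^sup>2))\<^sup>2) \<longlongrightarrow> (R y (h / r))\<^sup>2) (finite_subsets_at_top \<Lambda>)"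
    by (intro tendsto_intros lim y)
  moreover have "(exp (2 * e * (h / r)\<^sup>2))\<^sup>2 = exp (2 * e * h\<^sup>2)" for e
    using r by (simp add: exp_double[symmetric] power_divide mult.assoc)
  ultimately have "((\<lambda>F. exp (2 * \<epsilon> F * h\<^sup>2)) \<longlongrightarrow> 1) (finite_subsets_at_top \<Lambda>)"
    using square[OF y] by simp
  then have "R z h = 1"
    using lim[of z h] False tendsto_unique[OF finite_subsets_at_top_neq_bot] by blast
  then show ?thesis
    using False by (simp add: R_def sigma_eq_0_iff lattice_add_iff \<omega>)
qed

text \<open>
  Differentiating the previous identity with respect to \<open>h\<close> at \<open>h = z\<close> transports the simple zero at
  \<open>0\<close> to \<open>\<omega>\<close>.
\<close>
lemma sigma_deriv_lattice:
  assumes \<omega>: "\<omega> \<in> \<Lambda>"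
  shows "deriv \<sigma> \<omega> \<noteq> 0"
proof
  assume d\<omega>: "deriv \<sigma> \<omega> = 0"
  have D: "(\<sigma> has_field_derivative deriv \<sigma> w) (at w)" for w
    using sigma_holomorphic[of UNIV] by (simp add: holomorphic_derivI)
  have "countable (\<Lambda> \<union> (\<lambda>w. w / 2) ` \<Lambda>)"
    using countable_lattice by simp
  then obtain z where "z \<notin> \<Lambda> \<union> (\<lambda>w. w / 2) ` \<Lambda>"
    using uncountable_UNIV_complex by (metis UNIV_eq_I)
  then have zn: "z \<notin> \<Lambda>" "z \<notin> (\<lambda>w. w / 2) ` \<Lambda>"
    by simp_all
  have "z + z \<notin> \<Lambda>"
  proof
    assume "z + z \<in> \<Lambda>"
    then have "(z + z) / 2 \<in> (\<lambda>w. w / 2) ` \<Lambda>"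
      by (rule imageI)
    then show False
      using zn(2) by simp
  qed
  with zn have z: "z \<notin> \<Lambda>" "z + z \<notin> \<Lambda>"
    by simp_all
  have plus: "((\<lambda>h. \<sigma> (u + h)) has_field_derivative deriv \<sigma> (u + z)) (at z)" for u
    by (rule DERIV_chain2[OF D, THEN DERIV_cong]) (auto intro!: derivative_eq_intros)
  have minus: "((\<lambda>h. \<sigma> (u - h)) has_field_derivative - deriv \<sigma> (u - z)) (at z)" for u
    by (rule DERIV_chain2[OF D, THEN DERIV_cong]) (auto intro!: derivative_eq_intros)
  have "((\<lambda>h. \<sigma> ((z + \<omega>) + h) * \<sigma> ((z + \<omega>) - h) * (\<sigma> z)\<^sup>2) has_field_derivative
      (deriv \<sigma> (z + \<omega> + z) * \<sigma> (z + \<omega> - z) + - deriv \<sigma> (z + \<omega> - z) * \<sigma> (z + \<omega> + z)) * (\<sigma> z)\<^sup>2) (at z)"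
    by (intro DERIV_cmult_right DERIV_mult plus minus)
  then have L: "((\<lambda>h. \<sigma> ((z + \<omega>) + h) * \<sigma> ((z + \<omega>) - h) * (\<sigma> z)\<^sup>2) has_field_derivative 0) (at z)"
    using d\<omega> sigma_eq_0_iff[of \<omega>] \<omega> by simp
  have R: "((\<lambda>h. \<sigma> (z + h) * \<sigma> (z - h) * (\<sigma> (z + \<omega>))\<^sup>2) has_field_derivative
      (deriv \<sigma> (z + z) * \<sigma> (z - z) + - deriv \<sigma> (z - z) * \<sigma> (z + z)) * (\<sigma> (z + \<omega>))\<^sup>2) (at z)"
    by (intro DERIV_cmult_right DERIV_mult plus minus)
  have eq: "(\<lambda>h. \<sigma> (z + h) * \<sigma> (z - h) * (\<sigma> (z + \<omega>))\<^sup>2) = (\<lambda>h. \<sigma> ((z + \<omega>) + h) * \<sigma> ((z + \<omega>) - h) * (\<sigma> z)\<^sup>2)"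
    using sigma_shift[OF \<omega>, of z] by (auto simp: algebra_simps)
  have "(deriv \<sigma> (z + z) * \<sigma> (z - z) + - deriv \<sigma> (z - z) * \<sigma> (z + z)) * (\<sigma> (z + \<omega>))\<^sup>2 = 0"
    by (rule DERIV_unique[OF R[unfolded eq] L])
  then show False
    using z \<omega> sigma_deriv_0 sigma_eq_0_iff[THEN iffD2, OF lattice_zero]
    by (simp add: sigma_eq_0_iff lattice_add_iff)
qed

text \<open>A zero of the numerator cancels a simple zero of the denominator.\<close>
lemma entire_quotient:
  fixes f W :: "complex \<Rightarrow> complex"
  assumes f: "f holomorphic_on UNIV" and W: "W holomorphic_on UNIV"
    and zeros: "\<And>p. W p = 0 \<Longrightarrow> f p = 0 \<and> deriv W p \<noteq> 0"
  obtains h where "h holomorphic_on UNIV" "\<And>z. f z = h z * W z"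
proof -
  define h where "h z = (if W z = 0 then deriv f z / deriv W z else f z / W z)" for z
  have contW: "continuous_on UNIV W"
    using W by (rule holomorphic_on_imp_continuous_on)
  have diff: "h field_differentiable at p" for p
  proof (cases "W p = 0")
    case False
    have "open {z. W z \<noteq> 0}"
      using contW by (simp add: open_Collect_neq continuous_on_const)
    moreover have "h holomorphic_on {z. W z \<noteq> 0}"
    proof (rule holomorphic_transform)
      show "(\<lambda>z. f z / W z) holomorphic_on {z. W z \<noteq> 0}"
        using f W by (intro holomorphic_intros) (auto intro: holomorphic_on_subset)
    qed (auto simp: h_def)
    ultimately show ?thesis
      using False holomorphic_on_imp_differentiable_at by auto
  next
    case True
    define f1 where "f1 z = (if z = p then deriv f p else (f z - f p) / (z - p))" for z
    define W1 where "W1 z = (if z = p then deriv W p else (W z - W p) / (z - p))" for z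
    have f1: "f1 holomorphic_on UNIV" and W1: "W1 holomorphic_on UNIV"
      unfolding f1_def[abs_def] W1_def[abs_def] using f W by (auto intro: pole_lemma_open)
    have "open {z. W1 z \<noteq> 0}"
      using holomorphic_on_imp_continuous_on[OF W1] by (simp add: open_Collect_neq continuous_on_const)
    moreover have "h holomorphic_on {z. W1 z \<noteq> 0}"
    proof (rule holomorphic_transform)
      show "(\<lambda>z. f1 z / W1 z) holomorphic_on {z. W1 z \<noteq> 0}"
        using f1 W1 by (intro holomorphic_intros) (auto intro: holomorphic_on_subset)
      show "f1 z / W1 z = h z" if "z \<in> {z. W1 z \<noteq> 0}" for z
        using that zeros[OF True] True by (auto simp: f1_def W1_def h_def)
    qed
    moreover have "W1 p \<noteq> 0"
      using zeros[OF True] by (simp add: W1_def)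
    ultimately show ?thesis
      using holomorphic_on_imp_differentiable_at by auto
  qed
  then have "h holomorphic_on UNIV"
    by (simp add: holomorphic_on_def)
  moreover have "f z = h z * W z" for z
    using zeros by (simp add: h_def)
  ultimately show ?thesis
    using that by blast
qed

lemma periodic_entire_constant:
  assumes hol: "h holomorphic_on UNIV" and per: "\<And>\<omega> z. \<omega> \<in> \<Lambda> \<Longrightarrow> h (z + \<omega>) = h z"
  shows "h z = h w"
proof -
  define \<tau> where "\<tau> = \<omega>2 / \<omega>1"
  have im: "Im \<tau> \<noteq> 0"
    using nondegenerate(2) complex_is_Real_iff unfolding \<tau>_def by blast
  define K where "K = (\<lambda>(s, t). complex_of_real s * \<omega>1 + complex_of_real t * \<omega>2) ` ({0..1} \<times> {0..1})"
  have "compact K"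
    unfolding K_def case_prod_beta by (intro compact_continuous_image continuous_intros compact_Times compact_Icc)
  have sub: "range h \<subseteq> h ` K"
  proof
    fix y assume "y \<in> range h"
    then obtain z where z: "y = h z"
      by blast
    define t where "t = Im (z / \<omega>1) / Im \<tau>"
    define s where "s = Re (z / \<omega>1) - t * Re \<tau>"
    have "z / \<omega>1 = complex_of_real s + complex_of_real t * \<tau>"
      using im by (simp add: complex_eq_iff s_def t_def)
    then have "z = complex_of_real s * \<omega>1 + complex_of_real t * \<omega>2"
      using nondegenerate(1) by (simp add: \<tau>_def field_simps)
    then have "z = (complex_of_real (frac s) * \<omega>1 + complex_of_real (frac t) * \<omega>2)
        + (of_int \<lfloor>s\<rfloor> * \<omega>1 + of_int \<lfloor>t\<rfloor> * \<omega>2)"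
      by (simp add: frac_def algebra_simps)
    moreover have "of_int \<lfloor>s\<rfloor> * \<omega>1 + of_int \<lfloor>t\<rfloor> * \<omega>2 \<in> \<Lambda>"
      unfolding period_lattice_def by blast
    ultimately have "y = h (complex_of_real (frac s) * \<omega>1 + complex_of_real (frac t) * \<omega>2)"
      using per z by metis
    moreover have "(frac s, frac t) \<in> {0..1} \<times> {0..1}"
      using frac_ge_0 frac_lt_1 less_imp_le by auto
    ultimately show "y \<in> h ` K"
      unfolding K_def by force
  qed
  have "continuous_on K h"
    using hol by (meson holomorphic_on_imp_continuous_on holomorphic_on_subset subset_UNIV)
  then have "compact (h ` K)"
    using \<open>compact K\<close> by (rule compact_continuous_image)
  then have "bounded (range h)"
    by (rule bounded_subset[OF compact_imp_bounded sub])
  with hol have "h constant_on UNIV"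
    by (rule Liouville_theorem)
  then show ?thesis
    by (metis UNIV_I constant_on_def)
qed

text \<open>
  As a function of \<open>z\<close> all three terms, and also \<open>\<sigma> (z + a) \<sigma> (z - a)\<close>, acquire the same factor under
  a translation by a period. The left-hand side vanishes at \<open>\<plusminus> a\<close>, so that the quotient is entire and
  periodic, hence constant, and it vanishes at \<open>z = b\<close>. The exceptional values of \<open>a\<close> are isolated.
\<close>
theorem sigma_three_term:
  "\<sigma> (z + a) * \<sigma> (z - a) * \<sigma> (b + c) * \<sigma> (b - c)
    + \<sigma> (z + b) * \<sigma> (z - b) * \<sigma> (c + a) * \<sigma> (c - a)
    + \<sigma> (z + c) * \<sigma> (z - c) * \<sigma> (a + b) * \<sigma> (a - b) = 0" (is "?T z a = 0")
proof -
  have generic: "?T z a = 0" if a: "a + a \<notin> \<Lambda>" "b + a \<notin> \<Lambda>" "b - a \<notin> \<Lambda>" for z a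
  proof -
    define f where "f z = ?T z a" for z
    define W where "W z = \<sigma> (z + a) * \<sigma> (z - a)" for z
    have hol: "(\<lambda>z. \<sigma> (z + u)) holomorphic_on UNIV" "(\<lambda>z. \<sigma> (z - u)) holomorphic_on UNIV" for u
      by (rule holomorphic_on_compose[OF _ sigma_holomorphic, unfolded o_def]; intro holomorphic_intros)+
    have f: "f holomorphic_on UNIV" and W: "W holomorphic_on UNIV"
      unfolding f_def[abs_def] W_def[abs_def] by (intro holomorphic_intros hol)+
    have quasi: "f (z + \<omega>) * (\<sigma> z)\<^sup>2 = f z * (\<sigma> (z + \<omega>))\<^sup>2" "W (z + \<omega>) * (\<sigma> z)\<^sup>2 = W z * (\<sigma> (z + \<omega>))\<^sup>2"
      if "\<omega> \<in> \<Lambda>" for \<omega> z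
    proof -
      have sh: "\<sigma> (z + \<omega> + u) * \<sigma> (z + \<omega> - u) * (\<sigma> z)\<^sup>2 = \<sigma> (z + u) * \<sigma> (z - u) * (\<sigma> (z + \<omega>))\<^sup>2" for u
        using sigma_shift[OF that, of z u] by (simp add: algebra_simps)
      show "W (z + \<omega>) * (\<sigma> z)\<^sup>2 = W z * (\<sigma> (z + \<omega>))\<^sup>2"
        unfolding W_def by (rule sh)
      have "f (z + \<omega>) * (\<sigma> z)\<^sup>2
          = (\<sigma> (z + \<omega> + a) * \<sigma> (z + \<omega> - a) * (\<sigma> z)\<^sup>2) * (\<sigma> (b + c) * \<sigma> (b - c))
          + (\<sigma> (z + \<omega> + b) * \<sigma> (z + \<omega> - b) * (\<sigma> z)\<^sup>2) * (\<sigma> (c + a) * \<sigma> (c - a))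
          + (\<sigma> (z + \<omega> + c) * \<sigma> (z + \<omega> - c) * (\<sigma> z)\<^sup>2) * (\<sigma> (a + b) * \<sigma> (a - b))"
        by (simp add: f_def algebra_simps)
      also have "\<dots> = f z * (\<sigma> (z + \<omega>))\<^sup>2"
        unfolding sh by (simp add: f_def algebra_simps)
      finally show "f (z + \<omega>) * (\<sigma> z)\<^sup>2 = f z * (\<sigma> (z + \<omega>))\<^sup>2" .
    qed
    have fa: "f a = 0" "f (- a) = 0"
    proof -
      have odd: "\<sigma> (u - v) = - \<sigma> (v - u)" for u v
        using sigma_odd[of "v - u"] by simp
      have zero: "\<sigma> 0 = 0"
        by (simp add: sigma_eq_0_iff)
      show "f a = 0"
        using odd[of c a] by (simp add: f_def zero add.commute)
      have "\<sigma> (- a + b) = - \<sigma> (a - b)" "\<sigma> (- a - b) = - \<sigma> (a + b)" for b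
        using sigma_odd[of "a - b"] sigma_odd[of "a + b"] by simp_all
      then show "f (- a) = 0"
        using odd[of c a] by (simp add: f_def zero add.commute)
    qed
    have zeros: "f p = 0 \<and> deriv W p \<noteq> 0" if "W p = 0" for p
    proof -
      have D: "(\<sigma> has_field_derivative deriv \<sigma> w) (at w)" for w
        using sigma_holomorphic[of UNIV] by (simp add: holomorphic_derivI)
      have D': "((\<lambda>z. \<sigma> (z + u)) has_field_derivative deriv \<sigma> (p + u)) (at p)" for u
        by (rule DERIV_chain2[OF D, THEN DERIV_cong]) (auto intro!: derivative_eq_intros)
      have "(W has_field_derivative deriv \<sigma> (p + a) * \<sigma> (p + - a) + deriv \<sigma> (p + - a) * \<sigma> (p + a)) (at p)"
        unfolding W_def[abs_def] using DERIV_mult[OF D'[of a] D'[of "- a"]] by simp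
      then have dW: "deriv W p = deriv \<sigma> (p + a) * \<sigma> (p - a) + deriv \<sigma> (p - a) * \<sigma> (p + a)"
        by (simp add: DERIV_imp_deriv)
      \<comment> \<open>The two factors of \<open>W\<close> have no common zero, since \<open>a + a\<close> is not a lattice point.\<close>
      have not_both: "p + a \<notin> \<Lambda> \<or> p - a \<notin> \<Lambda>"
        using lattice_diff[of "p + a" "p - a"] a(1) by auto
      have "p - - a \<in> \<Lambda> \<or> p - a \<in> \<Lambda>"
        using that by (simp add: W_def sigma_eq_0_iff)
      then obtain q where q: "f q = 0" "p - q \<in> \<Lambda>" "q = a \<or> q = - a"
        using fa by blast
      have "q \<notin> \<Lambda>"
      proof
        assume "q \<in> \<Lambda>"
        then have "q + q \<in> \<Lambda>"
          by (intro lattice_add)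
        moreover have "q + q = a + a \<or> q + q = - (a + a)"
          using q(3) by auto
        ultimately show False
          using a(1) by (metis lattice_minus_iff)
      qed
      then have "f p = 0"
        using quasi(1)[OF q(2), of q] q(1) by (simp add: sigma_eq_0_iff)
      moreover have "deriv W p \<noteq> 0"
        using not_both that unfolding dW W_def
        by (auto simp: sigma_eq_0_iff sigma_eq_0_iff[THEN iffD2] sigma_deriv_lattice)
      ultimately show ?thesis
        by blast
    qed
    obtain h where h: "h holomorphic_on UNIV" "\<And>z. f z = h z * W z"
      using entire_quotient[OF f W zeros] by blast
    have "h (z + \<omega>) = h z" if \<omega>: "\<omega> \<in> \<Lambda>" for \<omega> z
    proof -
      have cont: "isCont h u" for u
        using h(1) by (meson UNIV_I continuous_on_eq_continuous_at holomorphic_on_imp_continuous_on open_UNIV)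
      have shift_ev: "\<forall>\<^sub>F w in at z. \<sigma> (w + u) \<noteq> 0" for u
        using sigma_isolated_zeros[of "z + u"] eventually_filtermap[of _ "\<lambda>w. w + u" "at z"]
        by (simp add: filtermap_at_shift[of "- u", simplified])
      have "\<forall>\<^sub>F w in at z. h (w + \<omega>) = h w"
        using shift_ev[of 0] shift_ev[of a] shift_ev[of "- a"]
      proof eventually_elim
        case (elim w)
        have "h (w + \<omega>) * (W w * (\<sigma> (w + \<omega>))\<^sup>2) = h w * (W w * (\<sigma> (w + \<omega>))\<^sup>2)"
          using quasi[OF \<omega>, of w] h(2)[of w] h(2)[of "w + \<omega>"] by (metis mult.assoc)
        moreover have "W w * (\<sigma> (w + \<omega>))\<^sup>2 \<noteq> 0"
          using elim \<omega> by (simp add: W_def sigma_eq_0_iff lattice_add_iff)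
        ultimately show ?case
          by simp
      qed
      moreover have "((\<lambda>w. h (w + \<omega>)) \<longlongrightarrow> h (z + \<omega>)) (at z)"
        using cont by (intro isCont_tendsto_compose[of _ h] tendsto_intros)
      ultimately have "(h \<longlongrightarrow> h (z + \<omega>)) (at z)"
        by (rule Lim_transform_eventually[rotated])
      moreover have "(h \<longlongrightarrow> h z) (at z)"
        using cont by (rule isContD)
      ultimately show ?thesis
        by (rule tendsto_unique[OF at_neq_bot])
    qed
    then have const: "h z = h b"
      using periodic_entire_constant h(1) by blast
    have "f b = 0"
    proof -
      have "\<sigma> (a - b) = - \<sigma> (b - a)" "\<sigma> (c - a) = - \<sigma> (a - c)" "\<sigma> 0 = 0"
        using sigma_odd[of "b - a"] sigma_odd[of "a - c"] by (simp_all add: sigma_eq_0_iff)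
      then show ?thesis
        by (simp add: f_def add.commute)
    qed
    moreover have "W b \<noteq> 0"
      using a by (simp add: W_def sigma_eq_0_iff)
    ultimately have "h b = 0"
      using h(2)[of b] by simp
    then show ?thesis
      using const h(2)[of z] by (simp add: f_def)
  qed
  have ev: "\<forall>\<^sub>F w in at a. ?T z w = 0"
  proof -
    have "\<forall>\<^sub>F w in at a. w + w \<notin> \<Lambda>"
    proof -
      have "filterlim (\<lambda>w. w + w) (at (a + a)) (at a)"
        by (auto simp: filterlim_at eventually_at_filter intro!: tendsto_intros always_eventually)
      then show ?thesis
        using sigma_isolated_zeros[of "a + a"] unfolding filterlim_iff by (auto simp: sigma_eq_0_iff)
    qed
    moreover have "\<forall>\<^sub>F w in at a. b + w \<notin> \<Lambda>"
    proof -
      have "filterlim (\<lambda>w. b + w) (at (b + a)) (at a)"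
        by (auto simp: filterlim_at eventually_at_filter intro!: tendsto_intros always_eventually)
      then show ?thesis
        using sigma_isolated_zeros[of "b + a"] unfolding filterlim_iff by (auto simp: sigma_eq_0_iff)
    qed
    moreover have "\<forall>\<^sub>F w in at a. b - w \<notin> \<Lambda>"
    proof -
      have "filterlim (\<lambda>w. b - w) (at (b - a)) (at a)"
        by (auto simp: filterlim_at eventually_at_filter intro!: tendsto_intros always_eventually)
      then show ?thesis
        using sigma_isolated_zeros[of "b - a"] unfolding filterlim_iff by (auto simp: sigma_eq_0_iff)
    qed
    ultimately show ?thesis
      by eventually_elim (rule generic)
  qed
  have "((\<lambda>w. ?T z w) \<longlongrightarrow> ?T z a) (at a)"
    by (intro tendsto_intros isCont_tendsto_compose[OF sigma_isCont])
  moreover have "((\<lambda>w. ?T z w) \<longlongrightarrow> 0) (at a)"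
    using ev by (rule tendsto_eventually)
  ultimately show ?thesis
    by (rule tendsto_unique[OF at_neq_bot])
qed

end

section \<open>Shifted factorials of an abstract bracket\<close>

text \<open>
  For the sigma function the last assumption says that no nonzero integer multiple of \<open>\<delta>\<close> is a lattice point.
\<close>
locale elliptic_bracket =
  fixes br :: "complex \<Rightarrow> complex" and \<delta> :: complex and n :: nat
  assumes odd: "br (- z) = - br z"
    and three_term: "br (z + a) * br (z - a) * br (b + c) * br (b - c)
      + br (z + b) * br (z - b) * br (c + a) * br (c - a)
      + br (z + c) * br (z - c) * br (a + b) * br (a - b) = 0"
    and isCont_br: "isCont br z"
    and isolated_zeros: "\<forall>\<^sub>F w in at z. br w \<noteq> 0"
    and br_step: "k \<noteq> 0 \<Longrightarrow> br (of_int k * \<delta>) \<noteq> 0"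
begin

definition I :: "nat set" where
  "I = {1..n}"

lemma finite_I [simp]: "finite I"
  by (simp add: I_def)

abbreviation "ph \<equiv> shifted_fact br \<delta>"
abbreviation sz :: "(nat \<Rightarrow> nat) \<Rightarrow> nat" where "sz \<gamma> \<equiv> mi_size n \<gamma>"
abbreviation below :: "(nat \<Rightarrow> nat) \<Rightarrow> (nat \<Rightarrow> nat) set" where "below m \<equiv> (\<Pi>\<^sub>E i\<in>I. {..m i})"

lemma odd_diff: "br (a - b) = - br (b - a)"
  using odd[of "b - a"] by simp

lemma br_0 [simp]: "br 0 = 0"
  using odd[of 0] by simp

lemma eventually_br_nonzero: "\<forall>\<^sub>F t in at 0. br (a - t) \<noteq> 0"
proof -
  have "filterlim (\<lambda>t. a - t) (at a) (at 0)"
    by (auto simp: filterlim_at eventually_at_filter intro!: tendsto_eq_intros always_eventually)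
  then show ?thesis
    using isolated_zeros[of a] unfolding filterlim_iff by blast
qed

lemma ph_0 [simp]: "ph z 0 = 1"
  by (simp add: shifted_fact_def)

lemma ph_Suc: "ph z (Suc k) = ph z k * br (z + of_nat k * \<delta>)"
  by (simp add: shifted_fact_def)

lemma ph_split:
  assumes "k = a + b" "w = z + of_nat a * \<delta>"
  shows "ph z k = ph z a * ph w b"
  unfolding assms by (induction b) (simp_all add: ph_Suc algebra_simps)

lemma ph_reflect:
  assumes "w = \<delta> - z - of_nat k * \<delta>"
  shows "ph w k = (- 1) ^ k * ph z k"
proof -
  have "ph w k = (\<Prod>r<k. br (w + of_nat (k - Suc r) * \<delta>))"
    unfolding shifted_fact_def by (rule prod.nat_diff_reindex[symmetric])
  also have "\<dots> = (\<Prod>r<k. - 1 * br (z + of_nat r * \<delta>))"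
  proof (rule prod.cong)
    fix r assume "r \<in> {..<k}"
    then have "w + of_nat (k - Suc r) * \<delta> = - (z + of_nat r * \<delta>)"
      by (simp add: assms of_nat_diff algebra_simps)
    then show "br (w + of_nat (k - Suc r) * \<delta>) = - 1 * br (z + of_nat r * \<delta>)"
      by (simp only: odd) simp
  qed simp
  also have "\<dots> = (- 1) ^ k * ph z k"
    by (simp only: prod.distrib shifted_fact_def prod_constant card_lessThan)
  finally show ?thesis .
qed

lemma ph_eq_0_iff: "ph z k = 0 \<longleftrightarrow> (\<exists>r<k. br (z + of_nat r * \<delta>) = 0)"
  by (auto simp: shifted_fact_def)

lemma ph_diagonal_nonzero: "k \<le> l \<Longrightarrow> ph (- of_nat l * \<delta>) k \<noteq> 0"
proof -
  assume "k \<le> l"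
  have "br (- of_nat l * \<delta> + of_nat r * \<delta>) \<noteq> 0" if "r < k" for r
  proof -
    have "- of_nat l * \<delta> + of_nat r * \<delta> = of_int (int r - int l) * \<delta>"
      by (simp add: algebra_simps)
    then show ?thesis
      using br_step[of "int r - int l"] that \<open>k \<le> l\<close> by simp
  qed
  then show ?thesis
    by (auto simp: ph_eq_0_iff)
qed

section \<open>Interpolation of even products\<close>

text \<open>
  For the sigma function these are the even theta functions of degree \<open>2 D\<close>.
\<close>
inductive even_span :: "nat \<Rightarrow> (complex \<Rightarrow> complex) \<Rightarrow> bool" where
  const: "even_span 0 (\<lambda>z. a)"
| mult: "even_span D f \<Longrightarrow> even_span (Suc D) (\<lambda>z. f z * (br (u + z) * br (u - z)))"
| add: "even_span D f \<Longrightarrow> even_span D g \<Longrightarrow> even_span D (\<lambda>z. f z + g z)"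

lemma even_span_mult_left: "even_span D f \<Longrightarrow> even_span D (\<lambda>z. a * f z)"
proof (induction rule: even_span.induct)
  case (mult D f u)
  from even_span.mult[OF mult.IH, of u] show ?case
    by (simp add: mult_ac)
next
  case (add D f g)
  from even_span.add[OF add.IH] show ?case
    by (simp add: distrib_left)
qed (rule even_span.const)

lemma even_span_mult:
  assumes g: "even_span E g" and f: "even_span D f"
  shows "even_span (D + E) (\<lambda>z. f z * g z)"
  using g
proof (induction rule: even_span.induct)
  case (const a)
  from even_span_mult_left[OF f, of a] show ?case
    by (simp add: mult.commute)
next
  case (mult E g u)
  from even_span.mult[OF mult.IH, of u] show ?case
    by (simp add: mult.assoc)
next
  case (add E g h)
  from even_span.add[OF add.IH] show ?case
    by (simp add: distrib_left)
qed

lemma even_span_0: "even_span D (\<lambda>z. 0)"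
proof (induction D)
  case 0
  show ?case by (rule even_span.const)
next
  case (Suc D)
  from even_span.mult[OF this] show ?case by simp
qed

lemma even_span_sum: "(\<And>i. i \<in> A \<Longrightarrow> even_span D (f i)) \<Longrightarrow> even_span D (\<lambda>z. \<Sum>i\<in>A. f i z)"
  by (induction A rule: infinite_finite_induct) (auto intro: even_span_0 even_span.add)

lemma even_span_prod:
  "(\<And>i. i \<in> A \<Longrightarrow> even_span (D i) (f i)) \<Longrightarrow> even_span (\<Sum>i\<in>A. D i) (\<lambda>z. \<Prod>i\<in>A. f i z)"
proof (induction A rule: infinite_finite_induct)
  case (insert i A)
  then have "even_span ((\<Sum>i\<in>A. D i) + D i) (\<lambda>z. (\<Prod>i\<in>A. f i z) * f i z)"
    by (intro even_span_mult) auto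
  with insert.hyps show ?case
    by (simp add: mult.commute add.commute)
qed (auto intro: even_span.const)

lemma even_span_ph: "even_span k (\<lambda>z. ph (u + z) k * ph (u - z) k)"
proof (induction k)
  case 0
  show ?case by (simp add: even_span.const)
next
  case (Suc k)
  from even_span.mult[OF this, of "u + of_nat k * \<delta>"] show ?case
    by (simp add: ph_Suc mult_ac add_ac diff_add_eq)
qed

text \<open>
  The three-term identity writes every factor \<open>br (u + z) * br (u - z)\<close> as a linear combination of the two
  fixed functions \<open>A\<close> and \<open>B\<close>. Thus \<open>f\<close> is a form of degree \<open>D\<close> in \<open>A\<close> and \<open>B\<close>, here dehomogenised;
  where \<open>B\<close> vanishes only the leading coefficient is seen.
\<close>
lemma even_span_polynomial:
  assumes "even_span D f" and pq: "br (p + q) * br (p - q) \<noteq> 0"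
  defines "A \<equiv> \<lambda>z. br (z + p) * br (z - p)" and "B \<equiv> \<lambda>z. br (z + q) * br (z - q)"
  shows "\<exists>P. degree P \<le> D \<and> (\<forall>z. B z \<noteq> 0 \<longrightarrow> f z = B z ^ D * poly P (A z / B z))
    \<and> (\<forall>z. B z = 0 \<longrightarrow> f z = coeff P D * A z ^ D)"
  using assms(1)
proof (induction rule: even_span.induct)
  case (const a)
  show ?case
    by (intro exI[of _ "[:a:]"]) simp
next
  case (mult D f u)
  then obtain P where P: "degree P \<le> D"
    "\<And>z. B z \<noteq> 0 \<Longrightarrow> f z = B z ^ D * poly P (A z / B z)"
    "\<And>z. B z = 0 \<Longrightarrow> f z = coeff P D * A z ^ D"
    by blast
  define \<alpha> where "\<alpha> = br (q + u) * br (q - u) / (br (p + q) * br (p - q))"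
  define \<beta> where "\<beta> = br (u + p) * br (u - p) / (br (p + q) * br (p - q))"
  have lin: "br (u + z) * br (u - z) = \<alpha> * A z + \<beta> * B z" for z
  proof -
    have "br (u + z) * br (u - z) * (br (p + q) * br (p - q))
        = br (q + u) * br (q - u) * A z + br (u + p) * br (u - p) * B z"
      using three_term[of z u p q] unfolding A_def B_def odd_diff[of u z] add.commute[of u z]
      by algebra
    then show ?thesis
      using pq by (simp add: \<alpha>_def \<beta>_def field_simps)
  qed
  show ?case
  proof (intro exI[of _ "P * [:\<beta>, \<alpha>:]"] conjI allI impI)
    show "degree (P * [:\<beta>, \<alpha>:]) \<le> Suc D"
      using degree_mult_le[of P "[:\<beta>, \<alpha>:]"] P(1) by (auto split: if_splits)
    show "f z * (br (u + z) * br (u - z)) = B z ^ Suc D * poly (P * [:\<beta>, \<alpha>:]) (A z / B z)" if "B z \<noteq> 0" for z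
      unfolding lin P(2)[OF that] using that by (simp add: field_simps)
    have "coeff P (Suc D) = 0"
      using P(1) by (simp add: coeff_eq_0)
    then have "coeff (P * [:\<beta>, \<alpha>:]) (Suc D) = \<alpha> * coeff P D"
      by (simp add: mult_pCons_right)
    then show "f z * (br (u + z) * br (u - z)) = coeff (P * [:\<beta>, \<alpha>:]) (Suc D) * A z ^ Suc D" if "B z = 0" for z
      unfolding lin P(3)[OF that] using that by simp
  qed
next
  case (add D f g)
  then obtain P Q where P: "degree P \<le> D"
    "\<And>z. B z \<noteq> 0 \<Longrightarrow> f z = B z ^ D * poly P (A z / B z)"
    "\<And>z. B z = 0 \<Longrightarrow> f z = coeff P D * A z ^ D"
    and Q: "degree Q \<le> D"
    "\<And>z. B z \<noteq> 0 \<Longrightarrow> g z = B z ^ D * poly Q (A z / B z)"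
    "\<And>z. B z = 0 \<Longrightarrow> g z = coeff Q D * A z ^ D"
    by blast
  show ?case
    by (intro exI[of _ "P + Q"]) (auto simp: P Q degree_add_le distrib_left distrib_right)
qed

text \<open>
  Two of the nodes serve as \<open>p\<close> and \<open>q\<close>. The zero at \<open>q\<close>, where \<open>B\<close> vanishes, lowers the degree of the
  polynomial below \<open>D\<close>, and the other nodes give \<open>D\<close> different roots \<open>A / B\<close>, again by the three-term
  identity.
\<close>
lemma even_span_interpolation:
  assumes f: "even_span D f" and J: "finite J" "D < card J"
    and zero: "\<And>j. j \<in> J \<Longrightarrow> f (pt j) = 0"
    and dist: "\<And>i j. i \<in> J \<Longrightarrow> j \<in> J \<Longrightarrow> i \<noteq> j \<Longrightarrow> br (pt i + pt j) * br (pt i - pt j) \<noteq> 0"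
  shows "f z = 0"
proof (cases "D = 0")
  case True
  have "\<exists>a. \<forall>z. f z = a" if "even_span D f" "D = 0" for D f
    using that by (induction rule: even_span.induct) auto
  then obtain a where "\<And>z. f z = a"
    using f True by blast
  moreover obtain j where "j \<in> J"
    using J by fastforce
  ultimately show ?thesis
    using zero by metis
next
  case False
  then have "1 < card J"
    using J(2) by linarith
  then obtain i j where ij: "i \<in> J" "j \<in> J" "i \<noteq> j"
    by (metis card_le_Suc0_iff_eq J(1) One_nat_def not_le)
  define p q where "p = pt i" and "q = pt j"
  define A B where "A z = br (z + p) * br (z - p)" and "B z = br (z + q) * br (z - q)" for z
  have pq: "br (p + q) * br (p - q) \<noteq> 0"
    using dist ij by (simp add: p_def q_def)
  obtain P where P: "degree P \<le> D"
    "\<And>z. B z \<noteq> 0 \<Longrightarrow> f z = B z ^ D * poly P (A z / B z)"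
    "\<And>z. B z = 0 \<Longrightarrow> f z = coeff P D * A z ^ D"
    using even_span_polynomial[OF f pq] unfolding A_def B_def by blast
  have nzB: "B (pt l) \<noteq> 0" if "l \<in> J - {j}" for l
    using dist[of l j] that ij by (simp add: B_def q_def)
  have "P = 0"
  proof (rule ccontr)
    assume nz: "P \<noteq> 0"
    have "B q = 0" "A q \<noteq> 0"
      using dist[of j i] ij by (simp_all add: A_def B_def q_def p_def)
    then have "coeff P D = 0"
      using P(3)[of q] zero[OF ij(2)] by (simp add: q_def)
    then have "degree P < D"
      using P(1) nz by (metis le_neq_implies_less leading_coeff_0_iff)
    moreover have "D \<le> card {x. poly P x = 0}"
    proof -
      have "inj_on (\<lambda>l. A (pt l) / B (pt l)) (J - {j})"
      proof (rule inj_onI, rule ccontr)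
        fix k l assume kl: "k \<in> J - {j}" "l \<in> J - {j}" "k \<noteq> l"
          and "A (pt k) / B (pt k) = A (pt l) / B (pt l)"
        then have "A (pt k) * B (pt l) = A (pt l) * B (pt k)"
          using nzB by (simp add: field_simps)
        then have "br (pt k + pt l) * br (pt k - pt l) * (br (q + p) * br (q - p)) = 0"
          using three_term[of "pt k" p "pt l" q] odd_diff[of p "pt l"] unfolding A_def B_def
          by (simp add: algebra_simps)
        then show False
          using dist[of k l] dist[of j i] kl ij by (simp add: p_def q_def)
      qed
      then have "card (J - {j}) = card ((\<lambda>l. A (pt l) / B (pt l)) ` (J - {j}))"
        by (simp add: card_image)
      also have "\<dots> \<le> card {x. poly P x = 0}"
      proof (intro card_mono poly_roots_finite nz)
        show "(\<lambda>l. A (pt l) / B (pt l)) ` (J - {j}) \<subseteq> {x. poly P x = 0}"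
          using P(2) nzB zero by fastforce
      qed
      finally show ?thesis
        using J ij by simp
    qed
    moreover have "card {x. poly P x = 0} \<le> degree P"
      using nz by (rule card_poly_roots_bound)
    ultimately show False
      by linarith
  qed
  then show ?thesis
    using P(2)[of z] P(3)[of z] by (cases "B z = 0") auto
qed

section \<open>The Jackson summation\<close>

text \<open>
  Up to sign this is the quotient of the two Vandermonde products times the factors with
  \<open>a j = - m j * \<delta>\<close> (see \<open>Delta_quotient\<close>). In the present form numerator and denominator differ only in
  \<open>m\<close> and \<open>\<gamma>\<close>, like those of the binomial coefficient that it generalises.
\<close>
definition weight :: "(nat \<Rightarrow> nat) \<Rightarrow> (nat \<Rightarrow> complex) \<Rightarrow> (nat \<Rightarrow> nat) \<Rightarrow> complex" where
  "weight m x \<gamma> = (\<Prod>i\<in>I. \<Prod>j\<in>I. ph (- of_nat (m j) * \<delta> + x i - x j) (\<gamma> i)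
     / ph (- of_nat (\<gamma> j) * \<delta> + x i - x j) (\<gamma> i))"

text \<open>
  The very-well-poised part of the term together with all of its factors \<open>s + x i\<close>.
\<close>
definition poised :: "(nat \<Rightarrow> nat) \<Rightarrow> complex \<Rightarrow> (nat \<Rightarrow> complex) \<Rightarrow> (nat \<Rightarrow> nat) \<Rightarrow> complex" where
  "poised m s x \<gamma> = (\<Prod>i\<in>I. br (of_nat (sz \<gamma> + \<gamma> i) * \<delta> + s + x i)
     / ph (s + x i + of_nat (sz \<gamma>) * \<delta>) (Suc (m i)))"

text \<open>
  \<open>c_factor\<close> and \<open>d_factor\<close> are the contributions of one \<open>c\<close> and of one \<open>d\<close>, multiplied
  by the part of the normalising factor that clears their denominators.
\<close>
definition c_factor :: "(nat \<Rightarrow> nat) \<Rightarrow> complex \<Rightarrow> (nat \<Rightarrow> complex) \<Rightarrow> complex \<Rightarrow> (nat \<Rightarrow> nat) \<Rightarrow> complex" where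
  "c_factor m s x c \<gamma> = ph (\<delta> + s - c + of_nat (sz \<gamma>) * \<delta>) (sz m - sz \<gamma>) * (\<Prod>i\<in>I. ph (c + x i) (\<gamma> i))"

definition d_factor :: "(nat \<Rightarrow> nat) \<Rightarrow> complex \<Rightarrow> (nat \<Rightarrow> complex) \<Rightarrow> complex \<Rightarrow> (nat \<Rightarrow> nat) \<Rightarrow> complex" where
  "d_factor m s x d \<gamma> = ph d (sz \<gamma>) * (\<Prod>i\<in>I. ph (\<delta> + s - d + x i + of_nat (\<gamma> i) * \<delta>) (m i - \<gamma> i))"

definition jackson_term where
  "jackson_term m s x c0 c1 d0 d1 \<gamma> = (- 1) ^ sz \<gamma> * weight m x \<gamma> * poised m s x \<gamma>
     * (c_factor m s x c0 \<gamma> * c_factor m s x c1 \<gamma>) * (d_factor m s x d0 \<gamma> * d_factor m s x d1 \<gamma>)"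

definition jackson_value where
  "jackson_value m s x c0 c1 d0 d1 = ph (\<delta> + s - c0 - d0) (sz m) * ph (\<delta> + s - c1 - d0) (sz m)
     * (\<Prod>i\<in>I. ph (\<delta> + s - d0 - d1 + x i) (m i))"

text \<open>
  The denominators of \<open>weight\<close> and \<open>poised\<close> do not vanish for any \<open>\<gamma> \<le> m\<close>. These are the only
  denominators that are left.
\<close>
definition regular :: "(nat \<Rightarrow> nat) \<Rightarrow> complex \<Rightarrow> (nat \<Rightarrow> complex) \<Rightarrow> bool" where
  "regular m s x \<longleftrightarrow>
     (\<forall>i\<in>I. \<forall>j\<in>I. i \<noteq> j \<longrightarrow> (\<forall>k. - int (m j) \<le> k \<longrightarrow> k \<le> int (m i) \<longrightarrow> br (x i - x j + of_int k * \<delta>) \<noteq> 0))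
     \<and> (\<forall>i\<in>I. \<forall>k \<le> sz m + m i. br (s + x i + of_nat k * \<delta>) \<noteq> 0)"

text \<open>
  With \<open>regular\<close> this makes the interpolation nodes \<open>c0 = - x p - r * \<delta>\<close> and
  \<open>c0 = s + sz m * \<delta>\<close> of the Jackson sum distinct, also from their images under the exchange of \<open>c0\<close> and \<open>c1\<close>.
\<close>
definition separated where
  "separated m s x d0 d1 \<longleftrightarrow> (\<forall>p\<in>I. \<forall>k \<le> 1 + 3 * (sz m). br (s + x p - d0 - d1 + of_nat k * \<delta>) \<noteq> 0
     \<and> (\<forall>q\<in>I. br (2 * s + x p + x q - d0 - d1 + of_nat k * \<delta>) \<noteq> 0))"

lemma size_eq: "sz \<gamma> = sum \<gamma> I"
  by (simp add: mi_size_def I_def)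

lemma size_mono: "(\<And>i. i \<in> I \<Longrightarrow> \<gamma> i \<le> m i) \<Longrightarrow> (sz \<gamma>) \<le> sz m"
  unfolding size_eq by (intro sum_mono)

lemma size_ge: "i \<in> I \<Longrightarrow> m i \<le> sz m"
  unfolding size_eq by (intro member_le_sum) auto

lemma size_cong: "(\<And>i. i \<in> I \<Longrightarrow> \<gamma> i = m i) \<Longrightarrow> (sz \<gamma>) = sz m"
  unfolding size_eq by (intro sum.cong) auto

lemma size_update: "p \<in> I \<Longrightarrow> (sz (m(p := r))) + m p = sz m + r"
proof -
  assume p: "p \<in> I"
  have "sum (m(p := r)) (I - {p}) = sum m (I - {p})"
    by (intro sum.cong) auto
  then show ?thesis
    using p by (simp add: size_eq sum.remove[of I p])
qed

lemma below_le: "\<gamma> \<in> below m \<Longrightarrow> i \<in> I \<Longrightarrow> \<gamma> i \<le> m i"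
  by (auto simp: PiE_iff)

lemma finite_below: "finite (below m)"
  by (intro finite_PiE) auto

lemma regular_differenceD:
  "regular m s x \<Longrightarrow> i \<in> I \<Longrightarrow> j \<in> I \<Longrightarrow> i \<noteq> j \<Longrightarrow> - int (m j) \<le> k \<Longrightarrow> k \<le> int (m i)
    \<Longrightarrow> br (x i - x j + of_int k * \<delta>) \<noteq> 0"
  unfolding regular_def by blast

lemma regular_sumD: "regular m s x \<Longrightarrow> i \<in> I \<Longrightarrow> k \<le> sz m + m i \<Longrightarrow> br (s + x i + of_nat k * \<delta>) \<noteq> 0"
  unfolding regular_def by blast

lemma regular_mono:
  assumes "regular m s x" "\<And>i. i \<in> I \<Longrightarrow> \<gamma> i \<le> m i"
  shows "regular \<gamma> s x"
  unfolding regular_def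
proof (intro conjI ballI allI impI)
  fix i j k assume "i \<in> I" "j \<in> I" "i \<noteq> j" "- int (\<gamma> j) \<le> k" "k \<le> int (\<gamma> i)"
  then show "br (x i - x j + of_int k * \<delta>) \<noteq> 0"
    using assms(2)[of i] assms(2)[of j] by (intro regular_differenceD[OF assms(1)]) auto
next
  fix i k assume "i \<in> I" "k \<le> sz \<gamma> + \<gamma> i"
  then show "br (s + x i + of_nat k * \<delta>) \<noteq> 0"
    using assms(2)[of i] size_mono[of \<gamma> m, OF assms(2)] by (intro regular_sumD[OF assms(1)]) auto
qed

lemma weight_denominator_nonzero:
  assumes "regular m s x" "i \<in> I" "j \<in> I" "\<gamma> i \<le> m i" "\<gamma> j \<le> m j"
  shows "ph (- of_nat (\<gamma> j) * \<delta> + x i - x j) (\<gamma> i) \<noteq> 0"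
proof (cases "i = j")
  case True
  then show ?thesis
    using ph_diagonal_nonzero[of "\<gamma> i" "\<gamma> i"] by simp
next
  case False
  have "br (- of_nat (\<gamma> j) * \<delta> + x i - x j + of_nat r * \<delta>) \<noteq> 0" if "r < \<gamma> i" for r
  proof -
    have "- of_nat (\<gamma> j) * \<delta> + x i - x j + of_nat r * \<delta> = x i - x j + of_int (int r - int (\<gamma> j)) * \<delta>"
      by (simp add: algebra_simps)
    moreover have "br (x i - x j + of_int (int r - int (\<gamma> j)) * \<delta>) \<noteq> 0"
      using that assms(4,5) by (intro regular_differenceD[OF assms(1-3) False]) auto
    ultimately show ?thesis
      by (simp only: not_False_eq_True)
  qed
  then show ?thesis
    by (auto simp: ph_eq_0_iff)
qed

lemma poised_denominator_nonzero:
  assumes "regular m s x" "i \<in> I" "k + l \<le> sz m + m i + 1"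
  shows "ph (s + x i + of_nat k * \<delta>) l \<noteq> 0"
proof -
  have "br (s + x i + of_nat k * \<delta> + of_nat r * \<delta>) \<noteq> 0" if "r < l" for r
    using regular_sumD[OF assms(1,2), of "k + r"] that assms(3) by (simp add: algebra_simps)
  then show ?thesis
    by (auto simp: ph_eq_0_iff)
qed

lemma prod_update:
  fixes f g :: "nat \<Rightarrow> complex"
  assumes "p \<in> I" "f p = g p * k" "\<And>i. i \<in> I \<Longrightarrow> i \<noteq> p \<Longrightarrow> f i = g i"
  shows "(\<Prod>i\<in>I. f i) = (\<Prod>i\<in>I. g i) * k"
proof -
  have "(\<Prod>i\<in>I - {p}. f i) = (\<Prod>i\<in>I - {p}. g i)"
    using assms(3) by (intro prod.cong) auto
  then show ?thesis
    using assms(1,2) by (simp add: prod.remove[of I p])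
qed

lemma c_factor_eq_0:
  assumes "p \<in> I" "r < \<gamma> p"
  shows "c_factor m s x (- x p - of_nat r * \<delta>) \<gamma> = 0"
proof -
  have "ph (- x p - of_nat r * \<delta> + x p) (\<gamma> p) = 0"
    unfolding ph_eq_0_iff using assms(2) by (intro exI[of _ r]) simp
  then have "(\<Prod>i\<in>I. ph (- x p - of_nat r * \<delta> + x i) (\<gamma> i)) = 0"
    using assms(1) by (intro prod_zero bexI[of _ p]) auto
  then show ?thesis
    by (simp add: c_factor_def)
qed

lemma d_factor_update:
  assumes p: "p \<in> I" "\<gamma> p \<le> r" "r \<le> m p"
  shows "d_factor m s x d \<gamma> = d_factor (m(p := r)) s x d \<gamma> * ph (\<delta> + s - d + x p + of_nat r * \<delta>) (m p - r)"
proof -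
  have "(\<Prod>i\<in>I. ph (\<delta> + s - d + x i + of_nat (\<gamma> i) * \<delta>) (m i - \<gamma> i))
      = (\<Prod>i\<in>I. ph (\<delta> + s - d + x i + of_nat (\<gamma> i) * \<delta>) ((m(p := r)) i - \<gamma> i))
        * ph (\<delta> + s - d + x p + of_nat r * \<delta>) (m p - r)"
  proof (rule prod_update[OF p(1)])
    show "ph (\<delta> + s - d + x p + of_nat (\<gamma> p) * \<delta>) (m p - \<gamma> p)
        = ph (\<delta> + s - d + x p + of_nat (\<gamma> p) * \<delta>) ((m(p := r)) p - \<gamma> p)
          * ph (\<delta> + s - d + x p + of_nat r * \<delta>) (m p - r)"
      by (rule ph_split) (use p in \<open>simp_all add: of_nat_diff algebra_simps\<close>)
  qed auto
  then show ?thesis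
    by (simp add: d_factor_def)
qed

lemma weight_update:
  assumes p: "p \<in> I"
  shows "weight m x \<gamma> * (\<Prod>i\<in>I. ph (- x p - of_nat r * \<delta> + x i) (\<gamma> i))
    = weight (m(p := r)) x \<gamma> * (\<Prod>i\<in>I. ph (- x p - of_nat (m p) * \<delta> + x i) (\<gamma> i))"
proof -
  define w where "w m j = (\<Prod>i\<in>I. ph (- of_nat (m j) * \<delta> + x i - x j) (\<gamma> i)
     / ph (- of_nat (\<gamma> j) * \<delta> + x i - x j) (\<gamma> i))" for m :: "nat \<Rightarrow> nat" and j
  have weight: "weight m x \<gamma> = (\<Prod>j\<in>I. w m j)" for m
    unfolding weight_def w_def by (rule prod.swap)
  have "(\<Prod>j\<in>I - {p}. w m j) = (\<Prod>j\<in>I - {p}. w (m(p := r)) j)"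
    by (intro prod.cong) (auto simp: w_def)
  moreover have "w m p * (\<Prod>i\<in>I. ph (- x p - of_nat r * \<delta> + x i) (\<gamma> i))
      = w (m(p := r)) p * (\<Prod>i\<in>I. ph (- x p - of_nat (m p) * \<delta> + x i) (\<gamma> i))"
    unfolding w_def prod.distrib[symmetric] by (intro prod.cong) (auto simp: algebra_simps)
  ultimately show ?thesis
    using p unfolding weight by (simp add: prod.remove[of I p] mult.assoc)
qed

lemma poised_update:
  assumes reg: "regular m s x" and p: "p \<in> I" "r \<le> m p"
    and \<gamma>: "\<And>i. i \<in> I \<Longrightarrow> \<gamma> i \<le> (m(p := r)) i"
  shows "poised m s x \<gamma> * ph (\<delta> + s + x p + of_nat r * \<delta> + of_nat (sz \<gamma>) * \<delta>) (sz m - sz \<gamma>)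
    = poised (m(p := r)) s x \<gamma>
      * ph (\<delta> + s + x p + of_nat (m p) * \<delta> + of_nat (sz \<gamma>) * \<delta>) ((sz (m(p := r))) - sz \<gamma>)"
proof -
  define N where "N = sz \<gamma>"
  define q where "q = m p - r"
  define k where "k = ph (\<delta> + s + x p + of_nat r * \<delta> + of_nat N * \<delta>) q"
  have N: "N \<le> (sz (m(p := r)))"
    unfolding N_def by (rule size_mono[OF \<gamma>])
  have size: "sz m - N = q + ((sz (m(p := r))) - N)"
    using size_update[OF p(1), of m r] p(2) N by (simp add: q_def)
  have eq1: "ph (\<delta> + s + x p + of_nat r * \<delta> + of_nat N * \<delta>) (sz m - N)
      = k * ph (\<delta> + s + x p + of_nat (m p) * \<delta> + of_nat N * \<delta>) ((sz (m(p := r))) - N)"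
    unfolding k_def by (rule ph_split[OF size]) (use p in \<open>simp add: q_def of_nat_diff algebra_simps\<close>)
  have "ph (s + x p + of_nat N * \<delta>) (Suc (m p)) = ph (s + x p + of_nat N * \<delta>) (Suc r) * k"
    unfolding k_def by (rule ph_split) (use p in \<open>simp_all add: q_def algebra_simps\<close>)
  moreover have "ph (s + x p + of_nat N * \<delta>) (Suc (m p)) \<noteq> 0"
    using N size_update[OF p(1), of m r] p(2) by (intro poised_denominator_nonzero[OF reg p(1)]) simp
  ultimately have nz: "k \<noteq> 0" and
    eq: "ph (s + x p + of_nat N * \<delta>) (Suc (m p)) = ph (s + x p + of_nat N * \<delta>) (Suc r) * k"
    by auto
  have "poised m s x \<gamma> = poised (m(p := r)) s x \<gamma> * (1 / k)"
    unfolding poised_def by (rule prod_update[OF p(1)]) (use eq in \<open>auto simp: N_def\<close>)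
  then show ?thesis
    using nz eq1 by (simp add: N_def)
qed

text \<open>
  For \<open>c0 = - x p - r * \<delta>\<close> the terms with \<open>\<gamma> p > r\<close> vanish. In the others the factors of \<open>c0\<close> have the
  form of those of \<open>a p\<close>, so that \<open>c0\<close> and \<open>a p = - m p * \<delta>\<close> exchange their roles. The remaining factors
  change by an amount that does not depend on \<open>\<gamma>\<close> and is the same on both sides.
\<close>
lemma jackson_reduce:
  assumes reg: "regular m s x" and p: "p \<in> I" "r < m p"
    and bal: "- x p - of_nat r * \<delta> + c1 + d0 + d1 = (1 + of_nat (sz m)) * \<delta> + 2 * s"
    and IH: "(\<Sum>\<gamma>\<in>below (m(p := r)). jackson_term (m(p := r)) s x (- x p - of_nat (m p) * \<delta>) c1 d0 d1 \<gamma>)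
      = jackson_value (m(p := r)) s x (- x p - of_nat (m p) * \<delta>) c1 d0 d1"
  shows "(\<Sum>\<gamma>\<in>below m. jackson_term m s x (- x p - of_nat r * \<delta>) c1 d0 d1 \<gamma>)
    = jackson_value m s x (- x p - of_nat r * \<delta>) c1 d0 d1"
proof -
  define m' where "m' = m(p := r)"
  define q where "q = m p - r"
  define c0 where "c0 = - x p - of_nat r * \<delta>"
  define c0' where "c0' = - x p - of_nat (m p) * \<delta>"
  define K1 where "K1 = ph (\<delta> + s - c1 + of_nat (sz m') * \<delta>) q"
  define K2 where "K2 d = ph (\<delta> + s - d + x p + of_nat r * \<delta>) q" for d
  have size: "sz m = sz m' + q" and mp: "m p = r + q"
    using size_update[OF p(1), of m r] p(2) by (simp_all add: q_def m'_def)
  have c1: "c1 = (1 + of_nat r + of_nat (sz m)) * \<delta> + 2 * s + x p - d0 - d1"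
    using bal by (simp add: algebra_simps)
  have below: "below m' \<subseteq> below m"
    using p by (auto simp: PiE_iff m'_def split: if_splits)
  have "(\<Sum>\<gamma>\<in>below m. jackson_term m s x c0 c1 d0 d1 \<gamma>) = (\<Sum>\<gamma>\<in>below m'. jackson_term m s x c0 c1 d0 d1 \<gamma>)"
  proof (rule sum.mono_neutral_right[OF finite_below below], rule ballI)
    fix \<gamma> assume \<gamma>: "\<gamma> \<in> below m - below m'"
    then have "r < \<gamma> p"
      by (auto simp: PiE_iff m'_def split: if_splits)
    then show "jackson_term m s x c0 c1 d0 d1 \<gamma> = 0"
      using c_factor_eq_0[OF p(1)] by (simp add: jackson_term_def c0_def)
  qed
  also have "\<dots> = (\<Sum>\<gamma>\<in>below m'. jackson_term m' s x c0' c1 d0 d1 \<gamma> * (K1 * K2 d0 * K2 d1))"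
  proof (rule sum.cong[OF refl])
    fix \<gamma> assume \<gamma>: "\<gamma> \<in> below m'"
    define N where "N = sz \<gamma>"
    have le: "\<gamma> i \<le> m' i" if "i \<in> I" for i
      using \<gamma> that by (rule below_le)
    have N: "N \<le> sz m'"
      unfolding N_def by (rule size_mono[OF le])
    have "\<gamma> p \<le> r"
      using le[OF p(1)] by (simp add: m'_def)
    then have d: "d_factor m s x d \<gamma> = d_factor m' s x d \<gamma> * K2 d" for d
      using p unfolding m'_def K2_def q_def by (intro d_factor_update) auto
    have "ph (\<delta> + s - c1 + of_nat N * \<delta>) (sz m - N) = ph (\<delta> + s - c1 + of_nat N * \<delta>) (sz m' - N) * K1"
      unfolding K1_def by (rule ph_split) (use N in \<open>simp_all add: size of_nat_diff algebra_simps\<close>)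
    then have c: "c_factor m s x c1 \<gamma> = c_factor m' s x c1 \<gamma> * K1"
      by (simp add: c_factor_def N_def)
    have "poised m s x \<gamma> * ph (\<delta> + s + x p + of_nat r * \<delta> + of_nat N * \<delta>) (sz m - N)
      = poised m' s x \<gamma> * ph (\<delta> + s + x p + of_nat (m p) * \<delta> + of_nat N * \<delta>) (sz m' - N)"
      unfolding m'_def N_def using p le by (intro poised_update[OF reg]) (auto simp: m'_def)
    moreover have "\<delta> + s + x p + of_nat r * \<delta> + of_nat N * \<delta> = \<delta> + s - c0 + of_nat N * \<delta>"
      "\<delta> + s + x p + of_nat (m p) * \<delta> + of_nat N * \<delta> = \<delta> + s - c0' + of_nat N * \<delta>"
      by (simp_all add: c0_def c0'_def)
    ultimately have "poised m s x \<gamma> * ph (\<delta> + s - c0 + of_nat N * \<delta>) (sz m - N)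
      = poised m' s x \<gamma> * ph (\<delta> + s - c0' + of_nat N * \<delta>) (sz m' - N)"
      by simp
    moreover have "weight m x \<gamma> * (\<Prod>i\<in>I. ph (c0 + x i) (\<gamma> i)) = weight m' x \<gamma> * (\<Prod>i\<in>I. ph (c0' + x i) (\<gamma> i))"
      unfolding c0_def c0'_def m'_def by (rule weight_update[OF p(1)])
    ultimately have "weight m x \<gamma> * poised m s x \<gamma> * c_factor m s x c0 \<gamma>
        = weight m' x \<gamma> * poised m' s x \<gamma> * c_factor m' s x c0' \<gamma>"
      unfolding c_factor_def N_def by algebra
    moreover define e :: complex where "e = (- 1) ^ sz \<gamma>"
    ultimately show "jackson_term m s x c0 c1 d0 d1 \<gamma> = jackson_term m' s x c0' c1 d0 d1 \<gamma> * (K1 * K2 d0 * K2 d1)"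
      unfolding jackson_term_def c d e_def[symmetric] by algebra
  qed
  also have "\<dots> = jackson_value m' s x c0' c1 d0 d1 * (K1 * K2 d0 * K2 d1)"
    using IH by (simp add: m'_def c0'_def flip: sum_distrib_right)
  also have "\<dots> = jackson_value m s x c0 c1 d0 d1"
  proof -
    define L where "L = ph (\<delta> + s - d0 - d1 + x p + of_nat r * \<delta>) q"
    have v1: "ph (\<delta> + s - c0 - d0) (sz m) = K2 d0 * ph (\<delta> + s - c0' - d0) (sz m')"
    proof -
      have "ph (\<delta> + s - c0 - d0) (sz m) = ph (\<delta> + s - c0 - d0) q * ph (\<delta> + s - c0' - d0) (sz m')"
        by (rule ph_split) (simp_all add: size c0_def c0'_def mp algebra_simps)
      then show ?thesis
        by (simp add: K2_def c0_def algebra_simps)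
    qed
    have v2: "ph (\<delta> + s - c1 - d0) (sz m) = ph (\<delta> + s - c1 - d0) (sz m') * ((- 1) ^ q * K2 d1)"
    proof -
      have "ph (\<delta> + s - c1 - d0) (sz m)
          = ph (\<delta> + s - c1 - d0) (sz m') * ph (\<delta> + s - c1 - d0 + of_nat (sz m') * \<delta>) q"
        by (rule ph_split) (simp_all add: size)
      also have "ph (\<delta> + s - c1 - d0 + of_nat (sz m') * \<delta>) q = (- 1) ^ q * K2 d1"
        unfolding K2_def by (rule ph_reflect) (simp add: c1 size algebra_simps)
      finally show ?thesis .
    qed
    have v3: "(\<Prod>i\<in>I. ph (\<delta> + s - d0 - d1 + x i) (m i)) = (\<Prod>i\<in>I. ph (\<delta> + s - d0 - d1 + x i) (m' i)) * L"
      unfolding L_def by (rule prod_update[OF p(1)]) (auto simp: m'_def mp intro!: ph_split)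
    have k1: "K1 = (- 1) ^ q * L"
      unfolding K1_def L_def by (rule ph_reflect) (simp add: c1 size algebra_simps)
    show ?thesis
      unfolding jackson_value_def v1 v2 v3 k1 by (simp add: mult_ac)
  qed
  finally show ?thesis
    unfolding c0_def .
qed

lemma jackson_top:
  assumes reg: "regular m s x"
  shows "(\<Sum>\<gamma>\<in>below m. jackson_term m s x (s + of_nat (sz m) * \<delta>) (\<delta> + s - d0 - d1) d0 d1 \<gamma>)
    = jackson_value m s x (s + of_nat (sz m) * \<delta>) (\<delta> + s - d0 - d1) d0 d1"
proof -
  define M where "M = sz m"
  define c0 where "c0 = s + of_nat M * \<delta>"
  define c1 where "c1 = \<delta> + s - d0 - d1"
  define \<mu> where "\<mu> = restrict m I"
  have \<mu>: "\<mu> \<in> below m" "\<And>i. i \<in> I \<Longrightarrow> \<mu> i = m i" "sz \<mu> = M"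
    unfolding \<mu>_def M_def by (auto intro: size_cong)
  have "(\<Sum>\<gamma>\<in>below m. jackson_term m s x c0 c1 d0 d1 \<gamma>) = (\<Sum>\<gamma>\<in>{\<mu>}. jackson_term m s x c0 c1 d0 d1 \<gamma>)"
  proof (rule sum.mono_neutral_right[OF finite_below], use \<mu>(1) in simp, rule ballI)
    fix \<gamma> assume \<gamma>: "\<gamma> \<in> below m - {\<mu>}"
    have "\<exists>i\<in>I. \<gamma> i < m i"
    proof (rule ccontr)
      assume "\<not> (\<exists>i\<in>I. \<gamma> i < m i)"
      then have "\<gamma> i = \<mu> i" if "i \<in> I" for i
        using below_le[of \<gamma> m i] \<gamma> that \<mu>(2)[of i] by (force simp: not_less)
      then have "\<gamma> = \<mu>"
        using \<gamma> \<mu>(1) by (intro PiE_ext[of \<gamma> I "\<lambda>i. {..m i}" \<mu>]) auto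
      with \<gamma> show False by simp
    qed
    then have lt: "sz \<gamma> < M"
      unfolding M_def size_eq using below_le[of \<gamma> m] \<gamma> by (intro sum_strict_mono_ex1) auto
    have "ph (\<delta> + s - c0 + of_nat (sz \<gamma>) * \<delta>) (M - sz \<gamma>) = 0"
      unfolding ph_eq_0_iff using lt
      by (intro exI[of _ "M - sz \<gamma> - 1"]) (simp add: c0_def of_nat_diff algebra_simps)
    then show "jackson_term m s x c0 c1 d0 d1 \<gamma> = 0"
      by (simp add: jackson_term_def c_factor_def M_def)
  qed
  also have "\<dots> = jackson_term m s x c0 c1 d0 d1 \<mu>"
    by simp
  also have "\<dots> = jackson_value m s x c0 c1 d0 d1"
  proof -
    have w: "weight m x \<mu> = 1"
      unfolding weight_def using \<mu>(2) weight_denominator_nonzero[OF reg, of _ _ m]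
      by (intro prod.neutral ballI) auto
    have "poised m s x \<mu> * (\<Prod>i\<in>I. ph (c0 + x i) (\<mu> i)) = (\<Prod>i\<in>I. 1)"
      unfolding poised_def prod.distrib[symmetric]
    proof (rule prod.cong[OF refl])
      fix i assume i: "i \<in> I"
      have "ph (s + x i + of_nat M * \<delta>) (Suc (m i)) \<noteq> 0"
        using i by (intro poised_denominator_nonzero[OF reg]) (auto simp: M_def)
      moreover have "ph (s + x i + of_nat M * \<delta>) (Suc (m i))
          = ph (c0 + x i) (m i) * br (of_nat (M + m i) * \<delta> + s + x i)"
        by (simp add: ph_Suc c0_def algebra_simps)
      ultimately show "br (of_nat (sz \<mu> + \<mu> i) * \<delta> + s + x i)
          / ph (s + x i + of_nat (sz \<mu>) * \<delta>) (Suc (m i)) * ph (c0 + x i) (\<mu> i) = 1"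
        using i by (simp add: \<mu>)
    qed
    then have p: "poised m s x \<mu> * c_factor m s x c0 \<mu> = 1"
      by (simp add: c_factor_def \<mu>(3) M_def)
    have c: "c_factor m s x c1 \<mu> = (\<Prod>i\<in>I. ph (\<delta> + s - d0 - d1 + x i) (m i))"
      by (simp add: c_factor_def \<mu>(3) M_def c1_def \<mu>(2))
    have d: "d_factor m s x d \<mu> = ph d M" for d
      by (simp add: d_factor_def \<mu>(3) \<mu>(2))
    have v1: "ph (\<delta> + s - c0 - d0) M = (- 1) ^ M * ph d0 M"
      by (rule ph_reflect) (simp add: c0_def)
    have v2: "\<delta> + s - c1 - d0 = d1"
      by (simp add: c1_def)
    define e :: complex where "e = (- 1) ^ M"
    show ?thesis
      using p unfolding jackson_term_def jackson_value_def w c d \<mu>(3) M_def[symmetric] v1 v2 e_def[symmetric]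
      by algebra
  qed
  finally show ?thesis
    unfolding c0_def c1_def M_def .
qed

text \<open>
  Induction on \<open>sz m\<close>, by interpolation in \<open>z = (c0 - c1) / 2\<close>; \<open>e\<close> is the fixed value of
  \<open>(c0 + c1) / 2\<close>.
\<close>
theorem jackson_separated:
  assumes "regular m s x" "separated m s x d0 d1"
    and "c0 + c1 + d0 + d1 = (1 + of_nat (sz m)) * \<delta> + 2 * s"
  shows "(\<Sum>\<gamma>\<in>below m. jackson_term m s x c0 c1 d0 d1 \<gamma>) = jackson_value m s x c0 c1 d0 d1"
  using assms
proof (induction "sz m" arbitrary: m c0 c1 rule: less_induct)
  case less
  define M where "M = sz m"
  define e where "e = ((1 + of_nat M) * \<delta> + 2 * s - d0 - d1) / 2"
  have e2: "2 * e = (1 + of_nat M) * \<delta> + 2 * s - d0 - d1"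
    by (simp add: e_def)
  define F where "F z = (\<Sum>\<gamma>\<in>below m. jackson_term m s x (e + z) (e - z) d0 d1 \<gamma>)
    - jackson_value m s x (e + z) (e - z) d0 d1" for z
  have "even_span M F"
  proof -
    have "even_span M (\<lambda>z. jackson_term m s x (e + z) (e - z) d0 d1 \<gamma>)" if \<gamma>: "\<gamma> \<in> below m" for \<gamma>
    proof -
      define u where "u = \<delta> + s - e + of_nat (sz \<gamma>) * \<delta>"
      have "sz \<gamma> \<le> M"
        unfolding M_def using below_le[OF \<gamma>] by (rule size_mono)
      then have deg: "M - sz \<gamma> + (\<Sum>i\<in>I. \<gamma> i) = M"
        by (simp add: size_eq)
      have "even_span (M - sz \<gamma> + (\<Sum>i\<in>I. \<gamma> i)) (\<lambda>z. ph (u + z) (M - sz \<gamma>) * ph (u - z) (M - sz \<gamma>)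
          * (\<Prod>i\<in>I. ph (e + x i + z) (\<gamma> i) * ph (e + x i - z) (\<gamma> i)))"
        by (intro even_span_mult even_span_prod even_span_ph)
      then have "even_span M (\<lambda>z. (- 1) ^ sz \<gamma> * weight m x \<gamma> * poised m s x \<gamma>
          * (d_factor m s x d0 \<gamma> * d_factor m s x d1 \<gamma>)
          * (ph (u + z) (M - sz \<gamma>) * ph (u - z) (M - sz \<gamma>)
          * (\<Prod>i\<in>I. ph (e + x i + z) (\<gamma> i) * ph (e + x i - z) (\<gamma> i))))"
        unfolding deg by (rule even_span_mult_left)
      moreover have "jackson_term m s x (e + z) (e - z) d0 d1 \<gamma> = (- 1) ^ sz \<gamma> * weight m x \<gamma> * poised m s x \<gamma>
          * (d_factor m s x d0 \<gamma> * d_factor m s x d1 \<gamma>)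
          * (ph (u + z) (M - sz \<gamma>) * ph (u - z) (M - sz \<gamma>)
          * (\<Prod>i\<in>I. ph (e + x i + z) (\<gamma> i) * ph (e + x i - z) (\<gamma> i)))" for z
      proof -
        have "\<delta> + s - (e + z) + of_nat (sz \<gamma>) * \<delta> = u - z" "\<delta> + s - (e - z) + of_nat (sz \<gamma>) * \<delta> = u + z"
          "e + z + x i = e + x i + z" "e - z + x i = e + x i - z" for i
          by (simp_all add: u_def)
        then show ?thesis
          unfolding jackson_term_def c_factor_def M_def[symmetric] prod.distrib by (simp only: mult_ac)
      qed
      ultimately show ?thesis
        by simp
    qed
    then have 1: "even_span M (\<lambda>z. \<Sum>\<gamma>\<in>below m. jackson_term m s x (e + z) (e - z) d0 d1 \<gamma>)"
      by (rule even_span_sum)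
    define v where "v = \<delta> + s - e - d0"
    have "even_span M (\<lambda>z. (- (\<Prod>i\<in>I. ph (\<delta> + s - d0 - d1 + x i) (m i))) * (ph (v + z) M * ph (v - z) M))"
      by (intro even_span_mult_left even_span_ph)
    moreover have "- jackson_value m s x (e + z) (e - z) d0 d1
        = (- (\<Prod>i\<in>I. ph (\<delta> + s - d0 - d1 + x i) (m i))) * (ph (v + z) M * ph (v - z) M)" for z
    proof -
      have "\<delta> + s - (e + z) - d0 = v - z" "\<delta> + s - (e - z) - d0 = v + z"
        by (simp_all add: v_def)
      then show ?thesis
        unfolding jackson_value_def M_def[symmetric] by (simp only: mult_minus_left mult_minus_right mult_ac)
    qed
    ultimately have "even_span M (\<lambda>z. - jackson_value m s x (e + z) (e - z) d0 d1)"
      by simp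
    from even_span.add[OF 1 this] show ?thesis
      by (simp add: F_def[abs_def])
  qed
  moreover define J where "J = insert None (Some ` (SIGMA p:I. {..<m p}))"
  define pt where "pt j = (case j of None \<Rightarrow> s + of_nat M * \<delta> | Some (p, r) \<Rightarrow> - x p - of_nat r * \<delta>) - e"
    for j :: "(nat \<times> nat) option"
  have finJ: "finite J"
    by (auto simp: J_def intro!: finite_SigmaI)
  moreover have "M < card J"
  proof -
    have "card (Some ` (SIGMA p:I. {..<m p})) = M"
      by (simp add: card_image card_SigmaI M_def size_eq)
    moreover have "None \<notin> Some ` (SIGMA p:I. {..<m p})"
      by auto
    ultimately show ?thesis
      using finJ unfolding J_def by (subst card_insert_disjoint) auto
  qed
  moreover have "F (pt j) = 0" if jJ: "j \<in> J" for j
  proof (cases j)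
    case None
    have "e - pt None = \<delta> + s - d0 - d1"
      using e2 by (simp add: pt_def algebra_simps)
    moreover have "e + pt None = s + of_nat M * \<delta>"
      by (simp add: pt_def)
    ultimately show ?thesis
      using jackson_top[OF less.prems(1)] unfolding F_def None M_def by simp
  next
    case (Some a)
    then obtain p r where j: "j = Some (p, r)" and p: "p \<in> I" "r < m p"
      using jJ by (auto simp: J_def)
    define m' where "m' = m(p := r)"
    define c1 where "c1 = e - pt j"
    have c0: "e + pt j = - x p - of_nat r * \<delta>"
      by (simp add: pt_def j)
    have bal: "- x p - of_nat r * \<delta> + c1 + d0 + d1 = (1 + of_nat M) * \<delta> + 2 * s"
      using e2 by (simp add: c1_def pt_def j algebra_simps)
    have size: "sz m' + m p = M + r"
      using size_update[OF p(1), of m r] by (simp add: m'_def M_def)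
    have lt: "sz m' < M"
      using size p(2) by linarith
    have reg: "regular m' s x"
      using p by (intro regular_mono[OF less.prems(1)]) (auto simp: m'_def)
    have sep: "separated m' s x d0 d1"
      using less.prems(2) lt unfolding separated_def M_def by auto
    have "(of_nat (sz m') + of_nat (m p) :: complex) = of_nat M + of_nat r"
      using size by (metis of_nat_add)
    then have "of_nat (sz m') * \<delta> + of_nat (m p) * \<delta> = of_nat M * \<delta> + of_nat r * \<delta>"
      by (metis distrib_right)
    then have bal': "- x p - of_nat (m p) * \<delta> + c1 + d0 + d1 = (1 + of_nat (sz m')) * \<delta> + 2 * s"
      using bal by (simp add: algebra_simps add_eq_0_iff2)
    have "(\<Sum>\<gamma>\<in>below m'. jackson_term m' s x (- x p - of_nat (m p) * \<delta>) c1 d0 d1 \<gamma>)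
        = jackson_value m' s x (- x p - of_nat (m p) * \<delta>) c1 d0 d1"
      using lt bal' reg sep by (intro less.hyps) (auto simp: M_def)
    then have "(\<Sum>\<gamma>\<in>below m. jackson_term m s x (- x p - of_nat r * \<delta>) c1 d0 d1 \<gamma>)
        = jackson_value m s x (- x p - of_nat r * \<delta>) c1 d0 d1"
      using bal p unfolding m'_def M_def by (intro jackson_reduce[OF less.prems(1)])
    then show ?thesis
      unfolding F_def c0 c1_def[symmetric] by simp
  qed
  moreover have "br (pt i + pt j) * br (pt i - pt j) \<noteq> 0" if ij: "i \<in> J" "j \<in> J" "i \<noteq> j" for i j
  proof -
    have top: "br (pt None + pt (Some (p, r))) * br (pt None - pt (Some (p, r))) \<noteq> 0"
      if p: "p \<in> I" "r < m p" for p r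
    proof -
      have "m p \<le> M"
        unfolding M_def by (rule size_ge[OF p(1)])
      then have "1 + r \<le> 1 + 3 * M" "M + r \<le> M + m p"
        using p by auto
      then have nz: "br (s + x p - d0 - d1 + of_nat (1 + r) * \<delta>) \<noteq> 0" "br (s + x p + of_nat (M + r) * \<delta>) \<noteq> 0"
        using less.prems(2) regular_sumD[OF less.prems(1) p(1), of "M + r"] p
        unfolding separated_def M_def[symmetric] by blast+
      have eq: "pt None + pt (Some (p, r)) = - (s + x p - d0 - d1 + of_nat (1 + r) * \<delta>)"
        "pt None - pt (Some (p, r)) = s + x p + of_nat (M + r) * \<delta>"
        using e2 by (simp_all add: pt_def algebra_simps)
      show ?thesis
        unfolding eq odd using nz by simp
    qed
    have pair: "br (pt (Some (p, r)) + pt (Some (q, t))) * br (pt (Some (p, r)) - pt (Some (q, t))) \<noteq> 0"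
      if p: "p \<in> I" "r < m p" and q: "q \<in> I" "t < m q" and ne: "(p, r) \<noteq> (q, t)" for p r q t
    proof -
      have "m p \<le> M" "m q \<le> M"
        unfolding M_def by (rule size_ge[OF p(1)], rule size_ge[OF q(1)])
      then have "1 + M + r + t \<le> 1 + 3 * M"
        using p q by linarith
      then have 1: "br (2 * s + x p + x q - d0 - d1 + of_nat (1 + M + r + t) * \<delta>) \<noteq> 0"
        using less.prems(2) p q unfolding separated_def M_def[symmetric] by blast
      have 2: "br (x q - x p + of_int (int t - int r) * \<delta>) \<noteq> 0"
      proof (cases "p = q")
        case True
        then show ?thesis
          using br_step[of "int t - int r"] ne by simp
      next
        case False
        then show ?thesis
          using p q by (intro regular_differenceD[OF less.prems(1)]) auto
      qed
      have eq: "pt (Some (p, r)) + pt (Some (q, t)) = - (2 * s + x p + x q - d0 - d1 + of_nat (1 + M + r + t) * \<delta>)"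
        "pt (Some (p, r)) - pt (Some (q, t)) = x q - x p + of_int (int t - int r) * \<delta>"
        using e2 by (simp_all add: pt_def algebra_simps)
      show ?thesis
        unfolding eq odd using 1 2 by simp
    qed
    show ?thesis
    proof (cases i)
      case None
      then obtain p r where "j = Some (p, r)" "p \<in> I" "r < m p"
        using ij by (auto simp: J_def)
      then show ?thesis
        using top None by simp
    next
      case (Some a)
      then obtain p r where i: "i = Some (p, r)" "p \<in> I" "r < m p"
        using ij(1) by (auto simp: J_def)
      show ?thesis
      proof (cases j)
        case None
        then show ?thesis
          using top[OF i(2,3)] odd_diff[of "pt i" "pt j"] by (simp add: i(1) add.commute)
      next
        case (Some b)
        then obtain q t where j: "j = Some (q, t)" "q \<in> I" "t < m q"
          using ij(2) by (auto simp: J_def)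
        then show ?thesis
          using pair[OF i(2,3) j(2,3)] ij(3) by (simp add: i(1))
      qed
    qed
  qed
  ultimately have "F ((c0 - c1) / 2) = 0"
    by (rule even_span_interpolation)
  moreover have "2 * e = c0 + c1"
    using less.prems(3) e2 unfolding M_def by algebra
  then have "e = (c0 + c1) / 2"
    by (simp add: eq_divide_eq mult.commute)
  then have "e + (c0 - c1) / 2 = c0" "e - (c0 - c1) / 2 = c1"
    by (simp_all add: field_simps)
  ultimately show ?case
    by (simp add: F_def)
qed

text \<open>Moving \<open>d0\<close> and \<open>c1\<close> in opposite directions separates the nodes, and both sides are continuous.\<close>
theorem jackson:
  assumes reg: "regular m s x"
    and bal: "c0 + c1 + d0 + d1 = (1 + of_nat (sz m)) * \<delta> + 2 * s"
  shows "(\<Sum>\<gamma>\<in>below m. jackson_term m s x c0 c1 d0 d1 \<gamma>) = jackson_value m s x c0 c1 d0 d1"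
proof -
  have "\<forall>\<^sub>F t in at 0. separated m s x (d0 + t) d1"
  proof -
    have "\<forall>\<^sub>F t in at 0. \<forall>p\<in>I. \<forall>k\<in>{..1 + 3 * (sz m)}. br (s + x p - d0 - d1 + of_nat k * \<delta> - t) \<noteq> 0
        \<and> (\<forall>q\<in>I. br (2 * s + x p + x q - d0 - d1 + of_nat k * \<delta> - t) \<noteq> 0)"
      by (intro eventually_ball_finite ballI eventually_conj eventually_br_nonzero finite_I finite_atMost)
    then show ?thesis
      by eventually_elim (auto simp: separated_def algebra_simps)
  qed
  then have ev: "\<forall>\<^sub>F t in at 0. (\<Sum>\<gamma>\<in>below m. jackson_term m s x c0 (c1 - t) (d0 + t) d1 \<gamma>)
      = jackson_value m s x c0 (c1 - t) (d0 + t) d1"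
    by eventually_elim (use bal in \<open>auto intro!: jackson_separated[OF reg] simp: algebra_simps\<close>)
  have ph: "((\<lambda>t. ph (f t) k) \<longlongrightarrow> ph l k) (at 0)" if "(f \<longlongrightarrow> l) (at 0)" for f l k
    unfolding shifted_fact_def by (intro tendsto_intros isCont_tendsto_compose[OF isCont_br] that)
  have "((\<lambda>t. \<Sum>\<gamma>\<in>below m. jackson_term m s x c0 (c1 - t) (d0 + t) d1 \<gamma>) \<longlongrightarrow>
      (\<Sum>\<gamma>\<in>below m. jackson_term m s x c0 (c1 - 0) (d0 + 0) d1 \<gamma>)) (at 0)"
    unfolding jackson_term_def c_factor_def d_factor_def by (intro tendsto_intros ph)
  moreover have "((\<lambda>t. jackson_value m s x c0 (c1 - t) (d0 + t) d1) \<longlongrightarrow>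
      jackson_value m s x c0 (c1 - 0) (d0 + 0) d1) (at 0)"
    unfolding jackson_value_def by (intro tendsto_intros ph)
  ultimately have "(\<Sum>\<gamma>\<in>below m. jackson_term m s x c0 (c1 - 0) (d0 + 0) d1 \<gamma>)
      = jackson_value m s x c0 (c1 - 0) (d0 + 0) d1"
    using ev by (intro tendsto_unique[OF at_neq_bot Lim_transform_eventually])
  then show ?thesis
    by simp
qed

section \<open>The Bailey transformation\<close>

text \<open>
  The analogue of
  \<open>binom m (\<kappa> + \<mu>) * binom (\<kappa> + \<mu>) \<kappa> = binom m \<kappa> * binom (m - \<kappa>) \<mu>\<close>. It is what makes the
  inner sum over \<open>\<mu>\<close> in Bailey's argument a Jackson sum with parameters shifted by \<open>\<kappa>\<close>.
\<close>
lemma weight_compose: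
  assumes reg: "regular m s x" and \<gamma>: "\<And>i. i \<in> I \<Longrightarrow> \<gamma> i = \<kappa> i + \<mu> i" "\<And>i. i \<in> I \<Longrightarrow> \<gamma> i \<le> m i"
  shows "weight m x \<gamma> * weight \<gamma> x \<kappa>
    = weight m x \<kappa> * weight (\<lambda>i. m i - \<kappa> i) (\<lambda>i. x i + of_nat (\<kappa> i) * \<delta>) \<mu>"
  unfolding weight_def prod.distrib[symmetric]
proof (intro prod.cong refl)
  fix i j assume i: "i \<in> I" and j: "j \<in> I"
  define A B where "A = - of_nat (m j) * \<delta> + x i - x j" and "B = - of_nat (\<gamma> j) * \<delta> + x i - x j"
  define X where "X = x i + of_nat (\<kappa> i) * \<delta> - (x j + of_nat (\<kappa> j) * \<delta>)"
  have mj: "m j = \<kappa> j + (m j - \<kappa> j)"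
    using \<gamma>[OF j] by simp
  have "of_nat (m j) = (of_nat (\<kappa> j) + of_nat (m j - \<kappa> j) :: complex)"
    by (subst mj) (rule of_nat_add)
  then have A: "ph A (\<gamma> i) = ph A (\<kappa> i) * ph (- of_nat (m j - \<kappa> j) * \<delta> + X) (\<mu> i)"
    using \<gamma>(1)[OF i] by (intro ph_split) (simp_all add: A_def X_def algebra_simps)
  have B: "ph B (\<gamma> i) = ph B (\<kappa> i) * ph (- of_nat (\<mu> j) * \<delta> + X) (\<mu> i)"
    using \<gamma>(1)[OF i] \<gamma>(1)[OF j] by (intro ph_split) (simp_all add: B_def X_def algebra_simps)
  have "ph B (\<gamma> i) \<noteq> 0"
    unfolding B_def using i j \<gamma>(2) by (intro weight_denominator_nonzero[OF reg]) auto
  then have "ph A (\<gamma> i) / ph B (\<gamma> i) * (ph B (\<kappa> i) / ph (- of_nat (\<kappa> j) * \<delta> + x i - x j) (\<kappa> i))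
    = ph A (\<kappa> i) / ph (- of_nat (\<kappa> j) * \<delta> + x i - x j) (\<kappa> i)
      * (ph (- of_nat (m j - \<kappa> j) * \<delta> + X) (\<mu> i) / ph (- of_nat (\<mu> j) * \<delta> + X) (\<mu> i))"
    unfolding A B by simp
  then show "ph (- of_nat (m j) * \<delta> + x i - x j) (\<gamma> i) / ph (- of_nat (\<gamma> j) * \<delta> + x i - x j) (\<gamma> i)
      * (ph (- of_nat (\<gamma> j) * \<delta> + x i - x j) (\<kappa> i) / ph (- of_nat (\<kappa> j) * \<delta> + x i - x j) (\<kappa> i))
    = ph (- of_nat (m j) * \<delta> + x i - x j) (\<kappa> i) / ph (- of_nat (\<kappa> j) * \<delta> + x i - x j) (\<kappa> i)
      * (ph (- of_nat (m j - \<kappa> j) * \<delta> + (x i + of_nat (\<kappa> i) * \<delta>) - (x j + of_nat (\<kappa> j) * \<delta>)) (\<mu> i)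
        / ph (- of_nat (\<mu> j) * \<delta> + (x i + of_nat (\<kappa> i) * \<delta>) - (x j + of_nat (\<kappa> j) * \<delta>)) (\<mu> i))"
    unfolding A_def B_def X_def by (simp only: add_diff_eq)
qed

text \<open>
  The two products of shifted factorials come from one parameter of each of the two Jackson sums in
  Bailey's argument: \<open>s + N * \<delta>\<close>, in the role of a \<open>c\<close>, of the sum that is inserted, and \<open>s - \<nu>\<close>, in
  the role of a \<open>d\<close>, of the sum over \<open>\<mu>\<close>.
\<close>
lemma poised_compose:
  assumes reg: "regular m s x" "regular m \<nu> x"
    and \<gamma>: "\<And>i. i \<in> I \<Longrightarrow> \<gamma> i = \<kappa> i + \<mu> i" "\<And>i. i \<in> I \<Longrightarrow> \<gamma> i \<le> m i"
    and N: "N = sz \<gamma>" and K: "K = sz \<kappa>"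
  shows "poised m s x \<gamma> * poised \<gamma> \<nu> x \<kappa> * (\<Prod>i\<in>I. ph (s + of_nat N * \<delta> + x i) (\<kappa> i))
    = poised m \<nu> x \<kappa>
      * (poised (\<lambda>i. m i - \<kappa> i) (s + of_nat K * \<delta>) (\<lambda>i. x i + of_nat (\<kappa> i) * \<delta>) \<mu>
        * (\<Prod>i\<in>I. ph (\<delta> + (s + of_nat K * \<delta>) - (s - \<nu>) + (x i + of_nat (\<kappa> i) * \<delta>) + of_nat (\<mu> i) * \<delta>)
            (m i - \<kappa> i - \<mu> i)))"
  unfolding poised_def prod.distrib[symmetric]
proof (rule prod.cong[OF refl])
  fix i assume i: "i \<in> I"
  define U where "U = sz \<mu>"
  have NKU: "N = K + U"
    unfolding N K U_def size_eq sum.distrib[symmetric] by (intro sum.cong) (auto simp: \<gamma>)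
  have NM: "N \<le> sz m"
    unfolding N by (rule size_mono[OF \<gamma>(2)])
  define y where "y = s + x i + of_nat N * \<delta>"
  define l where "l = \<nu> + x i + of_nat K * \<delta>"
  define rest where "rest = ph (\<delta> + (s + of_nat K * \<delta>) - (s - \<nu>) + (x i + of_nat (\<kappa> i) * \<delta>) + of_nat (\<mu> i) * \<delta>)
            (m i - \<kappa> i - \<mu> i)"
  have y: "ph y (Suc (m i)) = ph (s + of_nat N * \<delta> + x i) (\<kappa> i)
      * ph (s + of_nat K * \<delta> + (x i + of_nat (\<kappa> i) * \<delta>) + of_nat U * \<delta>) (Suc (m i - \<kappa> i))"
  proof -
    have "ph y (Suc (m i)) = ph y (\<kappa> i) * ph (s + of_nat K * \<delta> + (x i + of_nat (\<kappa> i) * \<delta>) + of_nat U * \<delta>) (Suc (m i - \<kappa> i))"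
      using \<gamma>[OF i] by (intro ph_split) (simp_all add: y_def NKU algebra_simps)
    moreover have "y = s + of_nat N * \<delta> + x i"
      by (simp add: y_def)
    ultimately show ?thesis by simp
  qed
  have l: "ph l (Suc (m i)) = ph l (Suc (\<gamma> i)) * rest"
    unfolding rest_def using \<gamma>[OF i] by (intro ph_split) (simp_all add: l_def algebra_simps)
  have "ph y (Suc (m i)) \<noteq> 0"
    unfolding y_def using NM by (intro poised_denominator_nonzero[OF reg(1) i]) simp
  moreover have "ph l (Suc (m i)) \<noteq> 0"
    unfolding l_def using NM NKU by (intro poised_denominator_nonzero[OF reg(2) i]) simp
  ultimately have nz: "ph y (Suc (m i)) \<noteq> 0" "ph l (Suc (m i)) \<noteq> 0" .
  have num: "of_nat (U + \<mu> i) * \<delta> + (s + of_nat K * \<delta>) + (x i + of_nat (\<kappa> i) * \<delta>) = of_nat (N + \<gamma> i) * \<delta> + s + x i"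
    using \<gamma>(1)[OF i] by (simp add: NKU algebra_simps)
  show "br (of_nat (sz \<gamma> + \<gamma> i) * \<delta> + s + x i) / ph (s + x i + of_nat (sz \<gamma>) * \<delta>) (Suc (m i))
      * (br (of_nat (sz \<kappa> + \<kappa> i) * \<delta> + \<nu> + x i) / ph (\<nu> + x i + of_nat (sz \<kappa>) * \<delta>) (Suc (\<gamma> i)))
      * ph (s + of_nat N * \<delta> + x i) (\<kappa> i)
    = br (of_nat (sz \<kappa> + \<kappa> i) * \<delta> + \<nu> + x i) / ph (\<nu> + x i + of_nat (sz \<kappa>) * \<delta>) (Suc (m i))
      * (br (of_nat (sz \<mu> + \<mu> i) * \<delta> + (s + of_nat K * \<delta>) + (x i + of_nat (\<kappa> i) * \<delta>))
          / ph (s + of_nat K * \<delta> + (x i + of_nat (\<kappa> i) * \<delta>) + of_nat (sz \<mu>) * \<delta>) (Suc (m i - \<kappa> i))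
        * ph (\<delta> + (s + of_nat K * \<delta>) - (s - \<nu>) + (x i + of_nat (\<kappa> i) * \<delta>) + of_nat (\<mu> i) * \<delta>) (m i - \<kappa> i - \<mu> i))"
    unfolding N[symmetric] K[symmetric] U_def[symmetric] rest_def[symmetric] y_def[symmetric] l_def[symmetric] num
    using nz unfolding y l by (simp add: field_simps)
qed

lemma c_factor_compose:
  assumes \<gamma>: "\<And>i. i \<in> I \<Longrightarrow> \<gamma> i \<le> m i" and \<kappa>: "\<And>i. i \<in> I \<Longrightarrow> \<kappa> i \<le> \<gamma> i"
    and c: "s - c0 = \<nu> - c"
  shows "c_factor \<gamma> \<nu> x c \<kappa> * ph (\<delta> + s - c0 + of_nat (sz \<gamma>) * \<delta>) (sz m - sz \<gamma>) = c_factor m \<nu> x c \<kappa>"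
proof -
  have "sz \<kappa> \<le> sz \<gamma>" "sz \<gamma> \<le> sz m"
    by (rule size_mono[OF \<kappa>], assumption, rule size_mono[OF \<gamma>])
  moreover have "\<delta> + s - c0 = \<delta> + \<nu> - c"
    using c by (metis add_diff_eq)
  ultimately have "ph (\<delta> + \<nu> - c + of_nat (sz \<kappa>) * \<delta>) (sz m - sz \<kappa>)
      = ph (\<delta> + \<nu> - c + of_nat (sz \<kappa>) * \<delta>) (sz \<gamma> - sz \<kappa>) * ph (\<delta> + s - c0 + of_nat (sz \<gamma>) * \<delta>) (sz m - sz \<gamma>)"
    by (intro ph_split) (simp_all add: of_nat_diff algebra_simps)
  then show ?thesis
    by (simp add: c_factor_def)
qed

lemma d_factor_compose:
  assumes \<gamma>: "\<And>i. i \<in> I \<Longrightarrow> \<gamma> i \<le> m i" and \<kappa>: "\<And>i. i \<in> I \<Longrightarrow> \<kappa> i \<le> \<gamma> i"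
    and d: "s - d0 = \<nu> - d"
  shows "d_factor \<gamma> \<nu> x d \<kappa> * (\<Prod>i\<in>I. ph (\<delta> + s - d0 + x i + of_nat (\<gamma> i) * \<delta>) (m i - \<gamma> i)) = d_factor m \<nu> x d \<kappa>"
proof -
  have eq: "\<delta> + s - d0 = \<delta> + \<nu> - d"
    using d by (metis add_diff_eq)
  have "(\<Prod>i\<in>I. ph (\<delta> + \<nu> - d + x i + of_nat (\<kappa> i) * \<delta>) (\<gamma> i - \<kappa> i)) * (\<Prod>i\<in>I. ph (\<delta> + s - d0 + x i + of_nat (\<gamma> i) * \<delta>) (m i - \<gamma> i))
      = (\<Prod>i\<in>I. ph (\<delta> + \<nu> - d + x i + of_nat (\<kappa> i) * \<delta>) (m i - \<kappa> i))"
    unfolding prod.distrib[symmetric] eq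
  proof (rule prod.cong[OF refl])
    fix i assume i: "i \<in> I"
    show "ph (\<delta> + \<nu> - d + x i + of_nat (\<kappa> i) * \<delta>) (\<gamma> i - \<kappa> i) * ph (\<delta> + \<nu> - d + x i + of_nat (\<gamma> i) * \<delta>) (m i - \<gamma> i)
        = ph (\<delta> + \<nu> - d + x i + of_nat (\<kappa> i) * \<delta>) (m i - \<kappa> i)"
      using \<gamma>[OF i] \<kappa>[OF i] by (intro ph_split[symmetric]) (simp_all add: of_nat_diff algebra_simps)
  qed
  then show ?thesis
    by (simp add: d_factor_def)
qed

lemma c_factor_shift:
  assumes \<gamma>: "\<And>i. i \<in> I \<Longrightarrow> \<gamma> i = \<kappa> i + \<mu> i" "\<And>i. i \<in> I \<Longrightarrow> \<gamma> i \<le> m i"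
  shows "c_factor m s x c \<gamma> = (\<Prod>i\<in>I. ph (c + x i) (\<kappa> i))
    * c_factor (\<lambda>i. m i - \<kappa> i) (s + of_nat (sz \<kappa>) * \<delta>) (\<lambda>i. x i + of_nat (\<kappa> i) * \<delta>) c \<mu>"
proof -
  have size: "sz \<gamma> = sz \<kappa> + sz \<mu>"
    unfolding size_eq sum.distrib[symmetric] by (intro sum.cong) (auto simp: \<gamma>)
  have "\<kappa> i \<le> m i" if "i \<in> I" for i
    using \<gamma>[OF that] by simp
  then have size': "(sz (\<lambda>i. m i - \<kappa> i)) = sz m - sz \<kappa>"
    by (simp add: size_eq sum_subtractf_nat)
  have e1: "(\<Prod>i\<in>I. ph (c + x i) (\<gamma> i)) = (\<Prod>i\<in>I. ph (c + x i) (\<kappa> i)) * (\<Prod>i\<in>I. ph (c + (x i + of_nat (\<kappa> i) * \<delta>)) (\<mu> i))"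
    unfolding prod.distrib[symmetric] by (intro prod.cong refl ph_split) (auto simp: \<gamma>)
  have e2: "\<delta> + (s + of_nat (sz \<kappa>) * \<delta>) - c + of_nat (sz \<mu>) * \<delta> = \<delta> + s - c + of_nat (sz \<gamma>) * \<delta>"
    by (simp add: size algebra_simps)
  have e3: "sz m - sz \<kappa> - sz \<mu> = sz m - sz \<gamma>"
    by (simp add: size)
  show ?thesis
    unfolding c_factor_def size' e1 e2 e3 by (simp only: mult_ac)
qed

lemma d_factor_shift:
  assumes \<gamma>: "\<And>i. i \<in> I \<Longrightarrow> \<gamma> i = \<kappa> i + \<mu> i" "\<And>i. i \<in> I \<Longrightarrow> \<gamma> i \<le> m i"
  shows "d_factor m s x d \<gamma> = ph d (sz \<kappa>)
    * d_factor (\<lambda>i. m i - \<kappa> i) (s + of_nat (sz \<kappa>) * \<delta>) (\<lambda>i. x i + of_nat (\<kappa> i) * \<delta>) (d + of_nat (sz \<kappa>) * \<delta>) \<mu>"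
proof -
  have size: "sz \<gamma> = sz \<kappa> + sz \<mu>"
    unfolding size_eq sum.distrib[symmetric] by (intro sum.cong) (auto simp: \<gamma>)
  have "ph d (sz \<gamma>) = ph d (sz \<kappa>) * ph (d + of_nat (sz \<kappa>) * \<delta>) (sz \<mu>)"
    by (rule ph_split[OF size]) simp
  moreover have "(\<Prod>i\<in>I. ph (\<delta> + s - d + x i + of_nat (\<gamma> i) * \<delta>) (m i - \<gamma> i))
      = (\<Prod>i\<in>I. ph (\<delta> + (s + of_nat (sz \<kappa>) * \<delta>) - (d + of_nat (sz \<kappa>) * \<delta>) + (x i + of_nat (\<kappa> i) * \<delta>) + of_nat (\<mu> i) * \<delta>)
          (m i - \<kappa> i - \<mu> i))"
  proof (rule prod.cong[OF refl])
    fix i assume i: "i \<in> I"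
    have "\<delta> + (s + of_nat (sz \<kappa>) * \<delta>) - (d + of_nat (sz \<kappa>) * \<delta>) + (x i + of_nat (\<kappa> i) * \<delta>) + of_nat (\<mu> i) * \<delta>
        = \<delta> + s - d + x i + of_nat (\<gamma> i) * \<delta>"
      by (simp add: \<gamma>(1)[OF i] algebra_simps)
    moreover have "m i - \<kappa> i - \<mu> i = m i - \<gamma> i"
      by (simp add: \<gamma>(1)[OF i])
    ultimately show "ph (\<delta> + s - d + x i + of_nat (\<gamma> i) * \<delta>) (m i - \<gamma> i)
      = ph (\<delta> + (s + of_nat (sz \<kappa>) * \<delta>) - (d + of_nat (sz \<kappa>) * \<delta>) + (x i + of_nat (\<kappa> i) * \<delta>) + of_nat (\<mu> i) * \<delta>)
          (m i - \<kappa> i - \<mu> i)"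
      by (simp only:)
  qed
  ultimately show ?thesis
    by (simp add: d_factor_def mult.assoc)
qed

lemma sum_below_compose:
  fixes f :: "(nat \<Rightarrow> nat) \<Rightarrow> (nat \<Rightarrow> nat) \<Rightarrow> complex"
  shows "(\<Sum>\<gamma>\<in>below m. \<Sum>\<kappa>\<in>below \<gamma>. f \<gamma> \<kappa>)
    = (\<Sum>\<kappa>\<in>below m. \<Sum>\<mu>\<in>below (\<lambda>i. m i - \<kappa> i). f (\<lambda>i\<in>I. \<kappa> i + \<mu> i) \<kappa>)"
proof -
  have "(\<Sum>\<gamma>\<in>below m. \<Sum>\<kappa>\<in>below \<gamma>. f \<gamma> \<kappa>) = (\<Sum>(\<gamma>, \<kappa>)\<in>(SIGMA \<gamma>:below m. below \<gamma>). f \<gamma> \<kappa>)"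
    by (intro sum.Sigma finite_below ballI)
  also have "\<dots> = (\<Sum>(\<kappa>, \<mu>)\<in>(SIGMA \<kappa>:below m. below (\<lambda>i. m i - \<kappa> i)). f (\<lambda>i\<in>I. \<kappa> i + \<mu> i) \<kappa>)"
  proof (rule sum.reindex_bij_witness[where i = "\<lambda>(\<kappa>, \<mu>). (\<lambda>i\<in>I. \<kappa> i + \<mu> i, \<kappa>)" and j = "\<lambda>(\<gamma>, \<kappa>). (\<kappa>, \<lambda>i\<in>I. \<gamma> i - \<kappa> i)"])
    fix p assume "p \<in> (SIGMA \<gamma>:below m. below \<gamma>)"
    then obtain \<gamma> \<kappa> where p: "p = (\<gamma>, \<kappa>)" "\<gamma> \<in> below m" "\<kappa> \<in> below \<gamma>"
      by auto
    have restore: "(\<lambda>i\<in>I. \<kappa> i + (\<lambda>i\<in>I. \<gamma> i - \<kappa> i) i) = \<gamma>"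
    proof (rule ext)
      fix i
      show "(\<lambda>i\<in>I. \<kappa> i + (\<lambda>i\<in>I. \<gamma> i - \<kappa> i) i) i = \<gamma> i"
        using below_le[OF p(3), of i] PiE_arb[OF p(2), of i] by auto
    qed
    show "(case case p of (\<gamma>, \<kappa>) \<Rightarrow> (\<kappa>, \<lambda>i\<in>I. \<gamma> i - \<kappa> i) of (\<kappa>, \<mu>) \<Rightarrow> (\<lambda>i\<in>I. \<kappa> i + \<mu> i, \<kappa>)) = p"
      using restore by (simp add: p(1))
    show "(case p of (\<gamma>, \<kappa>) \<Rightarrow> (\<kappa>, \<lambda>i\<in>I. \<gamma> i - \<kappa> i)) \<in> (SIGMA \<kappa>:below m. below (\<lambda>i. m i - \<kappa> i))"
      using p(2,3) by (force simp: p(1) PiE_iff)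
    show "(case case p of (\<gamma>, \<kappa>) \<Rightarrow> (\<kappa>, \<lambda>i\<in>I. \<gamma> i - \<kappa> i) of (\<kappa>, \<mu>) \<Rightarrow> f (\<lambda>i\<in>I. \<kappa> i + \<mu> i) \<kappa>) = (case p of (\<gamma>, \<kappa>) \<Rightarrow> f \<gamma> \<kappa>)"
      using restore by (simp add: p(1))
  next
    fix p assume "p \<in> (SIGMA \<kappa>:below m. below (\<lambda>i. m i - \<kappa> i))"
    then obtain \<kappa> \<mu> where p: "p = (\<kappa>, \<mu>)" "\<kappa> \<in> below m" "\<mu> \<in> below (\<lambda>i. m i - \<kappa> i)"
      by auto
    have "(\<lambda>i\<in>I. (\<lambda>i\<in>I. \<kappa> i + \<mu> i) i - \<kappa> i) = \<mu>"
    proof (rule ext)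
      fix i
      show "(\<lambda>i\<in>I. (\<lambda>i\<in>I. \<kappa> i + \<mu> i) i - \<kappa> i) i = \<mu> i"
        using PiE_arb[OF p(3), of i] by auto
    qed
    then show "(case case p of (\<kappa>, \<mu>) \<Rightarrow> (\<lambda>i\<in>I. \<kappa> i + \<mu> i, \<kappa>) of (\<gamma>, \<kappa>) \<Rightarrow> (\<kappa>, \<lambda>i\<in>I. \<gamma> i - \<kappa> i)) = p"
      by (simp add: p(1))
    have "\<kappa> i + \<mu> i \<le> m i" if "i \<in> I" for i
      using below_le[OF p(2) that] below_le[OF p(3) that] by linarith
    then show "(case p of (\<kappa>, \<mu>) \<Rightarrow> (\<lambda>i\<in>I. \<kappa> i + \<mu> i, \<kappa>)) \<in> (SIGMA \<gamma>:below m. below \<gamma>)"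
      using p(2) by (auto simp: p(1) PiE_iff)
  qed
  also have "\<dots> = (\<Sum>\<kappa>\<in>below m. \<Sum>\<mu>\<in>below (\<lambda>i. m i - \<kappa> i). f (\<lambda>i\<in>I. \<kappa> i + \<mu> i) \<kappa>)"
    by (intro sum.Sigma[symmetric] finite_below ballI)
  finally show ?thesis .
qed

lemma regular_shift:
  assumes reg: "regular m s x" and \<kappa>: "\<And>i. i \<in> I \<Longrightarrow> \<kappa> i \<le> m i"
  shows "regular (\<lambda>i. m i - \<kappa> i) (s + of_nat (sz \<kappa>) * \<delta>) (\<lambda>i. x i + of_nat (\<kappa> i) * \<delta>)"
  unfolding regular_def
proof (intro conjI ballI allI impI)
  fix i j k assume ij: "i \<in> I" "j \<in> I" "i \<noteq> j" and k: "- int (m j - \<kappa> j) \<le> k" "k \<le> int (m i - \<kappa> i)"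
  have eq: "x i + of_nat (\<kappa> i) * \<delta> - (x j + of_nat (\<kappa> j) * \<delta>) + of_int k * \<delta>
      = x i - x j + of_int (int (\<kappa> i) - int (\<kappa> j) + k) * \<delta>"
    by (simp add: algebra_simps)
  show "br (x i + of_nat (\<kappa> i) * \<delta> - (x j + of_nat (\<kappa> j) * \<delta>) + of_int k * \<delta>) \<noteq> 0"
    unfolding eq using k \<kappa>[OF ij(1)] \<kappa>[OF ij(2)] by (intro regular_differenceD[OF reg ij]) auto
next
  fix i k assume i: "i \<in> I" and k: "k \<le> (sz (\<lambda>i. m i - \<kappa> i)) + (m i - \<kappa> i)"
  have "(sz (\<lambda>i. m i - \<kappa> i)) + sz \<kappa> = sz m"
    unfolding size_eq sum.distrib[symmetric] by (intro sum.cong) (auto simp: \<kappa>)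
  then have "sz \<kappa> + \<kappa> i + k \<le> sz m + m i"
    using k \<kappa>[OF i] by linarith
  moreover have eq: "s + of_nat (sz \<kappa>) * \<delta> + (x i + of_nat (\<kappa> i) * \<delta>) + of_nat k * \<delta> = s + x i + of_nat (sz \<kappa> + \<kappa> i + k) * \<delta>"
    by (simp add: algebra_simps)
  ultimately show "br (s + of_nat (sz \<kappa>) * \<delta> + (x i + of_nat (\<kappa> i) * \<delta>) + of_nat k * \<delta>) \<noteq> 0"
    unfolding eq by (intro regular_sumD[OF reg i])
qed

definition bailey_term where
  "bailey_term m s x c0 c1 c2 d0 d1 d2 \<gamma> = (- 1) ^ sz \<gamma> * weight m x \<gamma> * poised m s x \<gamma>
     * (c_factor m s x c0 \<gamma> * c_factor m s x c1 \<gamma> * c_factor m s x c2 \<gamma>)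
     * (d_factor m s x d0 \<gamma> * d_factor m s x d1 \<gamma> * d_factor m s x d2 \<gamma>)"

definition bailey_sum where
  "bailey_sum m s x c0 c1 c2 d0 d1 d2 = (\<Sum>\<gamma>\<in>below m. bailey_term m s x c0 c1 c2 d0 d1 d2 \<gamma>)"

text \<open>
  For fixed \<open>\<gamma>\<close> the Jackson sum \<open>\<Sum>\<kappa>. J \<gamma> \<kappa>\<close>, with \<open>s + N * \<delta>\<close> and \<open>N = sz \<gamma>\<close> for one of its \<open>c\<close>,
  evaluates up to sign to the factors \<open>ph d1 N * ph d2 N * (\<Prod>i\<in>I. ph (c0 + x i) (\<gamma> i))\<close> of the summand.
  The other factors of \<open>c0\<close>, \<open>d1\<close> and \<open>d2\<close> combine with factors of \<open>J \<gamma> \<kappa>\<close>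
  (\<open>c_factor_compose\<close>, \<open>d_factor_compose\<close>). With \<open>\<gamma> = \<kappa> + \<mu>\<close> the sum over \<open>\<mu>\<close> is a Jackson sum with
  the parameters \<open>c1\<close>, \<open>c2\<close>, \<open>s - \<nu>\<close> and \<open>d0 + K * \<delta>\<close>, where \<open>K = sz \<kappa>\<close>.
  Its balancing condition is the given one.
\<close>
theorem bailey_transformation:
  assumes reg: "regular m s x" "regular m \<nu> x"
    and \<nu>: "\<nu> = 2 * s + \<delta> - c0 - d1 - d2"
    and bal: "c0 + c1 + c2 + d0 + d1 + d2 = (2 + of_nat (sz m)) * \<delta> + 3 * s"
  shows "bailey_sum m s x c0 c1 c2 d0 d1 d2
    = bailey_sum m \<nu> x (s + \<delta> - d1 - d2) c1 c2 d0 (s + \<delta> - c0 - d2) (s + \<delta> - c0 - d1)"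
proof -
  define c0' d1' d2' where "c0' = s + \<delta> - d1 - d2" and "d1' = s + \<delta> - c0 - d2" and "d2' = s + \<delta> - c0 - d1"
  note prime_defs = c0'_def d1'_def d2'_def
  define G where "G c \<gamma> = ph (\<delta> + s - c + of_nat (sz \<gamma>) * \<delta>) (sz m - sz \<gamma>)" for c \<gamma>
  define H where "H d \<gamma> = (\<Prod>i\<in>I. ph (\<delta> + s - d + x i + of_nat (\<gamma> i) * \<delta>) (m i - \<gamma> i))" for d \<gamma>
  define R where "R \<gamma> = (- 1) ^ sz \<gamma> * weight m x \<gamma> * poised m s x \<gamma> * (G c0 \<gamma> * c_factor m s x c1 \<gamma> * c_factor m s x c2 \<gamma>)
    * (d_factor m s x d0 \<gamma> * H d1 \<gamma> * H d2 \<gamma>)" for \<gamma>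
  define J where "J \<gamma> = jackson_term \<gamma> \<nu> x c0' (s + of_nat (sz \<gamma>) * \<delta>) d1' d2'" for \<gamma>
  have expand: "bailey_term m s x c0 c1 c2 d0 d1 d2 \<gamma> = (\<Sum>\<kappa>\<in>below \<gamma>. R \<gamma> * ((- 1) ^ sz \<gamma> * J \<gamma> \<kappa>))"
    if \<gamma>: "\<gamma> \<in> below m" for \<gamma>
  proof -
    define N where "N = sz \<gamma>"
    have "regular \<gamma> \<nu> x"
      using below_le[OF \<gamma>] by (rule regular_mono[OF reg(2)])
    then have "(\<Sum>\<kappa>\<in>below \<gamma>. J \<gamma> \<kappa>) = jackson_value \<gamma> \<nu> x c0' (s + of_nat N * \<delta>) d1' d2'"
      unfolding J_def N_def by (rule jackson) (simp add: prime_defs \<nu> algebra_simps)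
    also have "\<dots> = ph d2 N * ((- 1) ^ N * ph d1 N) * (\<Prod>i\<in>I. ph (c0 + x i) (\<gamma> i))"
    proof -
      have "\<delta> + \<nu> - c0' - d1' = d2" "\<delta> + \<nu> - d1' - d2' = c0"
        by (simp_all add: prime_defs \<nu>)
      moreover have "ph (\<delta> + \<nu> - (s + of_nat N * \<delta>) - d1') N = (- 1) ^ N * ph d1 N"
        by (rule ph_reflect) (simp add: prime_defs \<nu>)
      ultimately show ?thesis
        by (simp add: jackson_value_def N_def)
    qed
    finally have J: "(\<Sum>\<kappa>\<in>below \<gamma>. J \<gamma> \<kappa>) = (- 1) ^ N * (ph d1 N * ph d2 N * (\<Prod>i\<in>I. ph (c0 + x i) (\<gamma> i)))"
      by (simp add: mult_ac)
    have "(- 1) ^ N * ((- 1) ^ N * z) = z" for z :: complex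
      by (simp flip: mult.assoc power_mult_distrib)
    then have "R \<gamma> * ((- 1) ^ N * (\<Sum>\<kappa>\<in>below \<gamma>. J \<gamma> \<kappa>)) = R \<gamma> * (ph d1 N * ph d2 N * (\<Prod>i\<in>I. ph (c0 + x i) (\<gamma> i)))"
      unfolding J by simp
    also have "\<dots> = bailey_term m s x c0 c1 c2 d0 d1 d2 \<gamma>"
      unfolding bailey_term_def R_def G_def H_def c_factor_def[of m s x c0] d_factor_def[of m s x d1]
        d_factor_def[of m s x d2] N_def by (simp only: mult_ac)
    finally show ?thesis
      by (simp add: N_def sum_distrib_left)
  qed
  have "bailey_sum m s x c0 c1 c2 d0 d1 d2 = (\<Sum>\<gamma>\<in>below m. \<Sum>\<kappa>\<in>below \<gamma>. R \<gamma> * ((- 1) ^ sz \<gamma> * J \<gamma> \<kappa>))"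
    unfolding bailey_sum_def by (intro sum.cong refl expand)
  also have "\<dots> = (\<Sum>\<kappa>\<in>below m. \<Sum>\<mu>\<in>below (\<lambda>i. m i - \<kappa> i).
      R (\<lambda>i\<in>I. \<kappa> i + \<mu> i) * ((- 1) ^ (sz (\<lambda>i\<in>I. \<kappa> i + \<mu> i)) * J (\<lambda>i\<in>I. \<kappa> i + \<mu> i) \<kappa>))"
    by (rule sum_below_compose)
  also have "\<dots> = (\<Sum>\<kappa>\<in>below m. bailey_term m \<nu> x c0' c1 c2 d0 d1' d2' \<kappa>)"
  proof (rule sum.cong[OF refl])
    fix \<kappa> assume \<kappa>: "\<kappa> \<in> below m"
    define K where "K = sz \<kappa>"
    define m' where "m' = (\<lambda>i. m i - \<kappa> i)"
    define s' where "s' = s + of_nat K * \<delta>"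
    define x' where "x' = (\<lambda>i. x i + of_nat (\<kappa> i) * \<delta>)"
    define A where "A = (- 1) ^ K * weight m x \<kappa> * poised m \<nu> x \<kappa>
      * (c_factor m \<nu> x c0' \<kappa> * (\<Prod>i\<in>I. ph (c1 + x i) (\<kappa> i)) * (\<Prod>i\<in>I. ph (c2 + x i) (\<kappa> i)))
      * (ph d0 K * d_factor m \<nu> x d1' \<kappa> * d_factor m \<nu> x d2' \<kappa>)"
    have \<kappa>m: "\<kappa> i \<le> m i" if "i \<in> I" for i
      using \<kappa> that by (rule below_le)
    have size': "sz m' + K = sz m"
      unfolding size_eq K_def m'_def sum.distrib[symmetric] by (intro sum.cong) (auto simp: \<kappa>m)
    have "R (\<lambda>i\<in>I. \<kappa> i + \<mu> i) * ((- 1) ^ (sz (\<lambda>i\<in>I. \<kappa> i + \<mu> i)) * J (\<lambda>i\<in>I. \<kappa> i + \<mu> i) \<kappa>)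
        = A * jackson_term m' s' x' c1 c2 (s - \<nu>) (d0 + of_nat K * \<delta>) \<mu>" if \<mu>: "\<mu> \<in> below m'" for \<mu>
    proof -
      define \<gamma> where "\<gamma> = (\<lambda>i\<in>I. \<kappa> i + \<mu> i)"
      define N where "N = sz \<gamma>"
      define U where "U = sz \<mu>"
      have \<gamma>: "\<gamma> i = \<kappa> i + \<mu> i" "\<gamma> i \<le> m i" "\<kappa> i \<le> \<gamma> i" if "i \<in> I" for i
        using below_le[OF \<mu> that] \<kappa>m[OF that] that by (auto simp: \<gamma>_def m'_def)
      have NKU: "N = K + U"
        unfolding N_def K_def U_def size_eq sum.distrib[symmetric] by (intro sum.cong) (auto simp: \<gamma>)
      define a a' where "a = (\<Prod>i\<in>I. ph (s + of_nat N * \<delta> + x i) (\<kappa> i))"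
        and "a' = (\<Prod>i\<in>I. ph (\<delta> + s' - (s - \<nu>) + x' i + of_nat (\<mu> i) * \<delta>) (m' i - \<mu> i))"
      define e f g :: complex where "e = (- 1) ^ N" and "f = (- 1) ^ K" and "g = (- 1) ^ U"
      have sq: "e * e = 1" "g * g = 1"
        by (simp_all add: e_def g_def flip: power_mult_distrib)
      have W: "weight m x \<gamma> * weight \<gamma> x \<kappa> = weight m x \<kappa> * weight m' x' \<mu>"
        unfolding m'_def x'_def by (rule weight_compose[OF reg(1)]) (erule \<gamma>)+
      have P: "poised m s x \<gamma> * poised \<gamma> \<nu> x \<kappa> * a = poised m \<nu> x \<kappa> * (poised m' s' x' \<mu> * a')"
        unfolding m'_def x'_def s'_def a_def a'_def
        by (rule poised_compose[OF reg]) (erule \<gamma> | rule N_def K_def)+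
      have C0: "c_factor \<gamma> \<nu> x c0' \<kappa> * G c0 \<gamma> = c_factor m \<nu> x c0' \<kappa>"
        unfolding G_def by (rule c_factor_compose) (erule \<gamma> | simp add: prime_defs \<nu>)+
      have D1: "d_factor \<gamma> \<nu> x d1' \<kappa> * H d1 \<gamma> = d_factor m \<nu> x d1' \<kappa>"
        and D2: "d_factor \<gamma> \<nu> x d2' \<kappa> * H d2 \<gamma> = d_factor m \<nu> x d2' \<kappa>"
        unfolding H_def by (rule d_factor_compose; (erule \<gamma> | simp add: prime_defs \<nu>))+
      have C: "c_factor m s x c \<gamma> = (\<Prod>i\<in>I. ph (c + x i) (\<kappa> i)) * c_factor m' s' x' c \<mu>" for c
        unfolding m'_def s'_def x'_def K_def by (rule c_factor_shift) (erule \<gamma>)+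
      have D0: "d_factor m s x d0 \<gamma> = ph d0 K * d_factor m' s' x' (d0 + of_nat K * \<delta>) \<mu>"
        unfolding m'_def s'_def x'_def K_def by (rule d_factor_shift) (erule \<gamma>)+
      have CN: "c_factor \<gamma> \<nu> x (s + of_nat N * \<delta>) \<kappa> = g * ph (s - \<nu>) U * a"
      proof -
        have "ph (\<delta> + \<nu> - (s + of_nat N * \<delta>) + of_nat K * \<delta>) U = (- 1) ^ U * ph (s - \<nu>) U"
          by (rule ph_reflect) (simp add: NKU algebra_simps)
        moreover have "N - K = U"
          by (simp add: NKU)
        ultimately show ?thesis
          by (simp add: c_factor_def a_def g_def N_def K_def)
      qed
      have DN: "d_factor m' s' x' (s - \<nu>) \<mu> = ph (s - \<nu>) U * a'"
        by (simp add: d_factor_def a'_def U_def)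
      have "R \<gamma> * (e * J \<gamma> \<kappa>) = (e * e) * f * g * (weight m x \<gamma> * weight \<gamma> x \<kappa>) * (poised m s x \<gamma> * poised \<gamma> \<nu> x \<kappa> * a)
          * (c_factor \<gamma> \<nu> x c0' \<kappa> * G c0 \<gamma>) * (d_factor \<gamma> \<nu> x d1' \<kappa> * H d1 \<gamma>) * (d_factor \<gamma> \<nu> x d2' \<kappa> * H d2 \<gamma>)
          * (c_factor m s x c1 \<gamma> * c_factor m s x c2 \<gamma> * d_factor m s x d0 \<gamma>) * ph (s - \<nu>) U"
        unfolding R_def J_def jackson_term_def N_def[symmetric] K_def[symmetric] e_def[symmetric] f_def[symmetric] CN
        by (simp only: mult_ac)
      also have "\<dots> = A * jackson_term m' s' x' c1 c2 (s - \<nu>) (d0 + of_nat K * \<delta>) \<mu>"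
        unfolding W P C0 D1 D2 C D0 A_def jackson_term_def DN U_def[symmetric] f_def[symmetric] g_def[symmetric] sq
        by (simp only: mult_ac mult_1_left)
      finally show ?thesis
        unfolding \<gamma>_def[symmetric] N_def[symmetric] e_def .
    qed
    then have "(\<Sum>\<mu>\<in>below m'. R (\<lambda>i\<in>I. \<kappa> i + \<mu> i) * ((- 1) ^ (sz (\<lambda>i\<in>I. \<kappa> i + \<mu> i)) * J (\<lambda>i\<in>I. \<kappa> i + \<mu> i) \<kappa>))
        = A * (\<Sum>\<mu>\<in>below m'. jackson_term m' s' x' c1 c2 (s - \<nu>) (d0 + of_nat K * \<delta>) \<mu>)"
      by (simp add: sum_distrib_left)
    also have "(\<Sum>\<mu>\<in>below m'. jackson_term m' s' x' c1 c2 (s - \<nu>) (d0 + of_nat K * \<delta>) \<mu>)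
        = jackson_value m' s' x' c1 c2 (s - \<nu>) (d0 + of_nat K * \<delta>)"
    proof (rule jackson)
      show "regular m' s' x'"
        unfolding m'_def s'_def x'_def K_def by (rule regular_shift[OF reg(1) \<kappa>m])
      have "(of_nat (sz m) :: complex) = of_nat (sz m') + of_nat K"
        unfolding size'[symmetric] by simp
      then show "c1 + c2 + (s - \<nu>) + (d0 + of_nat K * \<delta>) = (1 + of_nat (sz m')) * \<delta> + 2 * s'"
        using bal unfolding s'_def \<nu> by algebra
    qed
    also have "A * \<dots> = bailey_term m \<nu> x c0' c1 c2 d0 d1' d2' \<kappa>"
    proof -
      have e1: "sz m' = sz m - K"
        using size' by simp
      have e2: "\<delta> + s' - c - (s - \<nu>) = \<delta> + \<nu> - c + of_nat K * \<delta>" for c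
        by (simp add: s'_def)
      have e3: "\<delta> + s' - (s - \<nu>) - (d0 + of_nat K * \<delta>) + x' i = \<delta> + \<nu> - d0 + x i + of_nat (\<kappa> i) * \<delta>" for i
        by (simp add: s'_def x'_def)
      have v: "jackson_value m' s' x' c1 c2 (s - \<nu>) (d0 + of_nat K * \<delta>)
          = ph (\<delta> + \<nu> - c1 + of_nat K * \<delta>) (sz m - K) * ph (\<delta> + \<nu> - c2 + of_nat K * \<delta>) (sz m - K)
            * (\<Prod>i\<in>I. ph (\<delta> + \<nu> - d0 + x i + of_nat (\<kappa> i) * \<delta>) (m i - \<kappa> i))"
        unfolding jackson_value_def e1 e2 e3 unfolding m'_def by (rule refl)
      show ?thesis
        unfolding v A_def bailey_term_def c_factor_def[of m \<nu> x c1] c_factor_def[of m \<nu> x c2] d_factor_def[of m \<nu> x d0]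
          K_def[symmetric] by (simp only: mult_ac)
    qed
    finally show "(\<Sum>\<mu>\<in>below (\<lambda>i. m i - \<kappa> i). R (\<lambda>i\<in>I. \<kappa> i + \<mu> i) * ((- 1) ^ (sz (\<lambda>i\<in>I. \<kappa> i + \<mu> i)) * J (\<lambda>i\<in>I. \<kappa> i + \<mu> i) \<kappa>))
        = bailey_term m \<nu> x c0' c1 c2 d0 d1' d2' \<kappa>"
      unfolding m'_def .
  qed
  finally show ?thesis
    unfolding bailey_sum_def prime_defs .
qed

section \<open>Reversing the order of summation\<close>

definition reflected :: "(nat \<Rightarrow> nat) \<Rightarrow> (nat \<Rightarrow> complex) \<Rightarrow> nat \<Rightarrow> complex" where
  "reflected m x i = - of_nat (m i) * \<delta> - x i + of_nat (sz m) * \<delta>"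

lemma reflected_reflected [simp]: "reflected m (reflected m x) = x"
  by (simp add: reflected_def fun_eq_iff)

lemma regular_reflected:
  assumes reg: "regular m s x"
  shows "regular m (- s - 2 * of_nat (sz m) * \<delta>) (reflected m x)"
  unfolding regular_def
proof (intro conjI ballI allI impI)
  fix i j k assume ij: "i \<in> I" "j \<in> I" "i \<noteq> j" and k: "- int (m j) \<le> k" "k \<le> int (m i)"
  have eq: "reflected m x i - reflected m x j + of_int k * \<delta> = x j - x i + of_int (k - int (m i) + int (m j)) * \<delta>"
    by (simp add: reflected_def algebra_simps)
  show "br (reflected m x i - reflected m x j + of_int k * \<delta>) \<noteq> 0"
    unfolding eq using ij k by (intro regular_differenceD[OF reg]) auto
next
  fix i k assume i: "i \<in> I" and k: "k \<le> sz m + m i"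
  have eq: "- s - 2 * of_nat (sz m) * \<delta> + reflected m x i + of_nat k * \<delta>
      = - (s + x i + of_nat (sz m + m i - k) * \<delta>)"
    using k by (simp add: reflected_def of_nat_diff algebra_simps)
  have "br (s + x i + of_nat (sz m + m i - k) * \<delta>) \<noteq> 0"
    by (rule regular_sumD[OF reg i]) simp
  then show "br (- s - 2 * of_nat (sz m) * \<delta> + reflected m x i + of_nat k * \<delta>) \<noteq> 0"
    unfolding eq odd by simp
qed

text \<open>
  Reversal transposes the matrix of factors: both orders of splitting a shifted factorial of length
  \<open>(m i - \<gamma> i) + \<gamma> j\<close> identify the entry \<open>(i, j)\<close> on the left with the entry \<open>(j, i)\<close> on the
  right.
\<close>
lemma weight_reflected:
  assumes reg: "regular m s x" and \<gamma>: "\<And>i. i \<in> I \<Longrightarrow> \<gamma> i \<le> m i" "\<And>i. i \<in> I \<Longrightarrow> \<rho> i = m i - \<gamma> i"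
  shows "weight m (reflected m x) \<rho> = weight m x \<gamma>"
proof -
  have "weight m (reflected m x) \<rho> = (\<Prod>i\<in>I. \<Prod>j\<in>I. ph (- of_nat (m i) * \<delta> + x j - x i) (\<gamma> j)
      / ph (- of_nat (\<gamma> i) * \<delta> + x j - x i) (\<gamma> j))"
    unfolding weight_def
  proof (intro prod.cong refl)
    fix i j assume i: "i \<in> I" and j: "j \<in> I"
    define y where "y = - of_nat (m i) * \<delta> + x j - x i"
    define a b where "a = \<rho> i" and "b = \<gamma> j"
    have ma: "m i = \<gamma> i + a" and mb: "m j = \<rho> j + b"
      using \<gamma>[OF i] \<gamma>[OF j] by (simp_all add: a_def b_def)
    have args: "- of_nat (m j) * \<delta> + reflected m x i - reflected m x j = y"
      "- of_nat (\<rho> j) * \<delta> + reflected m x i - reflected m x j = y + of_nat b * \<delta>"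
      "- of_nat (\<gamma> i) * \<delta> + x j - x i = y + of_nat a * \<delta>"
      by (simp_all add: y_def reflected_def ma mb algebra_simps)
    have "ph y (a + b) = ph y a * ph (y + of_nat a * \<delta>) b" "ph y (a + b) = ph y b * ph (y + of_nat b * \<delta>) a"
      by (rule ph_split; simp)+
    moreover have "ph (y + of_nat b * \<delta>) a \<noteq> 0"
      unfolding args(2)[symmetric] a_def
      using i j \<gamma> by (intro weight_denominator_nonzero[OF regular_reflected[OF reg]]) auto
    moreover have "ph (y + of_nat a * \<delta>) b \<noteq> 0"
      unfolding args(3)[symmetric] b_def
      using i j \<gamma> by (intro weight_denominator_nonzero[OF reg]) auto
    ultimately have "ph y a / ph (y + of_nat b * \<delta>) a = ph y b / ph (y + of_nat a * \<delta>) b"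
      by (simp add: frac_eq_eq)
    then show "ph (- of_nat (m j) * \<delta> + reflected m x i - reflected m x j) (\<rho> i)
        / ph (- of_nat (\<rho> j) * \<delta> + reflected m x i - reflected m x j) (\<rho> i)
      = ph (- of_nat (m i) * \<delta> + x j - x i) (\<gamma> j) / ph (- of_nat (\<gamma> i) * \<delta> + x j - x i) (\<gamma> j)"
      unfolding args y_def[symmetric] a_def[symmetric] b_def[symmetric] .
  qed
  also have "\<dots> = weight m x \<gamma>"
    unfolding weight_def by (rule prod.swap)
  finally show ?thesis .
qed

lemma poised_reflected:
  assumes \<gamma>: "\<And>i. i \<in> I \<Longrightarrow> \<gamma> i \<le> m i" "\<And>i. i \<in> I \<Longrightarrow> \<rho> i = m i - \<gamma> i"
    and size: "sz \<rho> + sz \<gamma> = sz m"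
  shows "poised m (- s - 2 * of_nat (sz m) * \<delta>) (reflected m x) \<rho> = (- 1) ^ sz m * poised m s x \<gamma>"
proof -
  define s' where "s' = - s - 2 * of_nat (sz m) * \<delta>"
  have M: "of_nat (sz m) = (of_nat (sz \<rho>) + of_nat (sz \<gamma>) :: complex)"
    unfolding size[symmetric] by simp
  have "poised m s' (reflected m x) \<rho> = (\<Prod>i\<in>I. (- 1) ^ m i * (br (of_nat (sz \<gamma> + \<gamma> i) * \<delta> + s + x i)
      / ph (s + x i + of_nat (sz \<gamma>) * \<delta>) (Suc (m i))))"
    unfolding poised_def
  proof (rule prod.cong[OF refl])
    fix i assume i: "i \<in> I"
    have mi: "m i = \<gamma> i + \<rho> i"
      using \<gamma>[OF i] by simp
    have "of_nat (sz \<rho> + \<rho> i) * \<delta> + s' + reflected m x i = - (of_nat (sz \<gamma> + \<gamma> i) * \<delta> + s + x i)"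
      by (simp add: s'_def reflected_def mi M algebra_simps)
    then have num: "br (of_nat (sz \<rho> + \<rho> i) * \<delta> + s' + reflected m x i) = - br (of_nat (sz \<gamma> + \<gamma> i) * \<delta> + s + x i)"
      by (simp only: odd)
    have den: "ph (s' + reflected m x i + of_nat (sz \<rho>) * \<delta>) (Suc (m i))
        = (- 1) ^ Suc (m i) * ph (s + x i + of_nat (sz \<gamma>) * \<delta>) (Suc (m i))"
      by (rule ph_reflect) (simp add: s'_def reflected_def M algebra_simps)
    have sign: "- a / ((- 1) ^ Suc k * b) = (- 1) ^ k * (a / b)" for a b :: complex and k
      by (cases "even k") simp_all
    show "br (of_nat (sz \<rho> + \<rho> i) * \<delta> + s' + reflected m x i) / ph (s' + reflected m x i + of_nat (sz \<rho>) * \<delta>) (Suc (m i))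
      = (- 1) ^ m i * (br (of_nat (sz \<gamma> + \<gamma> i) * \<delta> + s + x i) / ph (s + x i + of_nat (sz \<gamma>) * \<delta>) (Suc (m i)))"
      unfolding num den by (rule sign)
  qed
  also have "\<dots> = (- 1) ^ sz m * poised m s x \<gamma>"
    unfolding prod.distrib poised_def size_eq by (simp add: power_sum)
  finally show ?thesis
    unfolding s'_def .
qed

lemma
  assumes \<gamma>: "\<And>i. i \<in> I \<Longrightarrow> \<gamma> i \<le> m i" "\<And>i. i \<in> I \<Longrightarrow> \<rho> i = m i - \<gamma> i"
    and size: "sz \<rho> + sz \<gamma> = sz m"
  shows c_factor_reflected: "c_factor m (- s - 2 * of_nat (sz m) * \<delta>) (reflected m x) (d - s - of_nat (sz m) * \<delta>) \<rho>
      = (- 1) ^ sz m * d_factor m s x d \<gamma>"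
    and d_factor_reflected: "d_factor m (- s - 2 * of_nat (sz m) * \<delta>) (reflected m x) (c - s - of_nat (sz m) * \<delta>) \<rho>
      = (- 1) ^ sz m * c_factor m s x c \<gamma>"
proof -
  define s' where "s' = - s - 2 * of_nat (sz m) * \<delta>"
  have M: "of_nat (sz m) = (of_nat (sz \<rho>) + of_nat (sz \<gamma>) :: complex)"
    unfolding size[symmetric] by simp
  have mi: "m i = \<gamma> i + \<rho> i" if "i \<in> I" for i
    using \<gamma>[OF that] by simp
  have diff: "sz m - sz \<rho> = sz \<gamma>" "sz m - sz \<gamma> = sz \<rho>"
    using size by simp_all
  have sign: "(- 1) ^ sz \<gamma> * (- 1) ^ sz \<rho> = ((- 1) ^ (sz m) :: complex)"
    unfolding size[symmetric] by (simp only: power_add mult.commute)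
  have "ph (\<delta> + s' - (d - s - of_nat (sz m) * \<delta>) + of_nat (sz \<rho>) * \<delta>) (sz \<gamma>) = (- 1) ^ sz \<gamma> * ph d (sz \<gamma>)"
    by (rule ph_reflect) (simp add: s'_def M algebra_simps)
  moreover have "(\<Prod>i\<in>I. ph (d - s - of_nat (sz m) * \<delta> + reflected m x i) (\<rho> i))
      = (\<Prod>i\<in>I. (- 1) ^ \<rho> i * ph (\<delta> + s - d + x i + of_nat (\<gamma> i) * \<delta>) (m i - \<gamma> i))"
  proof (rule prod.cong[OF refl])
    fix i assume i: "i \<in> I"
    have "ph (d - s - of_nat (sz m) * \<delta> + reflected m x i) (\<rho> i) = (- 1) ^ \<rho> i * ph (\<delta> + s - d + x i + of_nat (\<gamma> i) * \<delta>) (\<rho> i)"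
      by (rule ph_reflect) (simp add: reflected_def mi[OF i] algebra_simps)
    then show "ph (d - s - of_nat (sz m) * \<delta> + reflected m x i) (\<rho> i)
        = (- 1) ^ \<rho> i * ph (\<delta> + s - d + x i + of_nat (\<gamma> i) * \<delta>) (m i - \<gamma> i)"
      using \<gamma>(2)[OF i] by simp
  qed
  ultimately show "c_factor m (- s - 2 * of_nat (sz m) * \<delta>) (reflected m x) (d - s - of_nat (sz m) * \<delta>) \<rho>
      = (- 1) ^ sz m * d_factor m s x d \<gamma>"
    unfolding s'_def[symmetric] c_factor_def d_factor_def diff sign[symmetric]
    by (simp add: prod.distrib power_sum[symmetric] size_eq[symmetric] mult_ac)
  have "ph (c - s - of_nat (sz m) * \<delta>) (sz \<rho>) = (- 1) ^ sz \<rho> * ph (\<delta> + s - c + of_nat (sz \<gamma>) * \<delta>) (sz \<rho>)"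
    by (rule ph_reflect) (simp add: M algebra_simps)
  moreover have "(\<Prod>i\<in>I. ph (\<delta> + s' - (c - s - of_nat (sz m) * \<delta>) + reflected m x i + of_nat (\<rho> i) * \<delta>) (m i - \<rho> i))
      = (\<Prod>i\<in>I. (- 1) ^ \<gamma> i * ph (c + x i) (\<gamma> i))"
  proof (rule prod.cong[OF refl])
    fix i assume i: "i \<in> I"
    have "ph (\<delta> + s' - (c - s - of_nat (sz m) * \<delta>) + reflected m x i + of_nat (\<rho> i) * \<delta>) (\<gamma> i) = (- 1) ^ \<gamma> i * ph (c + x i) (\<gamma> i)"
      by (rule ph_reflect) (simp add: s'_def reflected_def mi[OF i] algebra_simps)
    then show "ph (\<delta> + s' - (c - s - of_nat (sz m) * \<delta>) + reflected m x i + of_nat (\<rho> i) * \<delta>) (m i - \<rho> i)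
        = (- 1) ^ \<gamma> i * ph (c + x i) (\<gamma> i)"
      using mi[OF i] by simp
  qed
  ultimately show "d_factor m (- s - 2 * of_nat (sz m) * \<delta>) (reflected m x) (c - s - of_nat (sz m) * \<delta>) \<rho>
      = (- 1) ^ sz m * c_factor m s x c \<gamma>"
    unfolding s'_def[symmetric] c_factor_def d_factor_def diff sign[symmetric]
    by (simp add: prod.distrib power_sum[symmetric] size_eq[symmetric] mult_ac)
qed

text \<open>
  Under \<open>\<gamma> \<mapsto> m - \<gamma>\<close> the terms correspond to each other. The factors of the \<open>c\<close> and those of the \<open>d\<close> are
  exchanged, because reversing the order of a shifted factorial turns the one into the other.
\<close>
theorem bailey_sum_reverse:
  assumes reg: "regular m s x"
  defines "u \<equiv> s + of_nat (sz m) * \<delta>"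
  shows "bailey_sum m (- s - 2 * of_nat (sz m) * \<delta>) (reflected m x) (d0 - u) (d1 - u) (d2 - u) (c0 - u) (c1 - u) (c2 - u)
    = bailey_sum m s x c0 c1 c2 d0 d1 d2"
proof -
  define rev where "rev \<gamma> = (\<lambda>i\<in>I. m i - \<gamma> i)" for \<gamma> :: "nat \<Rightarrow> nat"
  have rev_below: "rev \<gamma> \<in> below m" for \<gamma>
    by (auto simp: rev_def)
  have rev_rev: "rev (rev \<gamma>) = \<gamma>" if "\<gamma> \<in> below m" for \<gamma>
  proof (rule ext)
    fix i
    show "rev (rev \<gamma>) i = \<gamma> i"
      using below_le[OF that, of i] PiE_arb[OF that, of i] by (auto simp: rev_def)
  qed
  show ?thesis
    unfolding bailey_sum_def
  proof (rule sum.reindex_bij_witness[where i = rev and j = rev])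
    fix \<rho> assume \<rho>: "\<rho> \<in> below m"
    define \<gamma> where "\<gamma> = rev \<rho>"
    have \<gamma>: "\<gamma> i \<le> m i" "\<rho> i = m i - \<gamma> i" if "i \<in> I" for i
      using below_le[OF \<rho> that] that by (auto simp: \<gamma>_def rev_def)
    have size: "sz \<rho> + sz \<gamma> = sz m"
      unfolding size_eq sum.distrib[symmetric] using \<gamma> by (intro sum.cong) auto
    define e f g :: complex where "e = (- 1) ^ sz m" and "f = (- 1) ^ sz \<gamma>" and "g = (- 1) ^ sz \<rho>"
    have "e = f * g"
      unfolding e_def f_def g_def size[symmetric] by (simp only: power_add mult.commute)
    moreover have "g * g = 1" "e * e = 1"
      by (simp_all add: e_def g_def flip: power_mult_distrib)
    ultimately have sign: "e = f * g" "g * g = 1" "e * e = 1" .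
    have u: "z - u = z - s - of_nat (sz m) * \<delta>" for z
      by (simp add: u_def)
    have W: "weight m (reflected m x) \<rho> = weight m x \<gamma>"
      by (rule weight_reflected[OF reg \<gamma>])
    have P: "poised m (- s - 2 * of_nat (sz m) * \<delta>) (reflected m x) \<rho> = e * poised m s x \<gamma>"
      unfolding e_def by (rule poised_reflected[OF \<gamma> size])
    have C: "c_factor m (- s - 2 * of_nat (sz m) * \<delta>) (reflected m x) (d - u) \<rho> = e * d_factor m s x d \<gamma>" for d
      unfolding e_def u by (rule c_factor_reflected[OF \<gamma> size])
    have D: "d_factor m (- s - 2 * of_nat (sz m) * \<delta>) (reflected m x) (c - u) \<rho> = e * c_factor m s x c \<gamma>" for c
      unfolding e_def u by (rule d_factor_reflected[OF \<gamma> size])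
    show "bailey_term m s x c0 c1 c2 d0 d1 d2 (rev \<rho>)
      = bailey_term m (- s - 2 * of_nat (sz m) * \<delta>) (reflected m x) (d0 - u) (d1 - u) (d2 - u) (c0 - u) (c1 - u) (c2 - u) \<rho>"
      unfolding \<gamma>_def[symmetric] bailey_term_def W P C D f_def[symmetric] g_def[symmetric]
      using sign by algebra
  qed (use rev_below rev_rev in auto)
qed

lemma bailey_sum_swap:
  "bailey_sum m s x c0 c1 c2 d0 d1 d2 = bailey_sum m s x c1 c0 c2 d0 d1 d2"
  "bailey_sum m s x c0 c1 c2 d0 d1 d2 = bailey_sum m s x c0 c2 c1 d0 d1 d2"
  "bailey_sum m s x c0 c1 c2 d0 d1 d2 = bailey_sum m s x c0 c1 c2 d1 d0 d2"
  "bailey_sum m s x c0 c1 c2 d0 d1 d2 = bailey_sum m s x c0 c1 c2 d0 d2 d1"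
  by (simp_all add: bailey_sum_def bailey_term_def mult_ac)

text \<open>
  The three transformations used belong to the triples \<open>(c0; d1, d2)\<close>, \<open>(c1; d0, d2)\<close> and
  \<open>(c2; d0, d1)\<close>. Modulo the balancing condition they send the \<open>c\<close> to translates of the \<open>d\<close> and the \<open>d\<close>
  to translates of the \<open>c\<close>. Reversal exchanges them back.
\<close>
lemma bailey_reflection_generic:
  assumes reg: "regular m s x" "regular m s1 x" "regular m s2 x"
    and s12: "s1 = 2 * s + \<delta> - c0 - d1 - d2" "s2 = 3 * s + 2 * \<delta> - c0 - c1 - d0 - d1 - 2 * d2"
    and s': "s' = 2 * s + \<delta> - c0 - c1 - c2" and reg': "regular m s' (reflected m x)"
    and bal: "c0 + c1 + c2 + d0 + d1 + d2 = (2 + of_nat (sz m)) * \<delta> + 3 * s"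
  shows "bailey_sum m s x c0 c1 c2 d0 d1 d2
    = bailey_sum m s' (reflected m x) (s + \<delta> - c1 - c2) (s + \<delta> - c0 - c2) (s + \<delta> - c0 - c1) d0 d1 d2"
proof -
  define M :: complex where "M = of_nat (sz m)"
  note bal = bal[folded M_def]
  define s3 where "s3 = - s' - 2 * M * \<delta>"
  have reg3: "regular m s3 x"
    using regular_reflected[OF reg'] by (simp add: s3_def M_def)
  have s3: "s3 = 2 * s2 + \<delta> - c2 - (s1 + \<delta> - c1 - (s + \<delta> - c0 - d1)) - (s + \<delta> - c0 - d2)"
    unfolding s3_def s' s12 using bal by algebra
  have "bailey_sum m s x c0 c1 c2 d0 d1 d2
      = bailey_sum m s1 x c1 (s + \<delta> - d1 - d2) c2 (s + \<delta> - c0 - d2) d0 (s + \<delta> - c0 - d1)"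
    using bailey_transformation[OF reg(1,2) s12(1), of c1 c2 d0] bal bailey_sum_swap unfolding M_def by metis
  also have "\<dots> = bailey_sum m s2 x (s1 + \<delta> - d0 - (s + \<delta> - c0 - d1)) (s + \<delta> - d1 - d2) c2 (s + \<delta> - c0 - d2)
      (s1 + \<delta> - c1 - (s + \<delta> - c0 - d1)) (s1 + \<delta> - c1 - d0)"
  proof (rule bailey_transformation[OF reg(2,3)])
    show "s2 = 2 * s1 + \<delta> - c1 - d0 - (s + \<delta> - c0 - d1)"
      unfolding s12 by simp
    show "c1 + (s + \<delta> - d1 - d2) + c2 + (s + \<delta> - c0 - d2) + d0 + (s + \<delta> - c0 - d1)
        = (2 + of_nat (sz m)) * \<delta> + 3 * s1"
      unfolding s12 using bal unfolding M_def by algebra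
  qed
  also have "\<dots> = bailey_sum m s2 x c2 (s1 + \<delta> - d0 - (s + \<delta> - c0 - d1)) (s + \<delta> - d1 - d2)
      (s1 + \<delta> - c1 - d0) (s1 + \<delta> - c1 - (s + \<delta> - c0 - d1)) (s + \<delta> - c0 - d2)"
    by (metis bailey_sum_swap)
  also have "\<dots> = bailey_sum m s3 x (s2 + \<delta> - (s1 + \<delta> - c1 - (s + \<delta> - c0 - d1)) - (s + \<delta> - c0 - d2))
      (s1 + \<delta> - d0 - (s + \<delta> - c0 - d1)) (s + \<delta> - d1 - d2) (s1 + \<delta> - c1 - d0)
      (s2 + \<delta> - c2 - (s + \<delta> - c0 - d2)) (s2 + \<delta> - c2 - (s1 + \<delta> - c1 - (s + \<delta> - c0 - d1)))"
  proof (rule bailey_transformation[OF reg(3) reg3 s3])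
    show "c2 + (s1 + \<delta> - d0 - (s + \<delta> - c0 - d1)) + (s + \<delta> - d1 - d2) + (s1 + \<delta> - c1 - d0)
        + (s1 + \<delta> - c1 - (s + \<delta> - c0 - d1)) + (s + \<delta> - c0 - d2) = (2 + of_nat (sz m)) * \<delta> + 3 * s2"
      unfolding s12 using bal unfolding M_def by algebra
  qed
  also have "\<dots> = bailey_sum m s3 x (d2 - (s' + M * \<delta>)) (d1 - (s' + M * \<delta>)) (d0 - (s' + M * \<delta>))
      (s + \<delta> - c0 - c1 - (s' + M * \<delta>)) (s + \<delta> - c0 - c2 - (s' + M * \<delta>)) (s + \<delta> - c1 - c2 - (s' + M * \<delta>))"
    (is "bailey_sum m s3 x ?a0 ?a1 ?a2 ?b0 ?b1 ?b2 = bailey_sum m s3 x ?a0' ?a1' ?a2' ?b0' ?b1' ?b2'")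
  proof -
    have "?a0 = ?a0'" unfolding s12 s' using bal by algebra
    moreover have "?a1 = ?a1'" unfolding s12 s' using bal by algebra
    moreover have "?a2 = ?a2'" unfolding s12 s' using bal by algebra
    moreover have "?b0 = ?b0'" unfolding s12 s' using bal by algebra
    moreover have "?b1 = ?b2'" unfolding s12 s' using bal by algebra
    moreover have "?b2 = ?b1'" unfolding s12 s' using bal by algebra
    ultimately show ?thesis
      by (metis bailey_sum_swap)
  qed
  also have "\<dots> = bailey_sum m s3 x (d0 - (s' + M * \<delta>)) (d1 - (s' + M * \<delta>)) (d2 - (s' + M * \<delta>))
      (s + \<delta> - c1 - c2 - (s' + M * \<delta>)) (s + \<delta> - c0 - c2 - (s' + M * \<delta>)) (s + \<delta> - c0 - c1 - (s' + M * \<delta>))"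
    by (metis bailey_sum_swap)
  also have "\<dots> = bailey_sum m s' (reflected m x) (s + \<delta> - c1 - c2) (s + \<delta> - c0 - c2) (s + \<delta> - c0 - c1) d0 d1 d2"
    using bailey_sum_reverse[OF reg', of d0 d1 d2] unfolding s3_def M_def by simp
  finally show ?thesis .
qed

lemma tendsto_bailey_sum:
  assumes "(c0 \<longlongrightarrow> c0') F" "(c1 \<longlongrightarrow> c1') F" "(c2 \<longlongrightarrow> c2') F" "(d0 \<longlongrightarrow> d0') F" "(d1 \<longlongrightarrow> d1') F" "(d2 \<longlongrightarrow> d2') F"
  shows "((\<lambda>t. bailey_sum m s x (c0 t) (c1 t) (c2 t) (d0 t) (d1 t) (d2 t)) \<longlongrightarrow> bailey_sum m s x c0' c1' c2' d0' d1' d2') F"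
  unfolding bailey_sum_def bailey_term_def c_factor_def d_factor_def shifted_fact_def
  by (intro tendsto_intros isCont_tendsto_compose[OF isCont_br] assms)

text \<open>Moving \<open>c0\<close> and \<open>c2\<close> in opposite directions makes the intermediate parameters regular.\<close>
theorem bailey_reflection:
  assumes reg: "regular m s x"
    and s': "s' = 2 * s + \<delta> - c0 - c1 - c2" and reg': "regular m s' (reflected m x)"
    and bal: "c0 + c1 + c2 + d0 + d1 + d2 = (2 + of_nat (sz m)) * \<delta> + 3 * s"
  shows "bailey_sum m s x c0 c1 c2 d0 d1 d2
    = bailey_sum m s' (reflected m x) (s + \<delta> - c1 - c2) (s + \<delta> - c0 - c2) (s + \<delta> - c0 - c1) d0 d1 d2"
proof -
  have ev_reg: "\<forall>\<^sub>F t in at 0. regular m (a - t) x" for a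
  proof -
    have "\<forall>\<^sub>F t in at 0. \<forall>i\<in>I. \<forall>k\<in>{..(sz m) + m i}. br (a + x i + of_nat k * \<delta> - t) \<noteq> 0"
      by (intro eventually_ball_finite ballI eventually_br_nonzero finite_I finite_atMost)
    then show ?thesis
      by eventually_elim (use reg in \<open>auto simp: regular_def algebra_simps\<close>)
  qed
  define L where "L t = bailey_sum m s x (c0 + t) c1 (c2 - t) d0 d1 d2" for t
  define R where "R t = bailey_sum m s' (reflected m x) (s + \<delta> - c1 - (c2 - t)) (s + \<delta> - (c0 + t) - (c2 - t)) (s + \<delta> - (c0 + t) - c1) d0 d1 d2" for t
  have "\<forall>\<^sub>F t in at 0. L t = R t"
    using ev_reg[of "2 * s + \<delta> - c0 - d1 - d2"] ev_reg[of "3 * s + 2 * \<delta> - c0 - c1 - d0 - d1 - 2 * d2"]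
  proof eventually_elim
    case (elim t)
    show ?case
      unfolding L_def R_def
      by (rule bailey_reflection_generic[OF reg elim _ _ _ reg']) (use bal in \<open>simp_all add: s' algebra_simps\<close>)
  qed
  moreover have "(L \<longlongrightarrow> L 0) (at 0)" "(R \<longlongrightarrow> R 0) (at 0)"
    unfolding L_def R_def by (intro tendsto_bailey_sum tendsto_intros)+
  ultimately have "L 0 = R 0"
    by (intro tendsto_unique[OF at_neq_bot Lim_transform_eventually])
  then show ?thesis
    by (simp add: L_def R_def)
qed

section \<open>The normal form of the elliptic series\<close>

lemma prod_square_split:
  fixes f :: "nat \<Rightarrow> nat \<Rightarrow> complex"
  shows "(\<Prod>i\<in>I. \<Prod>j\<in>I. f i j) = (\<Prod>(i, j)\<in>{(i, j). 1 \<le> i \<and> i < j \<and> j \<le> n}. f i j * f j i) * (\<Prod>i\<in>I. f i i)"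
proof -
  define T where "T = {(i, j). 1 \<le> i \<and> i < j \<and> j \<le> n}"
  have T: "T \<subseteq> I \<times> I"
    by (auto simp: T_def I_def)
  then have fin: "finite T"
    by (rule finite_subset) simp
  have "I \<times> I = T \<union> prod.swap ` T \<union> (\<lambda>i. (i, i)) ` I"
    by (auto simp: T_def I_def image_iff)
  then have "(\<Prod>(i, j)\<in>I \<times> I. f i j) = (\<Prod>(i, j)\<in>T \<union> prod.swap ` T \<union> (\<lambda>i. (i, i)) ` I. f i j)"
    by (rule arg_cong)
  also have "\<dots> = (\<Prod>(i, j)\<in>T \<union> prod.swap ` T. f i j) * (\<Prod>(i, j)\<in>(\<lambda>i. (i, i)) ` I. f i j)"
    using fin by (intro prod.union_disjoint) (auto simp: T_def)
  also have "(\<Prod>(i, j)\<in>T \<union> prod.swap ` T. f i j) = (\<Prod>(i, j)\<in>T. f i j) * (\<Prod>(i, j)\<in>prod.swap ` T. f i j)"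
    using fin by (intro prod.union_disjoint) (auto simp: T_def)
  also have "(\<Prod>(i, j)\<in>prod.swap ` T. f i j) = (\<Prod>(i, j)\<in>T. f j i)"
    by (subst prod.reindex) (auto simp: case_prod_beta)
  also have "(\<Prod>(i, j)\<in>(\<lambda>i. (i, i)) ` I. f i j) = (\<Prod>i\<in>I. f i i)"
    by (subst prod.reindex) (auto simp: inj_on_def)
  finally show ?thesis
    unfolding T_def by (simp add: prod.cartesian_product prod.distrib case_prod_beta)
qed

text \<open>
  Both sides arise from splitting the shifted factorial of length \<open>a + 1 + b\<close> that starts at \<open>X - b * \<delta>\<close>.
  This is the factor of an unordered pair of indices in \<open>Delta_quotient\<close>.
\<close>
lemma ph_exchange:
  "ph (- of_nat b * \<delta> + X) a * ph (- of_nat a * \<delta> - X) b * br (X + of_nat a * \<delta> - of_nat b * \<delta>)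
    = br X * (ph (\<delta> + X) a * ph (\<delta> - X) b)"
proof -
  define y where "y = - of_nat b * \<delta> + X"
  define z where "z = \<delta> + X + of_nat a * \<delta> - of_nat b * \<delta>"
  have "ph y (Suc a + b) = ph y (Suc a) * ph z b"
    by (rule ph_split) (simp_all add: y_def z_def algebra_simps)
  then have 1: "ph y (Suc a + b) = ph y a * br (X + of_nat a * \<delta> - of_nat b * \<delta>) * ph z b"
    by (simp add: ph_Suc y_def algebra_simps)
  have "ph y (Suc a + b) = ph y (Suc b) * ph (\<delta> + X) a"
    by (rule ph_split) (simp_all add: y_def algebra_simps)
  then have 2: "ph y (Suc a + b) = ph y b * br X * ph (\<delta> + X) a"
    by (simp add: ph_Suc y_def algebra_simps)
  have 3: "ph (- of_nat a * \<delta> - X) b = (- 1) ^ b * ph z b"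
    by (rule ph_reflect) (simp add: z_def)
  have 4: "ph (\<delta> - X) b = (- 1) ^ b * ph y b"
    by (rule ph_reflect) (simp add: y_def)
  show ?thesis
    unfolding 3 4 y_def[symmetric] using 1 2 by (simp add: mult_ac)
qed

lemma ph_difference_nonzero:
  assumes "regular m s x" "i \<in> I" "j \<in> I" "a \<le> m i"
  shows "ph (\<delta> + x i - x j) a \<noteq> 0"
proof (cases "i = j")
  case True
  have "br (\<delta> + of_nat r * \<delta>) \<noteq> 0" for r
    using br_step[of "int (Suc r)"] by (simp add: algebra_simps)
  then show ?thesis
    using True by (auto simp: ph_eq_0_iff)
next
  case False
  have "br (\<delta> + x i - x j + of_nat r * \<delta>) \<noteq> 0" if "r < a" for r
    using regular_differenceD[OF assms(1-3) False, of "int (Suc r)"] that assms(4)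
    by (simp add: algebra_simps)
  then show ?thesis
    by (auto simp: ph_eq_0_iff)
qed

lemma Delta_quotient:
  assumes reg: "regular m s x" and \<gamma>: "\<And>i. i \<in> I \<Longrightarrow> \<gamma> i \<le> m i"
  shows "Delta br n (\<lambda>i. x i + of_nat (\<gamma> i) * \<delta>) / Delta br n x
      * (\<Prod>j\<in>I. \<Prod>i\<in>I. ph (- of_nat (m j) * \<delta> + x i - x j) (\<gamma> i) / ph (\<delta> + x i - x j) (\<gamma> i))
    = (- 1) ^ sz \<gamma> * weight m x \<gamma>"
proof -
  define T where "T = {(i, j). 1 \<le> i \<and> i < j \<and> j \<le> n}"
  define f where "f i j = ph (- of_nat (\<gamma> j) * \<delta> + x i - x j) (\<gamma> i) / ph (\<delta> + x i - x j) (\<gamma> i)" for i j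
  have nz1: "ph (- of_nat (\<gamma> j) * \<delta> + x i - x j) (\<gamma> i) \<noteq> 0" if "i \<in> I" "j \<in> I" for i j
    by (rule weight_denominator_nonzero[OF reg that \<gamma>[OF that(1)] \<gamma>[OF that(2)]])
  have nz2: "ph (\<delta> + x i - x j) (\<gamma> i) \<noteq> 0" if "i \<in> I" "j \<in> I" for i j
    by (rule ph_difference_nonzero[OF reg that \<gamma>[OF that(1)]])
  have diag: "f i i = (- 1) ^ \<gamma> i" if "i \<in> I" for i
  proof -
    have "ph (- of_nat (\<gamma> i) * \<delta>) (\<gamma> i) = (- 1) ^ \<gamma> i * ph \<delta> (\<gamma> i)"
      by (rule ph_reflect) simp
    then show ?thesis
      using nz2[OF that that] by (simp add: f_def)
  qed
  have pair: "(br (x i + of_nat (\<gamma> i) * \<delta> - (x j + of_nat (\<gamma> j) * \<delta>)) / br (x i - x j)) * (f i j * f j i) = 1"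
    if "(i, j) \<in> T" for i j
  proof -
    have ij: "i \<in> I" "j \<in> I" "i \<noteq> j"
      using that by (auto simp: T_def I_def)
    have br0: "br (x i - x j) \<noteq> 0"
      using regular_differenceD[OF reg ij, of 0] by simp
    have args: "- of_nat (\<gamma> j) * \<delta> + (x i - x j) = - of_nat (\<gamma> j) * \<delta> + x i - x j"
      "- of_nat (\<gamma> i) * \<delta> - (x i - x j) = - of_nat (\<gamma> i) * \<delta> + x j - x i"
      "x i - x j + of_nat (\<gamma> i) * \<delta> - of_nat (\<gamma> j) * \<delta> = x i + of_nat (\<gamma> i) * \<delta> - (x j + of_nat (\<gamma> j) * \<delta>)"
      "\<delta> + (x i - x j) = \<delta> + x i - x j" "\<delta> - (x i - x j) = \<delta> + x j - x i"
      by simp_all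
    show ?thesis
      using ph_exchange[of "\<gamma> j" "x i - x j" "\<gamma> i", unfolded args] nz2[OF ij(1,2)] nz2[OF ij(2,1)] br0
      by (simp add: f_def field_simps)
  qed
  have "Delta br n (\<lambda>i. x i + of_nat (\<gamma> i) * \<delta>) / Delta br n x * (\<Prod>(i, j)\<in>T. f i j * f j i)
      = (\<Prod>(i, j)\<in>T. (br (x i + of_nat (\<gamma> i) * \<delta> - (x j + of_nat (\<gamma> j) * \<delta>)) / br (x i - x j)) * (f i j * f j i))"
    unfolding Delta_def T_def[symmetric] prod_dividef[symmetric] prod.distrib[symmetric]
    by (intro prod.cong) auto
  also have "\<dots> = 1"
    by (intro prod.neutral) (use pair in auto)
  finally have "Delta br n (\<lambda>i. x i + of_nat (\<gamma> i) * \<delta>) / Delta br n x * (\<Prod>i\<in>I. \<Prod>j\<in>I. f i j) = (\<Prod>i\<in>I. f i i)"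
    unfolding prod_square_split T_def by (simp flip: mult.assoc)
  also have "\<dots> = (- 1) ^ sz \<gamma>"
    by (simp add: diag size_eq power_sum)
  finally have main: "Delta br n (\<lambda>i. x i + of_nat (\<gamma> i) * \<delta>) / Delta br n x * (\<Prod>i\<in>I. \<Prod>j\<in>I. f i j) = (- 1) ^ sz \<gamma>" .
  have "(\<Prod>j\<in>I. \<Prod>i\<in>I. ph (- of_nat (m j) * \<delta> + x i - x j) (\<gamma> i) / ph (\<delta> + x i - x j) (\<gamma> i))
      = (\<Prod>i\<in>I. \<Prod>j\<in>I. ph (- of_nat (m j) * \<delta> + x i - x j) (\<gamma> i) / ph (\<delta> + x i - x j) (\<gamma> i))"
    by (rule prod.swap)
  also have "\<dots> = (\<Prod>i\<in>I. \<Prod>j\<in>I. f i j) * weight m x \<gamma>"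
    unfolding weight_def prod.distrib[symmetric] by (intro prod.cong refl) (use nz1 nz2 in \<open>simp add: f_def\<close>)
  finally have W: "(\<Prod>j\<in>I. \<Prod>i\<in>I. ph (- of_nat (m j) * \<delta> + x i - x j) (\<gamma> i) / ph (\<delta> + x i - x j) (\<gamma> i))
      = (\<Prod>i\<in>I. \<Prod>j\<in>I. f i j) * weight m x \<gamma>" .
  show ?thesis
    unfolding W main[symmetric] by (simp only: mult.assoc)
qed

text \<open>
  The conditions for \<open>\<gamma> = m\<close> contain those for all other \<open>\<gamma>\<close>.
\<close>
lemma generic_imp_regular:
  assumes "generic br n m (s, c, d, \<delta>, x)"
  shows "regular m s x"
proof -
  define \<mu> where "\<mu> = restrict m I"
  have \<mu>: "\<mu> \<in> below m" "sz \<mu> = sz m" "\<And>i. i \<in> I \<Longrightarrow> \<mu> i = m i"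
    by (auto simp: \<mu>_def I_def mi_size_def)
  note g = assms[unfolded generic.simps Let_def, folded I_def]
  note top = bspec[OF conjunct2[OF conjunct2[OF g]] \<mu>(1)]
  have D: "Delta br n x \<noteq> 0"
    using g by (rule conjunct1)
  have s: "br (s + x i) \<noteq> 0" "ph (\<delta> + s + x i) (m i) \<noteq> 0" if "i \<in> I" for i
    using bspec[OF conjunct1[OF conjunct2[OF g]] that] by simp_all
  have m1: "ph (\<delta> + s - - of_nat (m j) * \<delta> + x j) (sz m) \<noteq> 0" if "j \<in> I" for j
    using bspec[OF conjunct1[OF top] that] \<mu>(2) by simp
  have m2: "ph (\<delta> + x i - x j) (m i) \<noteq> 0" if "i \<in> I" "j \<in> I" for i j
    using bspec[OF conjunct1[OF top] that(2)] \<mu>(3)[OF that(1)] that(1) by fastforce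
  show ?thesis
    unfolding regular_def
  proof (intro conjI ballI allI impI)
    fix i j k assume ij: "i \<in> I" "j \<in> I" "i \<noteq> j" and k: "- int (m j) \<le> k" "k \<le> int (m i)"
    have pos: "br (x i - x j + of_nat (Suc r) * \<delta>) \<noteq> 0" if "i \<in> I" "j \<in> I" "r < m i" for i j r
      using m2[OF that(1,2)] that(3) by (auto simp: ph_eq_0_iff algebra_simps)
    have zero: "br (x i - x j) \<noteq> 0" if "i \<in> I" "j \<in> I" "i < j" for i j
    proof
      assume "br (x i - x j) = 0"
      moreover have "finite {(i, j). 1 \<le> i \<and> i < j \<and> j \<le> n}"
        by (rule finite_subset[of _ "I \<times> I"]) (auto simp: I_def)
      ultimately have "Delta br n x = 0"
        unfolding Delta_def using that by (intro prod_zero) (auto simp: I_def)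
      with D show False ..
    qed
    have "k = 0 \<or> (\<exists>r. k = int (Suc r)) \<or> (\<exists>r. k = - int (Suc r))"
      by (cases k rule: int_cases3) (auto dest: gr0_implies_Suc)
    then consider "k = 0" | r where "k = int (Suc r)" | r where "k = - int (Suc r)"
      by blast
    then show "br (x i - x j + of_int k * \<delta>) \<noteq> 0"
    proof cases
      case 1
      then show ?thesis
        using zero[of i j] zero[of j i] ij odd_diff[of "x i" "x j"] by (cases i j rule: linorder_cases) auto
    next
      case 2
      then show ?thesis
        using pos[OF ij(1,2), of r] k by simp
    next
      case 3
      have eq: "x i - x j + of_int k * \<delta> = - (x j - x i + of_nat (Suc r) * \<delta>)"
        unfolding 3 by (simp add: algebra_simps)
      have "br (x j - x i + of_nat (Suc r) * \<delta>) \<noteq> 0"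
        by (rule pos[OF ij(2,1)]) (use k 3 in simp)
      then show ?thesis
        unfolding eq odd by simp
    qed
  next
    fix i k assume i: "i \<in> I" and k: "k \<le> sz m + m i"
    consider "k = 0" | r where "k = Suc r" "r < m i" | r where "k = Suc (m i + r)" "r < sz m"
    proof (cases "k \<le> m i")
      case True
      then show ?thesis
        using that(1,2) by (cases k) auto
    next
      case False
      then have "k = Suc (m i + (k - Suc (m i)))" "k - Suc (m i) < sz m"
        using k by auto
      then show ?thesis
        using that(3) by blast
    qed
    then show "br (s + x i + of_nat k * \<delta>) \<noteq> 0"
    proof cases
      case 1
      then show ?thesis
        using s(1)[OF i] by simp
    next
      case 2
      then show ?thesis
        using s(2)[OF i] by (auto simp: ph_eq_0_iff algebra_simps)
    next
      case 3
      then show ?thesis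
        using m1[OF i] by (auto simp: ph_eq_0_iff algebra_simps)
    qed
  qed
qed

text \<open>
  The normalising factor extends the shifted factorials in the denominators of the \<open>c\<close> and the \<open>d\<close> to their
  full lengths \<open>sz m\<close> and \<open>m i\<close>, and merges the three denominators with \<open>s + x i\<close> into a single one.
\<close>
lemma E_term_normal_form:
  assumes gen: "generic br n m (s, c, d, \<delta>, x)" and \<gamma>: "\<gamma> \<in> below m"
  shows "(\<Prod>k=0..2. ph (\<delta> + s - c k) (sz m) * (\<Prod>i\<in>I. ph (\<delta> + s - d k + x i) (m i)))
      / (\<Prod>i\<in>I. ph (\<delta> + s + x i) (m i)) * E_term br n m (s, c, d, \<delta>, x) \<gamma>
    = bailey_term m s x (c 0) (c 1) (c 2) (d 0) (d 1) (d 2) \<gamma>"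
proof -
  have reg: "regular m s x"
    using gen by (rule generic_imp_regular)
  define N where "N = sz \<gamma>"
  have le: "\<gamma> i \<le> m i" if "i \<in> I" for i
    using \<gamma> that by (rule below_le)
  have NM: "N \<le> sz m"
    unfolding N_def by (rule size_mono[OF le])
  note g = bspec[OF conjunct2[OF conjunct2[OF gen[unfolded generic.simps Let_def, folded I_def]]] \<gamma>, THEN conjunct2]
  have nz: "ph (\<delta> + s - c k) N \<noteq> 0" "\<And>i. i \<in> I \<Longrightarrow> ph (\<delta> + s - d k + x i) (\<gamma> i) \<noteq> 0" if "k \<in> {0..2}" for k
    using bspec[OF g that] by (simp_all add: N_def)
  have factor: "ph (\<delta> + s - c k) (sz m) * (\<Prod>i\<in>I. ph (\<delta> + s - d k + x i) (m i))
      * (ph (d k) N / ph (\<delta> + s - c k) N * (\<Prod>i\<in>I. ph (c k + x i) (\<gamma> i) / ph (\<delta> + s - d k + x i) (\<gamma> i)))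
    = c_factor m s x (c k) \<gamma> * d_factor m s x (d k) \<gamma>" if k: "k \<in> {0..2}" for k
  proof -
    have 1: "ph (\<delta> + s - c k) (sz m) = ph (\<delta> + s - c k) N * ph (\<delta> + s - c k + of_nat N * \<delta>) (sz m - N)"
      by (rule ph_split) (use NM in simp_all)
    have "(\<Prod>i\<in>I. ph (\<delta> + s - d k + x i) (m i))
        = (\<Prod>i\<in>I. ph (\<delta> + s - d k + x i) (\<gamma> i) * ph (\<delta> + s - d k + x i + of_nat (\<gamma> i) * \<delta>) (m i - \<gamma> i))"
      using le by (intro prod.cong refl ph_split) auto
    then have 2: "(\<Prod>i\<in>I. ph (\<delta> + s - d k + x i) (m i)) = (\<Prod>i\<in>I. ph (\<delta> + s - d k + x i) (\<gamma> i))
        * (\<Prod>i\<in>I. ph (\<delta> + s - d k + x i + of_nat (\<gamma> i) * \<delta>) (m i - \<gamma> i))"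
      by (simp only: prod.distrib)
    have "(\<Prod>i\<in>I. ph (\<delta> + s - d k + x i) (\<gamma> i)) \<noteq> 0"
      using nz(2)[OF k] by simp
    then show ?thesis
      unfolding 1 2 c_factor_def d_factor_def N_def[symmetric] prod_dividef using nz(1)[OF k] by simp
  qed
  have "(\<Prod>i\<in>I. br (of_nat (N + \<gamma> i) * \<delta> + s + x i) / br (s + x i)
        * (ph (s + x i) N / ph (\<delta> + s - - of_nat (m i) * \<delta> + x i) N) / ph (\<delta> + s + x i) (m i))
      = poised m s x \<gamma>"
    unfolding poised_def N_def[symmetric]
  proof (rule prod.cong[OF refl])
    fix i assume i: "i \<in> I"
    have 0: "ph (s + x i + of_nat 0 * \<delta>) (m i + 1) \<noteq> 0"
      by (rule poised_denominator_nonzero[OF reg i]) simp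
    have "ph (s + x i + of_nat (Suc (m i)) * \<delta>) N \<noteq> 0"
      by (rule poised_denominator_nonzero[OF reg i]) (use NM in simp)
    moreover have "ph (s + x i + of_nat N * \<delta>) (Suc (m i)) \<noteq> 0"
      by (rule poised_denominator_nonzero[OF reg i]) (use NM in simp)
    ultimately have 1: "ph (s + x i + of_nat (Suc (m i)) * \<delta>) N \<noteq> 0" "ph (s + x i + of_nat N * \<delta>) (Suc (m i)) \<noteq> 0" .
    have split1: "ph (s + x i) (Suc (m i)) = br (s + x i) * ph (\<delta> + s + x i) (m i)"
      using ph_split[of "Suc (m i)" 1 "m i" "\<delta> + s + x i" "s + x i"] by (simp add: ph_Suc add_ac)
    have "ph (s + x i) (N + Suc (m i)) = ph (s + x i) N * ph (s + x i + of_nat N * \<delta>) (Suc (m i))"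
      by (rule ph_split) simp_all
    moreover have "ph (s + x i) (N + Suc (m i)) = ph (s + x i) (Suc (m i)) * ph (s + x i + of_nat (Suc (m i)) * \<delta>) N"
      by (rule ph_split) simp_all
    ultimately have eq: "br (s + x i) * ph (\<delta> + s + x i) (m i) * ph (s + x i + of_nat (Suc (m i)) * \<delta>) N
        = ph (s + x i) N * ph (s + x i + of_nat N * \<delta>) (Suc (m i))"
      unfolding split1 by simp
    have arg: "\<delta> + s - - of_nat (m i) * \<delta> + x i = s + x i + of_nat (Suc (m i)) * \<delta>"
      by (simp add: algebra_simps)
    have nz: "br (s + x i) \<noteq> 0" "ph (\<delta> + s + x i) (m i) \<noteq> 0"
      using 0 split1 by auto
    then have "ph (s + x i) N \<noteq> 0"
      using eq 1 by auto
    then show "br (of_nat (N + \<gamma> i) * \<delta> + s + x i) / br (s + x i)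
        * (ph (s + x i) N / ph (\<delta> + s - - of_nat (m i) * \<delta> + x i) N) / ph (\<delta> + s + x i) (m i)
      = br (of_nat (N + \<gamma> i) * \<delta> + s + x i) / ph (s + x i + of_nat N * \<delta>) (Suc (m i))"
      using 1 nz eq unfolding arg by (simp add: frac_eq_eq mult_ac)
  qed
  then have P: "(\<Prod>i\<in>I. br (of_nat (N + \<gamma> i) * \<delta> + s + x i) / br (s + x i))
      * (\<Prod>i\<in>I. ph (s + x i) N / ph (\<delta> + s - - of_nat (m i) * \<delta> + x i) N) / (\<Prod>i\<in>I. ph (\<delta> + s + x i) (m i))
      = poised m s x \<gamma>"
    by (simp only: prod.distrib prod_dividef)
  have three: "(\<Prod>k=0..2. g k) = g 0 * g 1 * g 2" for g :: "nat \<Rightarrow> complex"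
    by (simp add: numeral_2_eq_2)
  define F where "F k = ph (\<delta> + s - c k) (sz m) * (\<Prod>i\<in>I. ph (\<delta> + s - d k + x i) (m i))" for k
  define G where "G k = ph (d k) N / ph (\<delta> + s - c k) N * (\<Prod>i\<in>I. ph (c k + x i) (\<gamma> i) / ph (\<delta> + s - d k + x i) (\<gamma> i))" for k
  have FG: "F k * G k = c_factor m s x (c k) \<gamma> * d_factor m s x (d k) \<gamma>" if "k \<in> {0..2}" for k
    unfolding F_def G_def by (rule factor[OF that])
  define A where "A = Delta br n (\<lambda>i. x i + of_nat (\<gamma> i) * \<delta>) / Delta br n x"
  define B where "B = (\<Prod>i\<in>I. br (of_nat (N + \<gamma> i) * \<delta> + s + x i) / br (s + x i))"
  define B' where "B' = (\<Prod>i\<in>I. ph (s + x i) N / ph (\<delta> + s - - of_nat (m i) * \<delta> + x i) N)"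
  define W where "W = (\<Prod>j\<in>I. \<Prod>i\<in>I. ph (- of_nat (m j) * \<delta> + x i - x j) (\<gamma> i) / ph (\<delta> + x i - x j) (\<gamma> i))"
  define Q where "Q = (\<Prod>i\<in>I. ph (\<delta> + s + x i) (m i))"
  have E: "E_term br n m (s, c, d, \<delta>, x) \<gamma> = A * B * (B' * W) * (\<Prod>k=0..2. G k)"
    unfolding E_term.simps Let_def I_def[symmetric] N_def[symmetric] A_def B_def B'_def W_def G_def prod.distrib ..
  have "(\<Prod>k=0..2. F k) / Q * E_term br n m (s, c, d, \<delta>, x) \<gamma>
      = (A * W) * (B * B' / Q) * ((F 0 * G 0) * (F 1 * G 1) * (F 2 * G 2))"
    unfolding E three by (simp add: divide_inverse mult_ac)
  also have "A * W = (- 1) ^ sz \<gamma> * weight m x \<gamma>"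
    unfolding A_def W_def by (rule Delta_quotient[OF reg le])
  also have "B * B' / Q = poised m s x \<gamma>"
    unfolding B_def B'_def Q_def by (rule P)
  also have "(F 0 * G 0) * (F 1 * G 1) * (F 2 * G 2) = (c_factor m s x (c 0) \<gamma> * d_factor m s x (d 0) \<gamma>)
      * (c_factor m s x (c 1) \<gamma> * d_factor m s x (d 1) \<gamma>) * (c_factor m s x (c 2) \<gamma> * d_factor m s x (d 2) \<gamma>)"
    using FG[of 0] FG[of 1] FG[of 2] by simp
  finally show ?thesis
    unfolding F_def[symmetric] Q_def[symmetric] bailey_term_def by (simp only: mult_ac)
qed

theorem E_tilde_eq_bailey_sum:
  assumes gen: "generic br n m (s, c, d, \<delta>, x)"
  shows "E_tilde br n m (s, c, d, \<delta>, x) = bailey_sum m s x (c 0) (c 1) (c 2) (d 0) (d 1) (d 2)"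
proof -
  have "E_series br n m (s, c, d, \<delta>, x) = (\<Sum>\<gamma>\<in>below m. E_term br n m (s, c, d, \<delta>, x) \<gamma>)"
    unfolding I_def by (rule E_series_terminates) simp
  then show ?thesis
    unfolding E_tilde.simps Let_def I_def[symmetric] bailey_sum_def
    by (simp only: sum_distrib_left E_term_normal_form[OF gen] cong: sum.cong)
qed

theorem E_tilde_invariant:
  assumes gen: "generic br n m (s, c, d, \<delta>, x)" and bal: "balanced n m (s, c, d, \<delta>, x)"
    and T: "T \<in> {b1_tr, b2_tr n m, s_tr 0, s_tr 1, t_tr 0, t_tr 1}"
    and genT: "generic br n m (T (s, c, d, \<delta>, x))"
  shows "E_tilde br n m (T (s, c, d, \<delta>, x)) = E_tilde br n m (s, c, d, \<delta>, x)"
proof -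
  have bal': "c 0 + c 1 + c 2 + d 0 + d 1 + d 2 = (2 + of_nat (sz m)) * \<delta> + 3 * s"
    using bal by (simp add: add_ac)
  note reg = generic_imp_regular[OF gen]
  from T consider "T = b1_tr" | "T = b2_tr n m" | "T = s_tr 0" | "T = s_tr 1" | "T = t_tr 0" | "T = t_tr 1"
    by blast
  then show ?thesis
  proof cases
    case 1
    note gen' = genT[unfolded 1 b1_tr.simps]
    show ?thesis
      unfolding 1 b1_tr.simps E_tilde_eq_bailey_sum[OF gen'] E_tilde_eq_bailey_sum[OF gen]
      using bailey_transformation[OF reg generic_imp_regular[OF gen'] refl bal'] by simp
  next
    case 2
    have refl: "(\<lambda>i. - of_nat (m i) * \<delta> - x i + of_nat (sz m) * \<delta>) = reflected m x"
      by (simp add: reflected_def fun_eq_iff)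
    note gen' = genT[unfolded 2 b2_tr.simps refl]
    show ?thesis
      unfolding 2 b2_tr.simps refl E_tilde_eq_bailey_sum[OF gen'] E_tilde_eq_bailey_sum[OF gen]
      using bailey_reflection[OF reg HOL.refl generic_imp_regular[OF gen'] bal'] by simp
  next
    case 3
    show ?thesis
      unfolding 3 s_tr.simps E_tilde_eq_bailey_sum[OF genT[unfolded 3 s_tr.simps]] E_tilde_eq_bailey_sum[OF gen]
      using bailey_sum_swap(1)[of m s x "c 0" "c 1" "c 2" "d 0" "d 1" "d 2"] by (simp add: numeral_2_eq_2)
  next
    case 4
    show ?thesis
      unfolding 4 s_tr.simps E_tilde_eq_bailey_sum[OF genT[unfolded 4 s_tr.simps]] E_tilde_eq_bailey_sum[OF gen]
      using bailey_sum_swap(2)[of m s x "c 0" "c 1" "c 2" "d 0" "d 1" "d 2"] by (simp add: numeral_2_eq_2)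
  next
    case 5
    show ?thesis
      unfolding 5 t_tr.simps E_tilde_eq_bailey_sum[OF genT[unfolded 5 t_tr.simps]] E_tilde_eq_bailey_sum[OF gen]
      using bailey_sum_swap(3)[of m s x "c 0" "c 1" "c 2" "d 0" "d 1" "d 2"] by (simp add: numeral_2_eq_2)
  next
    case 6
    show ?thesis
      unfolding 6 t_tr.simps E_tilde_eq_bailey_sum[OF genT[unfolded 6 t_tr.simps]] E_tilde_eq_bailey_sum[OF gen]
      using bailey_sum_swap(4)[of m s x "c 0" "c 1" "c 2" "d 0" "d 1" "d 2"] by (simp add: numeral_2_eq_2)
  qed
qed

end

section \<open>Invariance for the sigma function\<close>

theorem proposition3p2:
  fixes \<omega>1 \<omega>2 \<delta> s :: complex
    and n :: nat and m :: "nat \<Rightarrow> nat"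
    and c d x :: "nat \<Rightarrow> complex"
  assumes lattice: "\<omega>1 \<noteq> 0" "\<omega>2 / \<omega>1 \<notin> \<real>"
    and delta: "\<And>p q :: rat. \<delta> \<noteq> of_rat p * \<omega>1 + of_rat q * \<omega>2"
    and n: "n \<ge> 2"
    and generic: "generic (weierstrass_sigma \<omega>1 \<omega>2) n m (s, c, d, \<delta>, x)"
    and balanced: "balanced n m (s, c, d, \<delta>, x)"
  shows "\<forall>T\<in>{b1_tr, b2_tr n m, s_tr 0, s_tr 1, t_tr 0, t_tr 1}.
           generic (weierstrass_sigma \<omega>1 \<omega>2) n m (T (s, c, d, \<delta>, x)) \<longrightarrow>
           E_tilde (weierstrass_sigma \<omega>1 \<omega>2) n m (T (s, c, d, \<delta>, x))
             = E_tilde (weierstrass_sigma \<omega>1 \<omega>2) n m (s, c, d, \<delta>, x)"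
proof -
  interpret sigma_lattice \<omega>1 \<omega>2
    using lattice by unfold_locales
  interpret elliptic_bracket "weierstrass_sigma \<omega>1 \<omega>2" \<delta> n
  proof
    fix k :: int
    assume k: "k \<noteq> 0"
    show "weierstrass_sigma \<omega>1 \<omega>2 (of_int k * \<delta>) \<noteq> 0"
    proof
      assume "weierstrass_sigma \<omega>1 \<omega>2 (of_int k * \<delta>) = 0"
      then obtain a b :: int where "of_int k * \<delta> = of_int a * \<omega>1 + of_int b * \<omega>2"
        by (auto simp: sigma_eq_0_iff period_lattice_def)
      then have "\<delta> = of_rat (of_int a / of_int k) * \<omega>1 + of_rat (of_int b / of_int k) * \<omega>2"
        using k by (simp add: of_rat_divide field_simps)
      then show False
        using delta by blast
    qed
  qed (rule sigma_odd sigma_three_term sigma_isCont sigma_isolated_zeros)+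
  show ?thesis
    using E_tilde_invariant[OF generic balanced] by blast
qed

end
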